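(* Suppose the step-size, compactness, ergodicity, kernel-continuity, growth, interior-target and quasi-strong-monotonicity conditions listed in the context all hold, with $0<\delta\le1$. When $\delta=1$, suppose also that $2\zeta\alpha_0>1$. Then there are positive constants $C$ and $K$ such that, for all $k\ge K$, $$\mathbb E\bigl[\|\theta_k-\theta^\star\|^2\mid\mathcal F_0\bigr]\le C\,U_2(W_0)(1+\log k)\,k^{-\delta}.$$
   Context: Setting. $\|\cdot\|$ is the Euclidean norm and $\langle\cdot,\cdot\rangle$ the Euclidean inner product. $\Theta\subseteq\mathbb R^d$, and $\Pi_\Theta$ is Euclidean projection onto $\Theta$. $\mathcal W$ is a Borel subset of a Euclidean space, $F:\Theta\times\mathcal W\to\mathbb R^d$ is jointly Borel measurable, and $\{P_\theta:\theta\in\Theta\}$ is a family of Markov transition kernels on $\mathcal W$ with $(\theta,w)\mapsto P_\theta(w,E)$ Borel measurable for each Borel $E\subseteq\mathcal W$. Write $(P_\theta f)(w):=\int_{\mathcal W}f(y)P_\theta(w,dy)$, $P_\theta^k$ for the $k$-step kernel, and $U_p(w):=1+\|w\|^p$ for $p\in\{1,2\}$. On a probability space, $(\theta_0,W_0)$ is a $\Theta\times\mathcal W$-valued random element, and $$\theta_{k+1}=\Pi_\Theta\bigl(\theta_k+\alpha_kF(\theta_k,W_k)\bigr),\qquad k\ge0.$$ With $\mathcal F_k:=\sigma(\theta_0,W_0,\dots,\theta_k,W_k)$, $\{W_k\}$ is the adaptive Markov chain: $\mathbb P(W_{k+1}\in E\mid\mathcal F_k)=P_{\theta_k}(W_k,E)$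 for all Borel $E$ and $k\ge0$. (In)equalities between random quantities hold almost surely. Constants are deterministic; they may depend on fixed model and result parameters but not on running indices, sample paths, or the realization of $(\theta_0,W_0)$. Conditions. - Step sizes: $\alpha_0>0$, $\delta\in(0,1]$, and $\alpha_k=\alpha_0k^{-\delta}$ for all $k\ge1$ (the step size at $k=0$ is $\alpha_0$). - Compactness: $\Theta$ is nonempty, compact and convex. - Ergodicity: (i) each $P_\theta$ is irreducible and aperiodic (as a general-state-space chain); there are a positive integer $N$, a nonempty Borel set $\mathcal W_0\subseteq\mathcal W$, $\epsilon_0>0$ and a probability measure $\varphi$ on $\mathcal W$ with $P_\theta^N(w,E)\ge\epsilon_0\varphi(E)$ for all $\theta\in\Theta$, $w\in\mathcal W_0$ and Borel $E$; and there are constants $0\le\lambda<1$, $b\ge0$ with $(P_\theta U_2)(w)\le\lambda U_2(w)+b\,\mathbb I_{\mathcal W_0}(w)$ for all $\theta\in\Theta$, $w\in\mathcal W$. (ii) $\mathbb E[U_2(W_0)]<\infty$. Part (i) ensures that each $P_\theta$ has a unique stationary distribution $\nu_\theta$ and $\sup_\theta\nu_\theta(U_2)<\infty$. The mean field is $\bar F(\theta):=\int_{\mathcal W}F(\theta,w)\,\nu_\theta(dw)$. - Kernel continuity: there is $L_P>0$ with $|(P_\theta f)(w)-(P_{\theta'}f)(w)|\le L_PU_1(w)\|\theta-\theta'\|$ for all $\theta,\theta'\in\Theta$, $w\in\mathcal W$ and Borel $f:\mathcal W\to\mathbb R$ with $|f|\le U_1$. - Growth: there are $L_F,C_F>0$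 with $\|F(\theta,w)-F(\theta',w)\|\le L_F(1+\|w\|)\|\theta-\theta'\|$ and $\sup_{\theta\in\Theta}\|F(\theta,w)\|\le C_F(1+\|w\|)$ for all $\theta,\theta'\in\Theta$, $w\in\mathcal W$. - Interior target: there is $\theta^\star\in\operatorname{int}(\Theta)$ with $\bar F(\theta^\star)=0$. - Quasi-strong monotonicity: there is $\zeta>0$ with $\langle\theta-\theta^\star,\bar F(\theta)\rangle\le-\zeta\|\theta-\theta^\star\|^2$ for all $\theta\in\Theta$. *)

theory Defs
  imports "HOL-Probability.Probability"
begin

section \<open>Markov kernels on a general state space\<close>

text \<open>A kernel on a measurable space \<open>S\<close> is a map \<open>Q\<close> sending a state \<open>w\<close> to the probability
  measure \<open>Q w\<close> on \<open>S\<close>. The measure carried by \<open>S\<close> itself is irrelevant.\<close>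

primrec kernel_power :: "'b measure \<Rightarrow> ('b \<Rightarrow> 'b measure) \<Rightarrow> nat \<Rightarrow> 'b \<Rightarrow> 'b measure" where
  "kernel_power S Q 0 = return S"
| "kernel_power S Q (Suc n) = (\<lambda>w. Q w \<bind> kernel_power S Q n)"

definition stationary_distribution :: "'b measure \<Rightarrow> ('b \<Rightarrow> 'b measure) \<Rightarrow> 'b measure \<Rightarrow> bool" where
  "stationary_distribution S Q \<nu> \<longleftrightarrow> \<nu> \<in> space (prob_algebra S) \<and> \<nu> \<bind> Q = \<nu>"

text \<open>Meaningful only for kernels with exactly one stationary distribution.\<close>

definition the_stationary :: "'b measure \<Rightarrow> ('b \<Rightarrow> 'b measure) \<Rightarrow> 'b measure" where
  "the_stationary S Q = (THE \<nu>. stationary_distribution S Q \<nu>)"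

text \<open>Irreducibility and aperiodicity in the sense of Meyn and Tweedie.\<close>

definition irreducibility_measure :: "'b measure \<Rightarrow> ('b \<Rightarrow> 'b measure) \<Rightarrow> 'b measure \<Rightarrow> bool" where
  "irreducibility_measure S Q \<psi> \<longleftrightarrow>
     sets \<psi> = sets S \<and> sigma_finite_measure \<psi> \<and> emeasure \<psi> (space S) > 0 \<and>
     (\<forall>A\<in>sets S. emeasure \<psi> A > 0 \<longrightarrow>
        (\<forall>w\<in>space S. \<exists>n\<ge>1. emeasure (kernel_power S Q n w) A > 0))"

definition irreducible_kernel :: "'b measure \<Rightarrow> ('b \<Rightarrow> 'b measure) \<Rightarrow> bool" where
  "irreducible_kernel S Q \<longleftrightarrow> (\<exists>\<psi>. irreducibility_measure S Q \<psi>)"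

definition maximal_irreducibility_measure ::
    "'b measure \<Rightarrow> ('b \<Rightarrow> 'b measure) \<Rightarrow> 'b measure \<Rightarrow> bool" where
  "maximal_irreducibility_measure S Q \<psi> \<longleftrightarrow>
     irreducibility_measure S Q \<psi> \<and>
     (\<forall>\<phi>. irreducibility_measure S Q \<phi> \<longrightarrow> absolutely_continuous \<psi> \<phi>)"

definition kernel_cycle ::
    "'b measure \<Rightarrow> ('b \<Rightarrow> 'b measure) \<Rightarrow> 'b measure \<Rightarrow> nat \<Rightarrow> (nat \<Rightarrow> 'b set) \<Rightarrow> bool" where
  "kernel_cycle S Q \<psi> d D \<longleftrightarrow>
     (\<forall>i<d. D i \<in> sets S) \<and> disjoint_family_on D {..<d} \<and>
     (\<forall>i<d. \<forall>w\<in>D i. emeasure (Q w) (D (Suc i mod d)) = 1) \<and>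
     space S - (\<Union>i<d. D i) \<in> null_sets \<psi>"

text \<open>Every irreducible kernel has a maximal irreducibility measure, and any two of these have the
  same null sets, so the choice of \<open>\<psi>\<close> does not matter.\<close>

definition aperiodic_kernel :: "'b measure \<Rightarrow> ('b \<Rightarrow> 'b measure) \<Rightarrow> bool" where
  "aperiodic_kernel S Q \<longleftrightarrow>
     (\<exists>\<psi>. maximal_irreducibility_measure S Q \<psi> \<and> \<not> (\<exists>d\<ge>2. \<exists>D. kernel_cycle S Q \<psi> d D))"

section \<open>Projected stochastic approximation driven by an adaptive Markov chain\<close>

definition U :: "nat \<Rightarrow> 'b::euclidean_space \<Rightarrow> real" where
  "U p w = 1 + norm w ^ p"

definition step_size :: "real \<Rightarrow> real \<Rightarrow> nat \<Rightarrow> real" where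
  "step_size \<alpha>\<^sub>0 \<delta> k = (if k = 0 then \<alpha>\<^sub>0 else \<alpha>\<^sub>0 * real k powr (-\<delta>))"

definition mean_field ::
    "'b::euclidean_space set \<Rightarrow> ('a::euclidean_space \<Rightarrow> 'b \<Rightarrow> 'a) \<Rightarrow> ('a \<Rightarrow> 'b \<Rightarrow> 'b measure) \<Rightarrow> 'a \<Rightarrow> 'a"
  where
  "mean_field \<W> F P \<theta> = (\<integral>w. F \<theta> w \<partial>the_stationary (restrict_space borel \<W>) (P \<theta>))"

definition model ::
    "'a::euclidean_space set \<Rightarrow> 'b::euclidean_space set \<Rightarrow> ('a \<Rightarrow> 'b \<Rightarrow> 'a) \<Rightarrow> ('a \<Rightarrow> 'b \<Rightarrow> 'b measure) \<Rightarrow> bool"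
  where
  "model \<Theta> \<W> F P \<longleftrightarrow>
     \<W> \<in> sets borel \<and>
     case_prod F \<in> borel_measurable (restrict_space borel \<Theta> \<Otimes>\<^sub>M restrict_space borel \<W>) \<and>
     case_prod P \<in> restrict_space borel \<Theta> \<Otimes>\<^sub>M restrict_space borel \<W>
       \<rightarrow>\<^sub>M prob_algebra (restrict_space borel \<W>)"

text \<open>The drift condition uses the nonnegative integral: the Bochner integral of a nonintegrable
  function is \<open>0\<close>, which would make the inequality vacuous.\<close>

definition ergodicity ::
    "'a::euclidean_space set \<Rightarrow> 'b::euclidean_space set \<Rightarrow> ('a \<Rightarrow> 'b \<Rightarrow> 'b measure) \<Rightarrow> bool" where
  "ergodicity \<Theta> \<W> P \<longleftrightarrow>
     (\<forall>\<theta>\<in>\<Theta>. irreducible_kernel (restrict_space borel \<W>) (P \<theta>) \<and>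
             aperiodic_kernel (restrict_space borel \<W>) (P \<theta>)) \<and>
     (\<exists>N \<W>\<^sub>0 \<epsilon>\<^sub>0 \<phi> \<rho> b.
        N > 0 \<and> \<W>\<^sub>0 \<noteq> {} \<and> \<W>\<^sub>0 \<subseteq> \<W> \<and> \<W>\<^sub>0 \<in> sets borel \<and> \<epsilon>\<^sub>0 > 0 \<and>
        \<phi> \<in> space (prob_algebra (restrict_space borel \<W>)) \<and>
        (\<forall>\<theta>\<in>\<Theta>. \<forall>w\<in>\<W>\<^sub>0. \<forall>E\<in>sets (restrict_space borel \<W>).
           measure (kernel_power (restrict_space borel \<W>) (P \<theta>) N w) E \<ge> \<epsilon>\<^sub>0 * measure \<phi> E) \<and>
        0 \<le> \<rho> \<and> \<rho> < 1 \<and> 0 \<le> b \<and>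
        (\<forall>\<theta>\<in>\<Theta>. \<forall>w\<in>\<W>.
           (\<integral>\<^sup>+y. ennreal (U 2 y) \<partial>P \<theta> w) \<le> ennreal (\<rho> * U 2 w + b * indicat_real \<W>\<^sub>0 w)))"

definition kernel_continuity ::
    "'a::euclidean_space set \<Rightarrow> 'b::euclidean_space set \<Rightarrow> ('a \<Rightarrow> 'b \<Rightarrow> 'b measure) \<Rightarrow> bool" where
  "kernel_continuity \<Theta> \<W> P \<longleftrightarrow>
     (\<exists>L>0. \<forall>\<theta>\<in>\<Theta>. \<forall>\<theta>'\<in>\<Theta>. \<forall>w\<in>\<W>. \<forall>f\<in>borel_measurable (restrict_space borel \<W>).
        (\<forall>y\<in>\<W>. \<bar>f y\<bar> \<le> U 1 y) \<longrightarrow>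
        \<bar>(\<integral>y. f y \<partial>P \<theta> w) - (\<integral>y. f y \<partial>P \<theta>' w)\<bar> \<le> L * U 1 w * norm (\<theta> - \<theta>'))"

definition growth ::
    "'a::euclidean_space set \<Rightarrow> 'b::euclidean_space set \<Rightarrow> ('a \<Rightarrow> 'b \<Rightarrow> 'a) \<Rightarrow> bool" where
  "growth \<Theta> \<W> F \<longleftrightarrow>
     (\<exists>L>0. \<exists>C>0.
        (\<forall>\<theta>\<in>\<Theta>. \<forall>\<theta>'\<in>\<Theta>. \<forall>w\<in>\<W>. norm (F \<theta> w - F \<theta>' w) \<le> L * (1 + norm w) * norm (\<theta> - \<theta>')) \<and>
        (\<forall>\<theta>\<in>\<Theta>. \<forall>w\<in>\<W>. norm (F \<theta> w) \<le> C * (1 + norm w)))"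

text \<open>The \<open>\<sigma>\<close>-algebra generated by \<open>(\<theta>\<^sub>0, W\<^sub>0), \<dots>, (\<theta>\<^sub>k, W\<^sub>k)\<close>.\<close>

definition history ::
    "'w measure \<Rightarrow> (nat \<Rightarrow> 'w \<Rightarrow> 'a::euclidean_space) \<Rightarrow> (nat \<Rightarrow> 'w \<Rightarrow> 'b::euclidean_space) \<Rightarrow> nat \<Rightarrow> 'w measure"
  where
  "history M \<theta> W k =
     sigma (space M) (\<Union>j\<le>k. {\<theta> j -` A \<inter> space M |A. A \<in> sets borel} \<union>
                             {W j -` B \<inter> space M |B. B \<in> sets borel})"

text \<open>The expression \<open>closest_point \<Theta> x\<close> is the Euclidean projection of \<open>x\<close> onto \<open>\<Theta>\<close> when \<open>\<Theta>\<close> is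
  nonempty, closed and convex.\<close>

definition adaptive_SA ::
    "'a::euclidean_space set \<Rightarrow> 'b::euclidean_space set \<Rightarrow> ('a \<Rightarrow> 'b \<Rightarrow> 'a) \<Rightarrow> ('a \<Rightarrow> 'b \<Rightarrow> 'b measure) \<Rightarrow>
     (nat \<Rightarrow> real) \<Rightarrow> 'w measure \<Rightarrow> (nat \<Rightarrow> 'w \<Rightarrow> 'a) \<Rightarrow> (nat \<Rightarrow> 'w \<Rightarrow> 'b) \<Rightarrow> bool" where
  "adaptive_SA \<Theta> \<W> F P \<alpha> M \<theta> W \<longleftrightarrow>
     prob_space M \<and>
     (\<forall>k. \<theta> k \<in> M \<rightarrow>\<^sub>M restrict_space borel \<Theta>) \<and>
     (\<forall>k. W k \<in> M \<rightarrow>\<^sub>M restrict_space borel \<W>) \<and>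
     (\<forall>k. AE \<omega> in M. \<theta> (Suc k) \<omega> = closest_point \<Theta> (\<theta> k \<omega> + \<alpha> k *\<^sub>R F (\<theta> k \<omega>) (W k \<omega>))) \<and>
     (\<forall>k. \<forall>E\<in>sets (restrict_space borel \<W>). AE \<omega> in M.
        real_cond_exp M (history M \<theta> W k) (\<lambda>\<omega>'. indicat_real E (W (Suc k) \<omega>')) \<omega>
          = measure (P (\<theta> k \<omega>) (W k \<omega>)) E)"

end

theory Submission
  imports Defs
begin

text \<open>
  The recursion is a noisy Euler scheme for the mean field, and the noise is Markovian rather than a
  martingale difference. The argument rests on a solution \<open>G\<close> of the Poisson equation
  \<open>G \<theta> w - (P\<^sub>\<theta> G \<theta>) w = \<langle>\<theta> - \<theta>star, F \<theta> w\<rangle> - \<langle>\<theta> - \<theta>star, mean_field \<theta>\<rangle>\<close>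
  that grows at most like \<open>V w = sqrt (1 + norm w ^ 2)\<close> and is Lipschitz in \<open>\<theta>\<close> with a constant of
  the same order (\<open>model_poisson\<close>). It turns the noise in one step of the squared error into a
  difference \<open>G \<theta>\<^sub>k W\<^sub>k - G \<theta>\<^sub>k W\<^sub>k\<^sub>+\<^sub>1\<close>, in mean. Replacing the second \<open>\<theta>\<^sub>k\<close> by \<open>\<theta>\<^sub>k\<^sub>+\<^sub>1\<close> costs one
  step length, so what remains telescopes up to terms of order \<open>\<alpha>\<^sub>k\<^sup>2\<close>. After summation by parts the
  error obeys \<open>D\<^sub>k\<^sub>+\<^sub>1 \<le> (1 - 2 \<zeta> \<alpha>\<^sub>k) D\<^sub>k + O(\<alpha>\<^sub>k\<^sup>2)\<close>, and Chung's lemma (\<open>chung_recursion\<close>) gives the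
  order \<open>k powr -\<delta>\<close>; for \<open>\<delta> = 1\<close> this is where \<open>2 \<zeta> \<alpha>\<^sub>0 > 1\<close> enters.

  The Poisson equation is solved with constants uniform in \<open>\<theta>\<close>. The drift condition for the squared
  norm passes to \<open>V\<close> by Jensen's inequality. It also forces the chain, started where \<open>V\<close> is at most
  \<open>R\<close>, to spend a definite amount of time in the small set within a number of steps that depends
  only on \<open>R\<close>. Hence the average \<open>K\<close> of the powers \<open>P\<^sup>0, ..., P\<^sup>m\<close> satisfies a one-step minorization on
  a whole sublevel set of \<open>V\<close>, and still a drift inequality. This is the setting of the proof of
  Harris' theorem by Hairer and Mattingly: \<open>K\<close> contracts the oscillation of functions measured against
  \<open>1 + \<beta> V\<close> (\<open>harris_contraction\<close>, \<open>uniform_contraction\<close>). The contraction yields a limit of the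
  iterates of \<open>K\<close>, the existence and uniqueness of the stationary distribution of \<open>P\<close>
  (\<open>limit_measure_stationary\<close>, \<open>stationary_unique\<close>) and a convergent series that solves the Poisson
  equation for \<open>K\<close>. As \<open>I - K\<close> is a multiple of \<open>I - P\<close> by a polynomial in \<open>P\<close>, a solution for \<open>P\<close>
  follows (\<open>uniform_poisson\<close>).

  Conditioning on the initial state is handled by integrating over an arbitrary event \<open>A\<close> of the
  initial \<open>\<sigma>\<close>-algebra throughout and reading off the conditional expectation only at the end.
\<close>

section \<open>Markov operators on weighted function spaces\<close>

text \<open>These functions form the domain on which every operator below acts. A bound by a multiple of the
  weight replaces integrability, so that one domain serves all kernels of the family.\<close>

definition dominated :: "'b measure \<Rightarrow> ('b \<Rightarrow> real) \<Rightarrow> ('b \<Rightarrow> real) set" where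
  "dominated S V = {f \<in> borel_measurable S. \<exists>c. \<forall>w\<in>space S. \<bar>f w\<bar> \<le> c * V w}"

lemma dominatedI:
  "f \<in> borel_measurable S \<Longrightarrow> (\<And>w. w \<in> space S \<Longrightarrow> \<bar>f w\<bar> \<le> c * V w) \<Longrightarrow> f \<in> dominated S V"
  by (auto simp: dominated_def)

lemma dominated_measurable: "f \<in> dominated S V \<Longrightarrow> f \<in> borel_measurable S"
  by (simp add: dominated_def)

lemma dominatedE:
  assumes "f \<in> dominated S V"
  obtains c where "\<And>w. w \<in> space S \<Longrightarrow> \<bar>f w\<bar> \<le> c * V w"
  using assms by (auto simp: dominated_def)

lemma dominated_add:
  assumes "f \<in> dominated S V" "g \<in> dominated S V"
  shows "(\<lambda>y. f y + g y) \<in> dominated S V"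
proof -
  obtain a where a: "\<And>w. w \<in> space S \<Longrightarrow> \<bar>f w\<bar> \<le> a * V w" using assms(1) by (rule dominatedE) blast
  obtain b where b: "\<And>w. w \<in> space S \<Longrightarrow> \<bar>g w\<bar> \<le> b * V w" using assms(2) by (rule dominatedE) blast
  have [measurable]: "f \<in> borel_measurable S" "g \<in> borel_measurable S"
    using assms by (auto dest: dominated_measurable)
  show ?thesis
  proof (rule dominatedI[where c = "a + b"])
    fix w assume w: "w \<in> space S"
    show "\<bar>f w + g w\<bar> \<le> (a + b) * V w"
      using a[OF w] b[OF w] abs_triangle_ineq[of "f w" "g w"] unfolding distrib_right by linarith
  qed measurable
qed

lemma dominated_scale:
  assumes "f \<in> dominated S V"
  shows "(\<lambda>y. c * f y) \<in> dominated S V"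
proof -
  obtain a where a: "\<And>w. w \<in> space S \<Longrightarrow> \<bar>f w\<bar> \<le> a * V w" using assms by (rule dominatedE) blast
  have [measurable]: "f \<in> borel_measurable S" using assms by (rule dominated_measurable)
  show ?thesis
  proof (rule dominatedI[where c = "\<bar>c\<bar> * a"])
    fix w assume w: "w \<in> space S"
    show "\<bar>c * f w\<bar> \<le> \<bar>c\<bar> * a * V w"
      using mult_left_mono[OF a[OF w], of "\<bar>c\<bar>"] by (simp add: abs_mult mult.assoc)
  qed measurable
qed

lemma dominated_diff:
  assumes "f \<in> dominated S V" "g \<in> dominated S V"
  shows "(\<lambda>y. f y - g y) \<in> dominated S V"
  using dominated_add[OF assms(1) dominated_scale[OF assms(2), of "-1"]] by simp

text \<open>Working with positive linear operators instead of kernels treats a kernel, its powers, their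
  averages and the integral against a fixed probability measure alike. Bounded convergence is the
  trace of countable additivity: it makes limits of such operators integrals again.\<close>

locale markov_op =
  fixes S :: "'b measure" and V :: "'b \<Rightarrow> real" and T :: "('b \<Rightarrow> real) \<Rightarrow> 'b \<Rightarrow> real"
  assumes V_meas: "V \<in> borel_measurable S"
    and V_ge_1: "\<And>w. w \<in> space S \<Longrightarrow> 1 \<le> V w"
    and closed: "\<And>f. f \<in> dominated S V \<Longrightarrow> T f \<in> dominated S V"
    and add: "\<And>f g w. f \<in> dominated S V \<Longrightarrow> g \<in> dominated S V \<Longrightarrow> w \<in> space S \<Longrightarrow>
      T (\<lambda>y. f y + g y) w = T f w + T g w"
    and scale: "\<And>f c w. f \<in> dominated S V \<Longrightarrow> w \<in> space S \<Longrightarrow> T (\<lambda>y. c * f y) w = c * T f w"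
    and one: "\<And>w. w \<in> space S \<Longrightarrow> T (\<lambda>_. 1) w = 1"
    and nonneg: "\<And>f w. f \<in> dominated S V \<Longrightarrow> (\<And>y. y \<in> space S \<Longrightarrow> 0 \<le> f y) \<Longrightarrow> w \<in> space S \<Longrightarrow> 0 \<le> T f w"
    and bounded_convergence: "\<And>f g B w. (\<And>i. f i \<in> borel_measurable S) \<Longrightarrow> g \<in> borel_measurable S \<Longrightarrow>
      (\<And>i y. y \<in> space S \<Longrightarrow> \<bar>f i y\<bar> \<le> B) \<Longrightarrow> (\<And>y. y \<in> space S \<Longrightarrow> (\<lambda>i. f i y) \<longlonglongrightarrow> g y) \<Longrightarrow>
      w \<in> space S \<Longrightarrow> (\<lambda>i. T (f i) w) \<longlonglongrightarrow> T g w"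
begin

lemma bounded_dominated:
  assumes "f \<in> borel_measurable S" "\<And>w. w \<in> space S \<Longrightarrow> \<bar>f w\<bar> \<le> B"
  shows "f \<in> dominated S V"
proof (rule dominatedI[where c = "\<bar>B\<bar>"])
  fix w assume w: "w \<in> space S"
  have "\<bar>f w\<bar> \<le> \<bar>B\<bar>" using assms(2)[OF w] by linarith
  also have "\<dots> \<le> \<bar>B\<bar> * V w" using V_ge_1[OF w] by (simp add: mult_le_cancel_left1)
  finally show "\<bar>f w\<bar> \<le> \<bar>B\<bar> * V w" .
qed (rule assms(1))

lemma V_dominated: "V \<in> dominated S V"
  by (rule dominatedI[where c = 1]) (use V_meas V_ge_1 in force)+

lemma const_dominated: "(\<lambda>_. c) \<in> dominated S V"
  by (rule bounded_dominated[where B = "\<bar>c\<bar>"]) auto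

lemma dominated_sum:
  assumes "finite I" "\<And>i. i \<in> I \<Longrightarrow> f i \<in> dominated S V"
  shows "(\<lambda>y. \<Sum>i\<in>I. f i y) \<in> dominated S V"
  using assms by (induction I rule: finite_induct) (auto intro: const_dominated dominated_add)

lemma dominatedI_of_le:
  assumes "f \<in> borel_measurable S" "g \<in> dominated S V" "\<And>w. w \<in> space S \<Longrightarrow> \<bar>f w\<bar> \<le> g w"
  shows "f \<in> dominated S V"
proof -
  obtain a where a: "\<And>w. w \<in> space S \<Longrightarrow> \<bar>g w\<bar> \<le> a * V w" using assms(2) by (rule dominatedE) blast
  show ?thesis
    by (rule dominatedI[OF assms(1), where c = a]) (use a assms(3) in fastforce)
qed

lemma const: "w \<in> space S \<Longrightarrow> T (\<lambda>_. c) w = c"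
  using scale[OF const_dominated[of 1], of w c] one[of w] by simp

lemma diff:
  assumes "f \<in> dominated S V" "g \<in> dominated S V" "w \<in> space S"
  shows "T (\<lambda>y. f y - g y) w = T f w - T g w"
  using add[OF assms(1) dominated_scale[OF assms(2), of "-1"] assms(3)] scale[OF assms(2,3), of "-1"]
  by simp

lemma sum:
  assumes "finite I" "\<And>i. i \<in> I \<Longrightarrow> f i \<in> dominated S V" "w \<in> space S"
  shows "T (\<lambda>y. \<Sum>i\<in>I. f i y) w = (\<Sum>i\<in>I. T (f i) w)"
  using assms(1,2)
proof (induction I rule: finite_induct)
  case empty
  then show ?case using const[OF assms(3), of 0] by simp
next
  case (insert x F)
  then have "T (\<lambda>y. \<Sum>i\<in>insert x F. f i y) w = T (\<lambda>y. f x y + (\<Sum>i\<in>F. f i y)) w" by simp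
  also have "\<dots> = T (f x) w + T (\<lambda>y. \<Sum>i\<in>F. f i y) w"
    by (intro add dominated_sum) (use insert assms in auto)
  finally show ?case using insert by simp
qed

lemma mono:
  assumes "f \<in> dominated S V" "g \<in> dominated S V" "\<And>y. y \<in> space S \<Longrightarrow> f y \<le> g y" "w \<in> space S"
  shows "T f w \<le> T g w"
  using nonneg[OF dominated_diff[OF assms(2,1)] _ assms(4)] diff[OF assms(2,1,4)] assms(3) by simp

lemma cong:
  assumes "f \<in> dominated S V" "g \<in> dominated S V" "\<And>y. y \<in> space S \<Longrightarrow> f y = g y" "w \<in> space S"
  shows "T f w = T g w"
  using mono[OF assms(1,2) _ assms(4)] mono[OF assms(2,1) _ assms(4)] assms(3) by force

lemma abs_le:
  assumes "f \<in> dominated S V" "g \<in> dominated S V" "\<And>y. y \<in> space S \<Longrightarrow> \<bar>f y\<bar> \<le> g y" "w \<in> space S"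
  shows "\<bar>T f w\<bar> \<le> T g w"
proof -
  have g: "(\<lambda>y. - 1 * g y) \<in> dominated S V" by (intro dominated_scale assms)
  have "T f w \<le> T g w" by (rule mono) (use assms in force)+
  moreover have "T (\<lambda>y. - 1 * g y) w \<le> T f w"
    by (rule mono) (use assms g in \<open>force dest: abs_le_D2\<close>)+
  moreover have "T (\<lambda>y. - 1 * g y) w = - 1 * T g w" by (rule scale) (use assms in auto)
  ultimately show ?thesis by linarith
qed

lemma abs_le_scale:
  assumes "f \<in> dominated S V" "g \<in> dominated S V" "\<And>y. y \<in> space S \<Longrightarrow> \<bar>f y\<bar> \<le> c * g y" "w \<in> space S"
  shows "\<bar>T f w\<bar> \<le> c * T g w"
  using abs_le[OF assms(1) dominated_scale[OF assms(2)] assms(3,4)] scale[OF assms(2,4)] by simp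

lemma bounded:
  assumes "f \<in> borel_measurable S" "\<And>y. y \<in> space S \<Longrightarrow> \<bar>f y\<bar> \<le> B" "w \<in> space S"
  shows "\<bar>T f w\<bar> \<le> B"
  using abs_le[OF bounded_dominated[OF assms(1,2)] const_dominated assms(2,3)] const[OF assms(3)] by simp

end

lemma markov_op_id:
  assumes "V \<in> borel_measurable S" "\<And>w. w \<in> space S \<Longrightarrow> 1 \<le> V w"
  shows "markov_op S V (\<lambda>f. f)"
  by unfold_locales (use assms in auto)

lemma markov_op_comp:
  assumes "markov_op S V T1" "markov_op S V T2"
  shows "markov_op S V (\<lambda>f. T1 (T2 f))"
proof -
  interpret T1: markov_op S V T1 by fact
  interpret T2: markov_op S V T2 by fact
  show ?thesis
  proof unfold_locales
    show "V \<in> borel_measurable S" by (rule T1.V_meas)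
    show "1 \<le> V w" if "w \<in> space S" for w by (rule T1.V_ge_1[OF that])
    show "T1 (T2 f) \<in> dominated S V" if "f \<in> dominated S V" for f
      by (intro T1.closed T2.closed that)
    show "T1 (T2 (\<lambda>y. f y + g y)) w = T1 (T2 f) w + T1 (T2 g) w"
      if "f \<in> dominated S V" "g \<in> dominated S V" "w \<in> space S" for f g w
    proof -
      have "T1 (T2 (\<lambda>y. f y + g y)) w = T1 (\<lambda>y. T2 f y + T2 g y) w"
        by (rule T1.cong) (use that in \<open>auto intro!: T2.closed dominated_add T2.add\<close>)
      also have "\<dots> = T1 (T2 f) w + T1 (T2 g) w"
        by (intro T1.add T2.closed that)
      finally show ?thesis .
    qed
    show "T1 (T2 (\<lambda>y. c * f y)) w = c * T1 (T2 f) w"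
      if "f \<in> dominated S V" "w \<in> space S" for f c w
    proof -
      have "T1 (T2 (\<lambda>y. c * f y)) w = T1 (\<lambda>y. c * T2 f y) w"
        by (rule T1.cong) (use that in \<open>auto intro!: T2.closed dominated_scale T2.scale\<close>)
      also have "\<dots> = c * T1 (T2 f) w"
        by (intro T1.scale T2.closed that)
      finally show ?thesis .
    qed
    show "T1 (T2 (\<lambda>_. 1)) w = 1" if "w \<in> space S" for w
    proof -
      have "T1 (T2 (\<lambda>_. 1)) w = T1 (\<lambda>_. 1) w"
        by (rule T1.cong) (use that in \<open>auto intro!: T2.closed T1.const_dominated T2.one\<close>)
      then show ?thesis using T1.one[OF that] by simp
    qed
    show "0 \<le> T1 (T2 f) w"
      if "f \<in> dominated S V" "\<And>y. y \<in> space S \<Longrightarrow> 0 \<le> f y" "w \<in> space S" for f w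
      by (rule T1.nonneg) (use that in \<open>auto intro!: T2.closed T2.nonneg\<close>)
    show "(\<lambda>i. T1 (T2 (f i)) w) \<longlonglongrightarrow> T1 (T2 g) w"
      if f: "\<And>i. f i \<in> borel_measurable S" and g: "g \<in> borel_measurable S"
        and B: "\<And>i y. y \<in> space S \<Longrightarrow> \<bar>f i y\<bar> \<le> B"
        and lim: "\<And>y. y \<in> space S \<Longrightarrow> (\<lambda>i. f i y) \<longlonglongrightarrow> g y" and w: "w \<in> space S"
      for f :: "nat \<Rightarrow> 'a \<Rightarrow> real" and g B w
    proof (rule T1.bounded_convergence[where B = B])
      have "\<bar>g y\<bar> \<le> B" if "y \<in> space S" for y
        using LIMSEQ_le_const2[OF tendsto_rabs[OF lim[OF that]]] B[OF that] by blast
      then have "g \<in> dominated S V" using g by (intro T2.bounded_dominated)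
      then show "T2 g \<in> borel_measurable S" by (intro dominated_measurable[where V = V] T2.closed)
      show "T2 (f i) \<in> borel_measurable S" for i
        by (intro dominated_measurable[where V = V] T2.closed T2.bounded_dominated[OF f B])
      show "\<bar>T2 (f i) y\<bar> \<le> B" if "y \<in> space S" for i y
        by (rule T2.bounded[OF f B that])
      show "(\<lambda>i. T2 (f i) y) \<longlonglongrightarrow> T2 g y" if "y \<in> space S" for y
        by (rule T2.bounded_convergence[OF f g B lim that])
    qed (rule w)
  qed
qed

lemma markov_op_funpow:
  assumes "markov_op S V T"
  shows "markov_op S V (T ^^ n)"
proof (induction n)
  case 0
  interpret markov_op S V T by fact
  show ?case using markov_op_id[OF V_meas V_ge_1] by (simp add: id_def)
next
  case (Suc n)
  then show ?case using markov_op_comp[OF assms Suc] by (simp add: comp_def)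
qed

lemma (in markov_op) iter: "markov_op S V (T ^^ n)"
  by (rule markov_op_funpow) unfold_locales

definition op_average :: "nat \<Rightarrow> (nat \<Rightarrow> ('b \<Rightarrow> real) \<Rightarrow> 'b \<Rightarrow> real) \<Rightarrow> ('b \<Rightarrow> real) \<Rightarrow> 'b \<Rightarrow> real" where
  "op_average m T f w = (\<Sum>j\<le>m. T j f w) / real (Suc m)"

lemma markov_op_average:
  assumes T: "\<And>j. markov_op S V (T j)"
  shows "markov_op S V (op_average m T)"
proof -
  interpret T: markov_op S V "T j" for j by (rule T)
  show ?thesis
  proof unfold_locales
    show "V \<in> borel_measurable S" by (rule T.V_meas)
    show "1 \<le> V w" if "w \<in> space S" for w by (rule T.V_ge_1[OF that])
    show "op_average m T f \<in> dominated S V" if "f \<in> dominated S V" for f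
    proof -
      have "(\<lambda>y. (1 / real (Suc m)) * (\<Sum>j\<le>m. T j f y)) \<in> dominated S V"
        by (intro dominated_scale T.dominated_sum T.closed that) auto
      then show ?thesis by (simp add: op_average_def[abs_def])
    qed
    show "op_average m T (\<lambda>y. f y + g y) w = op_average m T f w + op_average m T g w"
      if "f \<in> dominated S V" "g \<in> dominated S V" "w \<in> space S" for f g w
      using that by (simp add: op_average_def T.add sum.distrib add_divide_distrib)
    show "op_average m T (\<lambda>y. c * f y) w = c * op_average m T f w"
      if "f \<in> dominated S V" "w \<in> space S" for f c w
      using that by (simp add: op_average_def T.scale sum_distrib_left[symmetric])
    show "op_average m T (\<lambda>_. 1) w = 1" if "w \<in> space S" for w
      using that by (simp add: op_average_def T.one)
    show "0 \<le> op_average m T f w"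
      if "f \<in> dominated S V" "\<And>y. y \<in> space S \<Longrightarrow> 0 \<le> f y" "w \<in> space S" for f w
      using T.nonneg that by (auto simp: op_average_def intro!: divide_nonneg_pos sum_nonneg)
    show "(\<lambda>i. op_average m T (f i) w) \<longlonglongrightarrow> op_average m T g w"
      if "\<And>i. f i \<in> borel_measurable S" "g \<in> borel_measurable S"
        "\<And>i y. y \<in> space S \<Longrightarrow> \<bar>f i y\<bar> \<le> B"
        "\<And>y. y \<in> space S \<Longrightarrow> (\<lambda>i. f i y) \<longlonglongrightarrow> g y" "w \<in> space S"
      for f :: "nat \<Rightarrow> 'a \<Rightarrow> real" and g B w
      unfolding op_average_def
      by (intro tendsto_intros tendsto_sum T.bounded_convergence[OF that]) auto
  qed
qed

definition kernel_op :: "('b \<Rightarrow> 'b measure) \<Rightarrow> ('b \<Rightarrow> real) \<Rightarrow> 'b \<Rightarrow> real" where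
  "kernel_op Q f w = (\<integral>y. f y \<partial>Q w)"

lemma integrable_of_nn_integral_le:
  assumes "V \<in> borel_measurable N" "(\<integral>\<^sup>+y. ennreal \<bar>V y\<bar> \<partial>N) \<le> ennreal c"
  shows "integrable N V"
  using assms by (intro integrableI_bounded) (auto simp: order_le_less_trans[OF assms(2)])

lemma integrable_dominated:
  assumes N: "sets N = sets S" "integrable N v" and g: "g \<in> dominated S v"
  shows "integrable N g"
proof -
  obtain c where c: "\<And>w. w \<in> space S \<Longrightarrow> \<bar>g w\<bar> \<le> c * v w" using g by (rule dominatedE) blast
  have space: "space N = space S" using N by (simp cong: sets_eq_imp_space_eq)
  show ?thesis
  proof (rule Bochner_Integration.integrable_bound)
    show "integrable N (\<lambda>y. c * v y)" using N by simp
    show "g \<in> borel_measurable N" using dominated_measurable[OF g] N by (simp cong: measurable_cong_sets)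
    show "AE y in N. norm (g y) \<le> norm (c * v y)" by (rule AE_I2) (use c space in force)
  qed
qed

lemma prob_kernelD:
  assumes "Q \<in> S \<rightarrow>\<^sub>M prob_algebra S" "w \<in> space S"
  shows "sets (Q w) = sets S" "space (Q w) = space S" "prob_space (Q w)"
  using measurable_space[OF assms] by (auto simp: space_prob_algebra dest: sets_eq_imp_space_eq)

text \<open>The bound on the integral of the weight keeps the domain of weighted functions invariant.\<close>

lemma markov_op_kernel_op:
  assumes Q: "Q \<in> S \<rightarrow>\<^sub>M prob_algebra S"
    and V: "V \<in> borel_measurable S" "\<And>w. w \<in> space S \<Longrightarrow> 1 \<le> V w"
    and int: "\<And>w. w \<in> space S \<Longrightarrow> integrable (Q w) V"
    and le: "\<And>w. w \<in> space S \<Longrightarrow> (\<integral>y. V y \<partial>Q w) \<le> B * V w"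
  shows "markov_op S V (kernel_op Q)"
proof -
  note sets_Q = prob_kernelD[OF Q]
  have meas: "f \<in> borel_measurable (Q w)" if "f \<in> borel_measurable S" "w \<in> space S" for f :: "'a \<Rightarrow> real" and w
    using that sets_Q by (simp cong: measurable_cong_sets)
  have intf: "integrable (Q w) f" if "f \<in> dominated S V" "w \<in> space S" for f w
    by (rule integrable_dominated[OF sets_Q(1)[OF that(2)] int[OF that(2)] that(1)])
  show ?thesis
  proof unfold_locales
    show "V \<in> borel_measurable S" "\<And>w. w \<in> space S \<Longrightarrow> 1 \<le> V w" by (fact V)+
    show "kernel_op Q f \<in> dominated S V" if f: "f \<in> dominated S V" for f
    proof -
      obtain c where c: "\<And>w. w \<in> space S \<Longrightarrow> \<bar>f w\<bar> \<le> c * V w" using f by (rule dominatedE) blast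
      show ?thesis
      proof (rule dominatedI[where c = "\<bar>c\<bar> * B"])
        have "(\<lambda>w. \<integral>y. f y \<partial>Q w) \<in> borel_measurable S"
          by (rule measurable_compose[OF measurable_prob_algebraD[OF Q]
                integral_measurable_subprob_algebra[OF dominated_measurable[OF f]]])
        then show "kernel_op Q f \<in> borel_measurable S" by (simp add: kernel_op_def[abs_def])
        fix w assume w: "w \<in> space S"
        have "\<bar>kernel_op Q f w\<bar> \<le> (\<integral>y. \<bar>f y\<bar> \<partial>Q w)" unfolding kernel_op_def by (rule integral_abs_bound)
        also have "\<dots> \<le> (\<integral>y. \<bar>c\<bar> * V y \<partial>Q w)"
        proof (rule integral_mono)
          fix y assume "y \<in> space (Q w)"
          then have y: "y \<in> space S" using sets_Q w by auto
          have "\<bar>f y\<bar> \<le> c * V y" by (rule c[OF y])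
          also have "\<dots> \<le> \<bar>c\<bar> * V y" using V(2)[OF y] by (intro mult_right_mono) auto
          finally show "\<bar>f y\<bar> \<le> \<bar>c\<bar> * V y" .
        qed (use int[OF w] intf[OF f w] in auto)
        also have "\<dots> = \<bar>c\<bar> * (\<integral>y. V y \<partial>Q w)" by simp
        also have "\<dots> \<le> \<bar>c\<bar> * (B * V w)" by (intro mult_left_mono le w) auto
        finally show "\<bar>kernel_op Q f w\<bar> \<le> \<bar>c\<bar> * B * V w" by (simp add: mult.assoc)
      qed
    qed
    show "kernel_op Q (\<lambda>y. f y + g y) w = kernel_op Q f w + kernel_op Q g w"
      if "f \<in> dominated S V" "g \<in> dominated S V" "w \<in> space S" for f g w
      using intf that by (simp add: kernel_op_def)
    show "kernel_op Q (\<lambda>y. c * f y) w = c * kernel_op Q f w" for f c w by (simp add: kernel_op_def)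
    show "kernel_op Q (\<lambda>_. 1) w = 1" if "w \<in> space S" for w
      using sets_Q(3)[OF that] by (simp add: kernel_op_def prob_space.prob_space)
    show "0 \<le> kernel_op Q f w"
      if "f \<in> dominated S V" "\<And>y. y \<in> space S \<Longrightarrow> 0 \<le> f y" "w \<in> space S" for f w
      unfolding kernel_op_def using that sets_Q by (intro Bochner_Integration.integral_nonneg) auto
    show "(\<lambda>i. kernel_op Q (f i) w) \<longlonglongrightarrow> kernel_op Q g w"
      if f: "\<And>i. f i \<in> borel_measurable S" and g: "g \<in> borel_measurable S"
        and B: "\<And>i y. y \<in> space S \<Longrightarrow> \<bar>f i y\<bar> \<le> B"
        and lim: "\<And>y. y \<in> space S \<Longrightarrow> (\<lambda>i. f i y) \<longlonglongrightarrow> g y" and w: "w \<in> space S"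
      for f :: "nat \<Rightarrow> 'a \<Rightarrow> real" and g B w
      unfolding kernel_op_def
    proof (rule integral_dominated_convergence[where w = "\<lambda>_. B"])
      interpret prob_space "Q w" by (rule sets_Q(3)[OF w])
      show "integrable (Q w) (\<lambda>_. B)" by simp
      show "g \<in> borel_measurable (Q w)" "\<And>i. f i \<in> borel_measurable (Q w)"
        using f g w by (auto intro: meas)
      show "AE y in Q w. (\<lambda>i. f i y) \<longlonglongrightarrow> g y"
        by (rule AE_I2) (use lim sets_Q w in auto)
      show "AE y in Q w. norm (f i y) \<le> B" for i
        by (rule AE_I2) (use B sets_Q w in auto)
    qed
  qed
qed

section \<open>Harris contraction and the Poisson equation\<close>

text \<open>The oscillation does not see additive constants, and a Markov operator fixes them. This is why it
  can be contracted on all functions, and not only on those with mean zero.\<close>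

definition osc_le :: "'b measure \<Rightarrow> ('b \<Rightarrow> real) \<Rightarrow> real \<Rightarrow> ('b \<Rightarrow> real) \<Rightarrow> bool" where
  "osc_le S u C f \<longleftrightarrow> (\<forall>x\<in>space S. \<forall>y\<in>space S. \<bar>f x - f y\<bar> \<le> C * (u x + u y))"

lemma osc_leD: "osc_le S u C f \<Longrightarrow> x \<in> space S \<Longrightarrow> y \<in> space S \<Longrightarrow> \<bar>f x - f y\<bar> \<le> C * (u x + u y)"
  by (simp add: osc_le_def)

lemma osc_le_of_abs_le:
  assumes "\<And>x. x \<in> space S \<Longrightarrow> \<bar>f x\<bar> \<le> C * u x"
  shows "osc_le S u C f"
  unfolding osc_le_def
proof (intro ballI)
  fix x y assume "x \<in> space S" "y \<in> space S"
  with assms[of x] assms[of y] show "\<bar>f x - f y\<bar> \<le> C * (u x + u y)"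
    unfolding distrib_left by linarith
qed

text \<open>A function of bounded oscillation is dominated after subtracting a constant. The supremum of the
  lower bounds for this constant serves, because every one of them lies below every upper bound.\<close>

lemma osc_le_centre:
  assumes "osc_le S u C f"
  obtains s where "\<And>x. x \<in> space S \<Longrightarrow> \<bar>f x - s\<bar> \<le> C * u x"
proof (cases "space S = {}")
  case True
  then show ?thesis using that by auto
next
  case False
  let ?A = "(\<lambda>x. f x - C * u x) ` space S"
  have le: "f x - C * u x \<le> f y + C * u y" if "x \<in> space S" "y \<in> space S" for x y
    using osc_leD[OF assms that] unfolding distrib_left by linarith
  have "\<bar>f x - Sup ?A\<bar> \<le> C * u x" if x: "x \<in> space S" for x
  proof -
    have "Sup ?A \<le> f x + C * u x" using False le[OF _ x] by (intro cSup_least) auto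
    moreover have "f x - C * u x \<le> Sup ?A"
      using le[OF _ x] x by (intro cSup_upper) (auto intro!: bdd_aboveI)
    ultimately show ?thesis by linarith
  qed
  then show ?thesis by (rule that)
qed

definition harris_weight :: "real \<Rightarrow> ('b \<Rightarrow> real) \<Rightarrow> 'b \<Rightarrow> real" where
  "harris_weight \<beta> V x = 1 + \<beta> * V x"

text \<open>The first two terms come from the minorization and the drift on the sublevel set of radius \<open>R\<close>, the
  last one from the drift alone outside of it.\<close>

definition harris_rate :: "real \<Rightarrow> real \<Rightarrow> real \<Rightarrow> real \<Rightarrow> real" where
  "harris_rate \<gamma> R a \<beta> = max (max (1 - a / 2) ((1 + \<gamma>) / 2)) ((2 + \<beta> * ((1 + \<gamma>) / 2) * R) / (2 + \<beta> * R))"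

lemma harris_rate_bounds:
  assumes "0 \<le> \<gamma>" "\<gamma> < 1" "0 < R" "0 < a" "0 < \<beta>"
  shows "0 < harris_rate \<gamma> R a \<beta>" "harris_rate \<gamma> R a \<beta> < 1"
proof -
  show "0 < harris_rate \<gamma> R a \<beta>" using assms by (auto simp: harris_rate_def less_max_iff_disj)
  have "\<beta> * ((1 + \<gamma>) / 2) * R < \<beta> * R" using assms by auto
  then have "(2 + \<beta> * ((1 + \<gamma>) / 2) * R) / (2 + \<beta> * R) < 1"
    using assms by (subst divide_less_eq_1_pos) (auto intro!: add_pos_pos mult_pos_pos)
  then show "harris_rate \<gamma> R a \<beta> < 1" using assms by (auto simp: harris_rate_def)
qed

text \<open>The contraction at the heart of Harris' theorem. If the two starting points have a large total
  weight, the drift alone reduces the bound. Otherwise both lie in the set where the minorization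
  holds; the common part \<open>a * \<Phi>\<close> of the two laws cancels in the difference, and \<open>\<beta>\<close> is so small that
  the loss \<open>\<beta> * c\<close> from the drift is half of the gain \<open>a\<close>.\<close>

lemma harris_contraction:
  assumes T: "markov_op S V T" and \<Phi>: "markov_op S V \<Phi>"
    and \<Phi>_const: "\<And>f x y. x \<in> space S \<Longrightarrow> y \<in> space S \<Longrightarrow> \<Phi> f x = \<Phi> f y"
    and drift: "\<And>w. w \<in> space S \<Longrightarrow> T V w \<le> \<gamma> * V w + c"
    and minor: "\<And>f w. f \<in> dominated S V \<Longrightarrow> (\<And>y. y \<in> space S \<Longrightarrow> 0 \<le> f y) \<Longrightarrow> w \<in> space S \<Longrightarrow>
      V w \<le> R \<Longrightarrow> a * \<Phi> f w \<le> T f w"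
    and param: "0 \<le> \<gamma>" "\<gamma> < 1" "0 < c" "0 < a" "4 * c \<le> (1 - \<gamma>) * R" "\<beta> = a / (2 * c)"
    and f: "f \<in> dominated S V" and osc: "osc_le S (harris_weight \<beta> V) C f"
  shows "osc_le S (harris_weight \<beta> V) (harris_rate \<gamma> R a \<beta> * C) (T f)"
  unfolding osc_le_def
proof (intro ballI)
  fix x y assume x: "x \<in> space S" and y: "y \<in> space S"
  interpret T: markov_op S V T by fact
  interpret \<Phi>: markov_op S V \<Phi> by fact
  let ?u = "harris_weight \<beta> V" and ?q = "harris_rate \<gamma> R a \<beta>"
  have \<beta>: "0 < \<beta>" "\<beta> * c = a / 2" using param by auto
  have R: "0 < R"
  proof -
    have "0 < (1 - \<gamma>) * R" using param by linarith
    then show ?thesis using param by (simp add: zero_less_mult_iff)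
  qed
  have u_dom: "?u \<in> dominated S V"
    unfolding harris_weight_def[abs_def]
    by (intro dominated_add dominated_scale T.const_dominated T.V_dominated)
  have u_pos: "1 \<le> ?u z" if "z \<in> space S" for z
    using T.V_ge_1[OF that] \<beta> by (simp add: harris_weight_def)
  have Tu: "T ?u z = 1 + \<beta> * T V z" if "z \<in> space S" for z
    using that unfolding harris_weight_def[abs_def]
    by (simp add: T.add T.scale T.one T.const_dominated T.V_dominated dominated_scale)
  have Tu_le: "T ?u z \<le> 1 + a / 2 + \<gamma> * (\<beta> * V z)" if "z \<in> space S" for z
    using mult_left_mono[OF drift[OF that], of \<beta>] \<beta> Tu[OF that] by (simp add: algebra_simps)
  have C: "0 \<le> C"
    using osc_leD[OF osc x x] u_pos[OF x] by (simp add: zero_le_mult_iff)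
  obtain s where s: "\<And>z. z \<in> space S \<Longrightarrow> \<bar>f z - s\<bar> \<le> C * ?u z"
    using osc by (rule osc_le_centre) blast
  define g where "g = (\<lambda>z. f z - s)"
  have g: "g \<in> dominated S V" unfolding g_def by (intro dominated_diff f T.const_dominated)
  have Tg: "T f x - T f y = T g x - T g y"
    using x y by (simp add: g_def T.diff[OF f T.const_dominated] T.const)
  let ?s = "V x + V y"
  have sum_u: "?u x + ?u y = 2 + \<beta> * ?s" by (simp add: harris_weight_def algebra_simps)
  have s_pos: "0 \<le> ?s" using T.V_ge_1[OF x] T.V_ge_1[OF y] by linarith
  have "\<bar>T g x - T g y\<bar> \<le> C * (?q * (?u x + ?u y))"
  proof (cases "?s \<le> R")
    case True
    have small: "V x \<le> R" "V y \<le> R" using True T.V_ge_1[OF x] T.V_ge_1[OF y] by linarith+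
    have resid: "\<bar>T g z - a * \<Phi> g z\<bar> \<le> C * (T ?u z - a * \<Phi> ?u z)" if z: "z \<in> space S" "V z \<le> R" for z
    proof -
      have "a * \<Phi> (\<lambda>y. C * ?u y + g y) z \<le> T (\<lambda>y. C * ?u y + g y) z"
        by (rule minor) (use s g u_dom z in \<open>force simp: g_def intro: dominated_add dominated_scale\<close>)+
      moreover have "a * \<Phi> (\<lambda>y. C * ?u y - g y) z \<le> T (\<lambda>y. C * ?u y - g y) z"
        by (rule minor) (use s g u_dom z in \<open>force simp: g_def intro: dominated_diff dominated_scale\<close>)+
      ultimately show ?thesis
        using z g u_dom by (simp add: T.add T.diff T.scale \<Phi>.add \<Phi>.diff \<Phi>.scale dominated_scale algebra_simps abs_le_iff)
    qed
    have \<Phi>u: "1 \<le> \<Phi> ?u z" if "z \<in> space S" for z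
    proof -
      have "\<Phi> (\<lambda>_. 1) z \<le> \<Phi> ?u z"
        by (rule \<Phi>.mono) (use that u_pos u_dom \<Phi>.const_dominated in auto)
      then show ?thesis using \<Phi>.one[OF that] by simp
    qed
    have part: "T ?u z - a * \<Phi> ?u z \<le> 1 - a / 2 + \<gamma> * (\<beta> * V z)" if "z \<in> space S" for z
      using Tu_le[OF that] mult_left_mono[OF \<Phi>u[OF that], of a] param(4) by linarith
    have "\<bar>T g x - T g y\<bar> \<le> C * (T ?u x - a * \<Phi> ?u x) + C * (T ?u y - a * \<Phi> ?u y)"
      using resid[OF x small(1)] resid[OF y small(2)] arg_cong[OF \<Phi>_const[OF x y, of g], of "(*) a"]
      unfolding abs_le_iff by linarith
    also have "\<dots> \<le> C * (1 - a / 2 + \<gamma> * (\<beta> * V x)) + C * (1 - a / 2 + \<gamma> * (\<beta> * V y))"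
      by (intro add_mono mult_left_mono part x y C)
    also have "\<dots> = C * ((1 - a / 2) * 2 + \<gamma> * (\<beta> * ?s))" by (simp add: algebra_simps)
    also have "\<dots> \<le> C * (?q * 2 + ?q * (\<beta> * ?s))"
      using \<beta> s_pos C param
      by (intro mult_left_mono add_mono mult_right_mono) (auto simp: harris_rate_def le_max_iff_disj)
    finally show ?thesis by (simp add: sum_u distrib_left)
  next
    case False
    then have sR: "R \<le> ?s" by simp
    let ?g = "(1 + \<gamma>) / 2"
    have g_u: "\<And>z. z \<in> space S \<Longrightarrow> \<bar>g z\<bar> \<le> C * ?u z" using s by (simp add: g_def)
    have "\<bar>T g x - T g y\<bar> \<le> C * T ?u x + C * T ?u y"
      using T.abs_le_scale[OF g u_dom g_u x] T.abs_le_scale[OF g u_dom g_u y] by linarith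
    also have "\<dots> \<le> C * (1 + a / 2 + \<gamma> * (\<beta> * V x)) + C * (1 + a / 2 + \<gamma> * (\<beta> * V y))"
      by (intro add_mono mult_left_mono Tu_le x y C)
    also have "\<dots> = C * (2 + \<beta> * (\<gamma> * ?s + 2 * c))" using \<beta>(2) by (simp add: algebra_simps)
    also have "\<dots> \<le> C * (2 + \<beta> * (?g * ?s))"
    proof -
      have "4 * c \<le> (1 - \<gamma>) * ?s" using param mult_left_mono[OF sR, of "1 - \<gamma>"] by linarith
      then have "\<gamma> * ?s + 2 * c \<le> ?g * ?s" by (simp add: field_simps)
      then show ?thesis using \<beta> C by (intro mult_left_mono add_mono) auto
    qed
    also have "\<dots> \<le> C * (?q * (2 + \<beta> * ?s))"
    proof (rule mult_left_mono[OF _ C])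
      have pos: "0 < 2 + \<beta> * R" using \<beta> R by (simp add: add_pos_pos)
      have "0 \<le> 2 * \<beta> * (1 - ?g) * (?s - R)" using \<beta> param sR by (intro mult_nonneg_nonneg) auto
      moreover have "(2 + \<beta> * g * R) * (2 + \<beta> * s) - (2 + \<beta> * (g * s)) * (2 + \<beta> * R)
          = 2 * \<beta> * (1 - g) * (s - R)" for g s
        by (simp add: algebra_simps)
      ultimately have "(2 + \<beta> * (?g * ?s)) * (2 + \<beta> * R) \<le> (2 + \<beta> * ?g * R) * (2 + \<beta> * ?s)"
        by (metis diff_ge_0_iff_ge)
      then have "2 + \<beta> * (?g * ?s) \<le> (2 + \<beta> * ?g * R) / (2 + \<beta> * R) * (2 + \<beta> * ?s)"
        using pos by (simp add: pos_le_divide_eq)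
      also have "\<dots> \<le> ?q * (2 + \<beta> * ?s)"
        using \<beta> s_pos by (intro mult_right_mono) (auto simp: harris_rate_def)
      finally show "2 + \<beta> * (?g * ?s) \<le> ?q * (2 + \<beta> * ?s)" .
    qed
    finally show ?thesis by (simp add: sum_u)
  qed
  then show "\<bar>T f x - T f y\<bar> \<le> ?q * C * (?u x + ?u y)" by (simp add: Tg ac_simps)
qed

lemma geometric_steps_convergent:
  fixes a :: "nat \<Rightarrow> real"
  assumes q: "0 \<le> q" "q < 1" and step: "\<And>n. \<bar>a (Suc n) - a n\<bar> \<le> D * q ^ n"
  obtains l where "a \<longlonglongrightarrow> l" "\<And>n. \<bar>a n - l\<bar> \<le> D * q ^ n / (1 - q)"
proof -
  have D: "0 \<le> D" using step[of 0] by simp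
  have summ: "summable (\<lambda>n. a (Suc n) - a n)"
    by (rule summable_comparison_test'[where g = "\<lambda>n. D * q ^ n"])
       (use q step in \<open>auto intro!: summable_mult summable_geometric\<close>)
  have "(\<lambda>n. \<Sum>i<n. a (Suc i) - a i) \<longlonglongrightarrow> (\<Sum>i. a (Suc i) - a i)"
    by (rule summable_LIMSEQ[OF summ])
  then have "(\<lambda>n. a n - a 0) \<longlonglongrightarrow> (\<Sum>i. a (Suc i) - a i)" by (simp add: sum_lessThan_telescope)
  from tendsto_add[OF this tendsto_const[of "a 0"]]
  obtain l where l: "a \<longlonglongrightarrow> l" by auto
  have tail: "\<bar>a (n + k) - a n\<bar> \<le> D * q ^ n * (1 - q ^ k) / (1 - q)" for n k
  proof (induction k)
    case (Suc k)
    have "\<bar>a (n + Suc k) - a n\<bar> \<le> \<bar>a (n + k) - a n\<bar> + D * q ^ (n + k)"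
      using step[of "n + k"] by simp
    also have "\<dots> \<le> D * q ^ n * (1 - q ^ k) / (1 - q) + D * q ^ (n + k)" using Suc by simp
    also have "\<dots> = D * q ^ n * (1 - q ^ Suc k) / (1 - q)"
      using q by (simp add: field_simps power_add)
    finally show ?case .
  qed simp
  have "\<bar>a n - l\<bar> \<le> D * q ^ n / (1 - q)" for n
  proof -
    have lim: "(\<lambda>k. \<bar>a (k + n) - a n\<bar>) \<longlonglongrightarrow> \<bar>l - a n\<bar>"
      by (intro tendsto_intros LIMSEQ_ignore_initial_segment l)
    have "\<bar>l - a n\<bar> \<le> D * q ^ n / (1 - q)"
    proof (rule LIMSEQ_le_const2[OF lim], intro exI allI impI)
      fix k
      have "D * q ^ n * (1 - q ^ k) / (1 - q) \<le> D * q ^ n * 1 / (1 - q)"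
        using q D by (intro divide_right_mono mult_left_mono) auto
      then show "\<bar>a (k + n) - a n\<bar> \<le> D * q ^ n / (1 - q)" using tail[of n k] by (simp add: add.commute)
    qed
    then show ?thesis by (simp add: abs_minus_commute)
  qed
  with l show ?thesis by (rule that)
qed

text \<open>The point \<open>w\<^sub>0\<close> only fixes additive constants of the solutions of the Poisson equation.\<close>

locale contracting_op = markov_op S u T
  for S :: "'b measure" and u :: "'b \<Rightarrow> real" and T +
  fixes w\<^sub>0 :: 'b and q B :: real
  assumes w\<^sub>0: "w\<^sub>0 \<in> space S"
    and q: "0 < q" "q < 1"
    and growth: "\<And>w. w \<in> space S \<Longrightarrow> T u w \<le> B * u w"
    and contraction: "\<And>f C. f \<in> dominated S u \<Longrightarrow> osc_le S u C f \<Longrightarrow> osc_le S u (q * C) (T f)"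
begin

lemma iter_dominated: "f \<in> dominated S u \<Longrightarrow> (T ^^ n) f \<in> dominated S u"
  using markov_op.closed[OF iter] .

lemma iter_osc:
  assumes "f \<in> dominated S u" "osc_le S u C f"
  shows "osc_le S u (q ^ n * C) ((T ^^ n) f)"
  using assms by (induction n) (auto dest!: contraction[OF iter_dominated] simp: mult.assoc)

lemma osc_nonneg: "osc_le S u C f \<Longrightarrow> 0 \<le> C"
  using osc_leD[OF _ w\<^sub>0 w\<^sub>0, of u C f] V_ge_1[OF w\<^sub>0] by (simp add: zero_le_mult_iff)

lemma step_le:
  assumes f: "f \<in> dominated S u" and osc: "osc_le S u C f" and w: "w \<in> space S"
  shows "\<bar>T f w - f w\<bar> \<le> C * (1 + B) * u w"
proof -
  have C: "0 \<le> C" using osc by (rule osc_nonneg)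
  have "T f w - f w = T (\<lambda>y. f y - f w) w"
    using w by (simp add: diff[OF f const_dominated] const)
  also have "\<bar>\<dots>\<bar> \<le> C * T (\<lambda>y. u y + u w) w"
    by (rule abs_le_scale)
       (use f w osc in \<open>auto intro!: dominated_diff dominated_add const_dominated V_dominated dest: osc_leD\<close>)
  also have "\<dots> = C * (T u w + u w)"
    using w by (simp add: add V_dominated const_dominated const)
  also have "\<dots> \<le> C * (B * u w + u w)" using C growth[OF w] by (intro mult_left_mono) auto
  finally show ?thesis by (simp add: algebra_simps)
qed

definition mean :: "('b \<Rightarrow> real) \<Rightarrow> real" where
  "mean f = lim (\<lambda>n. (T ^^ n) f w\<^sub>0)"

text \<open>Consecutive iterates differ by a geometric amount by \<open>step_le\<close>, so they converge at each point; the
  limits agree because the oscillation of the iterates tends to zero.\<close>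

lemma mean:
  assumes f: "f \<in> dominated S u" and osc: "osc_le S u C f" and w: "w \<in> space S"
  shows mean_tendsto: "(\<lambda>n. (T ^^ n) f w) \<longlonglongrightarrow> mean f"
    and mean_error: "\<bar>(T ^^ n) f w - mean f\<bar> \<le> C * (1 + B) / (1 - q) * u w * q ^ n"
proof -
  have step: "\<bar>(T ^^ Suc n) f w - (T ^^ n) f w\<bar> \<le> C * (1 + B) * u w * q ^ n" if "w \<in> space S" for n w
    using step_le[OF iter_dominated[OF f] iter_osc[OF f osc] that] by (simp add: ac_simps)
  obtain l where l: "(\<lambda>n. (T ^^ n) f w) \<longlonglongrightarrow> l"
    "\<And>n. \<bar>(T ^^ n) f w - l\<bar> \<le> C * (1 + B) * u w * q ^ n / (1 - q)"
    using geometric_steps_convergent[of q, OF _ q(2) step[OF w]] q by auto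
  obtain l' where l': "(\<lambda>n. (T ^^ n) f w\<^sub>0) \<longlonglongrightarrow> l'"
    using geometric_steps_convergent[of q, OF _ q(2) step[OF w\<^sub>0]] q by auto
  have "(\<lambda>n. (T ^^ n) f w - (T ^^ n) f w\<^sub>0) \<longlonglongrightarrow> 0"
  proof (rule Lim_null_comparison)
    show "\<forall>\<^sub>F n in sequentially. norm ((T ^^ n) f w - (T ^^ n) f w\<^sub>0) \<le> q ^ n * (C * (u w + u w\<^sub>0))"
      using osc_leD[OF iter_osc[OF f osc] w w\<^sub>0] by (simp add: mult.assoc)
    show "(\<lambda>n. q ^ n * (C * (u w + u w\<^sub>0))) \<longlonglongrightarrow> 0"
      using q by (intro tendsto_mult_left_zero LIMSEQ_realpow_zero) auto
  qed
  moreover have "(\<lambda>n. (T ^^ n) f w - (T ^^ n) f w\<^sub>0) \<longlonglongrightarrow> l - l'" by (intro tendsto_intros l l')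
  ultimately have "l = l'" using LIMSEQ_unique by fastforce
  moreover have "mean f = l'" unfolding mean_def by (rule limI[OF l'])
  ultimately have "mean f = l" by simp
  then show "(\<lambda>n. (T ^^ n) f w) \<longlonglongrightarrow> mean f"
    "\<bar>(T ^^ n) f w - mean f\<bar> \<le> C * (1 + B) / (1 - q) * u w * q ^ n"
    using l by (auto simp: field_simps)
qed

text \<open>The terms are normalised to vanish at \<open>w\<^sub>0\<close> and not to have mean zero. The series then involves only
  oscillations, and solutions for two operators can be compared without comparing their means.\<close>

definition poisson :: "('b \<Rightarrow> real) \<Rightarrow> 'b \<Rightarrow> real" where
  "poisson f w = (\<Sum>n. (T ^^ n) f w - (T ^^ n) f w\<^sub>0)"

lemma poisson_term_le:
  assumes "f \<in> dominated S u" "osc_le S u C f" "w \<in> space S"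
  shows "\<bar>(T ^^ n) f w - (T ^^ n) f w\<^sub>0\<bar> \<le> C * (u w + u w\<^sub>0) * q ^ n"
  using osc_leD[OF iter_osc[OF assms(1,2)] assms(3) w\<^sub>0] by (simp add: ac_simps)

lemma poisson_summable:
  assumes "f \<in> dominated S u" "osc_le S u C f" "w \<in> space S"
  shows "summable (\<lambda>n. (T ^^ n) f w - (T ^^ n) f w\<^sub>0)"
  by (rule summable_comparison_test'[where g = "\<lambda>n. C * (u w + u w\<^sub>0) * q ^ n"])
     (use q poisson_term_le[OF assms] in \<open>auto intro!: summable_mult summable_geometric\<close>)

lemma poisson_tail:
  assumes "f \<in> dominated S u" "osc_le S u C f" "w \<in> space S"
  shows "\<bar>poisson f w - (\<Sum>i<n. (T ^^ i) f w - (T ^^ i) f w\<^sub>0)\<bar> \<le> C / (1 - q) * q ^ n * (u w + u w\<^sub>0)"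
proof -
  let ?t = "\<lambda>n. (T ^^ n) f w - (T ^^ n) f w\<^sub>0"
  have geo: "(\<lambda>i. C * (u w + u w\<^sub>0) * q ^ n * q ^ i) sums (C * (u w + u w\<^sub>0) * q ^ n * (1 / (1 - q)))"
    using q by (intro sums_mult geometric_sums) auto
  have le: "norm (?t (i + n)) \<le> C * (u w + u w\<^sub>0) * q ^ n * q ^ i" for i
    using poisson_term_le[OF assms, of "i + n"] by (simp add: power_add ac_simps)
  have "poisson f w - sum ?t {..<n} = (\<Sum>i. ?t (i + n))"
    using suminf_minus_initial_segment[OF poisson_summable[OF assms], of n] by (simp add: poisson_def)
  also have "\<bar>\<dots>\<bar> \<le> (\<Sum>i. C * (u w + u w\<^sub>0) * q ^ n * q ^ i)"
    using norm_suminf_le[OF le sums_summable[OF geo]] by simp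
  also have "\<dots> = C / (1 - q) * q ^ n * (u w + u w\<^sub>0)" using sums_unique[OF geo] by (simp add: field_simps)
  finally show ?thesis .
qed

lemma poisson_le:
  assumes "f \<in> dominated S u" "osc_le S u C f" "w \<in> space S"
  shows "\<bar>poisson f w\<bar> \<le> C / (1 - q) * (u w + u w\<^sub>0)"
  using poisson_tail[OF assms, of 0] by simp

lemma poisson_dominated:
  assumes f: "f \<in> dominated S u" and osc: "osc_le S u C f"
  shows "poisson f \<in> dominated S u"
proof (rule dominatedI_of_le)
  have [measurable]: "(T ^^ n) f \<in> borel_measurable S" for n
    by (rule dominated_measurable[OF iter_dominated[OF f]])
  show "poisson f \<in> borel_measurable S" unfolding poisson_def[abs_def] by measurable
  show "(\<lambda>w. C / (1 - q) * (u w + u w\<^sub>0)) \<in> dominated S u"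
    by (intro dominated_scale dominated_add V_dominated const_dominated)
  show "\<bar>poisson f w\<bar> \<le> C / (1 - q) * (u w + u w\<^sub>0)" if "w \<in> space S" for w
    by (rule poisson_le[OF f osc that])
qed

text \<open>The operator is applied to the partial sums, where the sum telescopes. Positivity transfers the
  geometric tail bound through the operator, which justifies the limit.\<close>

lemma poisson_equation:
  assumes f: "f \<in> dominated S u" and osc: "osc_le S u C f" and w: "w \<in> space S"
  shows "poisson f w - T (poisson f) w = f w - mean f"
proof -
  define s where "s n w = (\<Sum>i<n. (T ^^ i) f w - (T ^^ i) f w\<^sub>0)" for n w
  have s_dom: "s n \<in> dominated S u" for n
    unfolding s_def[abs_def] by (intro dominated_sum dominated_diff iter_dominated f const_dominated) auto
  have Ts: "T (s n) w = s n w + (T ^^ n) f w - f w" for n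
  proof -
    have "T (s n) w = (\<Sum>i<n. T (\<lambda>w. (T ^^ i) f w - (T ^^ i) f w\<^sub>0) w)"
      unfolding s_def[abs_def] by (intro sum dominated_diff iter_dominated f const_dominated w) auto
    also have "\<dots> = (\<Sum>i<n. (T ^^ Suc i) f w - (T ^^ i) f w\<^sub>0)"
      using w by (simp add: diff iter_dominated f const_dominated const)
    also have "\<dots> = s n w + (\<Sum>i<n. (T ^^ Suc i) f w - (T ^^ i) f w)"
      by (simp add: s_def sum.distrib[symmetric])
    also have "(\<Sum>i<n. (T ^^ Suc i) f w - (T ^^ i) f w) = (T ^^ n) f w - f w"
      using sum_lessThan_telescope[of "\<lambda>i. (T ^^ i) f w" n] by simp
    finally show ?thesis by simp
  qed
  have lim_s: "(\<lambda>n. s n w) \<longlonglongrightarrow> poisson f w"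
    unfolding s_def poisson_def by (rule summable_LIMSEQ[OF poisson_summable[OF f osc w]])
  have "(\<lambda>n. T (poisson f) w - T (s n) w) \<longlonglongrightarrow> 0"
  proof (rule Lim_null_comparison)
    show "\<forall>\<^sub>F n in sequentially. norm (T (poisson f) w - T (s n) w)
        \<le> q ^ n * (C / (1 - q) * (T u w + u w\<^sub>0))"
    proof (rule always_eventually, rule allI)
      fix n
      have "\<bar>T (\<lambda>w. poisson f w - s n w) w\<bar> \<le> C / (1 - q) * q ^ n * T (\<lambda>w. u w + u w\<^sub>0) w"
        by (rule abs_le_scale)
           (use f osc w s_dom poisson_tail[OF f osc] in
             \<open>auto intro!: dominated_diff dominated_add const_dominated V_dominated poisson_dominated[OF f osc]
                simp: s_def[symmetric]\<close>)
      then show "norm (T (poisson f) w - T (s n) w) \<le> q ^ n * (C / (1 - q) * (T u w + u w\<^sub>0))"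
        using w by (simp add: diff poisson_dominated[OF f osc] s_dom add V_dominated const_dominated const ac_simps)
    qed
    show "(\<lambda>n. q ^ n * (C / (1 - q) * (T u w + u w\<^sub>0))) \<longlonglongrightarrow> 0"
      using q by (intro tendsto_mult_left_zero LIMSEQ_realpow_zero) auto
  qed
  moreover have "(\<lambda>n. T (poisson f) w - T (s n) w) \<longlonglongrightarrow> T (poisson f) w - (poisson f w + mean f - f w)"
    unfolding Ts by (intro tendsto_intros lim_s mean_tendsto[OF f osc w])
  ultimately have "T (poisson f) w - (poisson f w + mean f - f w) = 0" by (rule LIMSEQ_unique[rotated])
  then show ?thesis by simp
qed

end

text \<open>The difference \<open>\<Delta>\<^sub>n\<close> of the iterates satisfies \<open>\<Delta>\<^sub>n\<^sub>+\<^sub>1 = T1 \<Delta>\<^sub>n + (T1 - T2) (T2\<^sup>n f2)\<close>. The first term is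
  contracted and the second is geometrically small, so its oscillation is at most of the order of
  \<open>n * q ^ n\<close>, which is summable.\<close>

lemma poisson_lipschitz:
  assumes T1: "contracting_op S u T1 w\<^sub>0 q B" and T2: "contracting_op S u T2 w\<^sub>0 q B"
    and close: "\<And>g c w. g \<in> dominated S u \<Longrightarrow> (\<And>y. y \<in> space S \<Longrightarrow> \<bar>g y\<bar> \<le> c * u y) \<Longrightarrow> w \<in> space S \<Longrightarrow>
      \<bar>T1 g w - T2 g w\<bar> \<le> \<eta> * c * u w"
    and f1: "f1 \<in> dominated S u" and f2: "f2 \<in> dominated S u" and osc: "osc_le S u C f2"
    and diff: "osc_le S u d (\<lambda>y. f1 y - f2 y)" and w: "w \<in> space S"
  shows "\<bar>contracting_op.poisson T1 w\<^sub>0 f1 w - contracting_op.poisson T2 w\<^sub>0 f2 w\<bar>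
    \<le> (d / (1 - q) + \<eta> * C / (q * (1 - q)\<^sup>2)) * (u w + u w\<^sub>0)"
proof -
  interpret T1: contracting_op S u T1 w\<^sub>0 q B by fact
  interpret T2: contracting_op S u T2 w\<^sub>0 q B by fact
  have q: "0 < q" "q < 1" by (fact T1.q)+
  define \<Delta> where "\<Delta> n y = (T1 ^^ n) f1 y - (T2 ^^ n) f2 y" for n y
  have \<Delta>_dom: "\<Delta> n \<in> dominated S u" for n
    unfolding \<Delta>_def[abs_def] by (intro dominated_diff T1.iter_dominated T2.iter_dominated f1 f2)
  have pert: "osc_le S u (\<eta> * c) (\<lambda>y. T1 h y - T2 h y)" if h: "h \<in> dominated S u" "osc_le S u c h" for h c
  proof (rule osc_le_of_abs_le)
    fix x assume x: "x \<in> space S"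
    obtain s where s: "\<And>z. z \<in> space S \<Longrightarrow> \<bar>h z - s\<bar> \<le> c * u z"
      using h(2) by (rule osc_le_centre) blast
    have "\<bar>T1 (\<lambda>z. h z - s) x - T2 (\<lambda>z. h z - s) x\<bar> \<le> \<eta> * c * u x"
      by (rule close) (use s h x in \<open>auto intro!: dominated_diff T1.const_dominated\<close>)
    then show "\<bar>T1 h x - T2 h x\<bar> \<le> \<eta> * c * u x"
      using x h by (simp add: T1.diff T2.diff T1.const_dominated T1.const T2.const)
  qed
  \<comment> \<open>The recursion produces n * q ^ n / q; the factor Suc n matches the derivative of the geometric series.\<close>
  have \<Delta>_osc: "osc_le S u (d * q ^ n + \<eta> * C / q * (real (Suc n) * q ^ n)) (\<Delta> n)" for n
  proof (induction n)
    case 0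
    have "0 \<le> \<eta> * C / q"
    proof -
      have "0 \<le> \<eta> * 1 * u w\<^sub>0"
        by (rule order_trans[OF abs_ge_zero close[of "\<lambda>_. 1" 1 w\<^sub>0]])
           (use T1.w\<^sub>0 T1.const_dominated T1.V_ge_1 in auto)
      then have "0 \<le> \<eta>" using T1.V_ge_1[OF T1.w\<^sub>0] by (simp add: zero_le_mult_iff)
      then show ?thesis using T2.osc_nonneg[OF osc] q by simp
    qed
    have "\<bar>f1 x - f2 x - (f1 y - f2 y)\<bar> \<le> (d + \<eta> * C / q) * (u x + u y)"
      if "x \<in> space S" "y \<in> space S" for x y
    proof -
      have "d * (u x + u y) \<le> (d + \<eta> * C / q) * (u x + u y)"
        using \<open>0 \<le> \<eta> * C / q\<close> T1.V_ge_1[OF that(1)] T1.V_ge_1[OF that(2)]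
        by (intro mult_right_mono) auto
      then show ?thesis using osc_leD[OF diff that] by linarith
    qed
    then show ?case by (simp add: osc_le_def \<Delta>_def)
  next
    case (Suc n)
    show ?case unfolding osc_le_def
    proof (intro ballI)
      fix x y assume xy: "x \<in> space S" "y \<in> space S"
      let ?h = "(T2 ^^ n) f2"
      have h: "?h \<in> dominated S u" by (rule T2.iter_dominated[OF f2])
      have dec: "\<Delta> (Suc n) z = T1 (\<Delta> n) z + (T1 ?h z - T2 ?h z)" if "z \<in> space S" for z
        using T1.diff[OF T1.iter_dominated[OF f1] h that] by (simp add: \<Delta>_def[abs_def])
      have "\<bar>\<Delta> (Suc n) x - \<Delta> (Suc n) y\<bar>
          \<le> \<bar>T1 (\<Delta> n) x - T1 (\<Delta> n) y\<bar> + \<bar>(T1 ?h x - T2 ?h x) - (T1 ?h y - T2 ?h y)\<bar>"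
        using dec[OF xy(1)] dec[OF xy(2)] by linarith
      also have "\<dots> \<le> q * (d * q ^ n + \<eta> * C / q * (real (Suc n) * q ^ n)) * (u x + u y)
          + \<eta> * (q ^ n * C) * (u x + u y)"
        by (intro add_mono osc_leD[OF T1.contraction[OF \<Delta>_dom Suc] xy]
              osc_leD[OF pert[OF h T2.iter_osc[OF f2 osc]] xy])
      also have "\<dots> = (d * q ^ Suc n + \<eta> * C / q * (real (Suc (Suc n)) * q ^ Suc n)) * (u x + u y)"
        using q by (simp add: field_simps)
      finally show "\<bar>\<Delta> (Suc n) x - \<Delta> (Suc n) y\<bar>
          \<le> (d * q ^ Suc n + \<eta> * C / q * (real (Suc (Suc n)) * q ^ Suc n)) * (u x + u y)" .
    qed
  qed
  obtain C1 where C1: "\<And>x. x \<in> space S \<Longrightarrow> \<bar>f1 x\<bar> \<le> C1 * u x" using f1 by (rule dominatedE) blast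
  have osc1: "osc_le S u C1 f1" using C1 by (rule osc_le_of_abs_le)
  have "(\<lambda>n. d * q ^ n + \<eta> * C / q * (real (Suc n) * q ^ n)) sums
      (d * (1 / (1 - q)) + \<eta> * C / q * (1 / (1 - q)\<^sup>2))"
    using q by (intro sums_add sums_mult geometric_sums geometric_deriv_sums) auto
  from sums_mult2[OF this, of "u w + u w\<^sub>0"]
  have geo: "(\<lambda>n. (d * q ^ n + \<eta> * C / q * (real (Suc n) * q ^ n)) * (u w + u w\<^sub>0)) sums
      ((d / (1 - q) + \<eta> * C / (q * (1 - q)\<^sup>2)) * (u w + u w\<^sub>0))" by simp
  have "T1.poisson f1 w - T2.poisson f2 w = (\<Sum>n. \<Delta> n w - \<Delta> n w\<^sub>0)"
    unfolding T1.poisson_def T2.poisson_def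
    by (subst suminf_diff[OF T1.poisson_summable[OF f1 osc1 w] T2.poisson_summable[OF f2 osc w]])
       (simp add: \<Delta>_def algebra_simps)
  also have "\<bar>\<dots>\<bar> \<le> (\<Sum>n. (d * q ^ n + \<eta> * C / q * (real (Suc n) * q ^ n)) * (u w + u w\<^sub>0))"
    using norm_suminf_le[OF _ sums_summable[OF geo], of "\<lambda>n. \<Delta> n w - \<Delta> n w\<^sub>0"]
      osc_leD[OF \<Delta>_osc w T1.w\<^sub>0] by simp
  also have "\<dots> = (d / (1 - q) + \<eta> * C / (q * (1 - q)\<^sup>2)) * (u w + u w\<^sub>0)"
    by (rule sums_unique[OF geo, symmetric])
  finally show ?thesis .
qed

section \<open>The stationary distribution\<close>

text \<open>Invariance of a measure is a statement about sets. It extends to nonnegative functions by monotone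
  convergence, and to dominated ones by adding a multiple of the weight.\<close>

lemma stationary_integral:
  assumes Q: "Q \<in> S \<rightarrow>\<^sub>M prob_algebra S" and P: "markov_op S v (kernel_op Q)"
    and Qv: "\<And>w. w \<in> space S \<Longrightarrow> integrable (Q w) v"
    and stat: "stationary_distribution S Q \<mu>" and \<mu>v: "integrable \<mu> v" and f: "f \<in> dominated S v"
  shows stationary_integrable: "integrable \<mu> f"
    and stationary_integral_kernel_op: "(\<integral>x. kernel_op Q f x \<partial>\<mu>) = (\<integral>x. f x \<partial>\<mu>)"
    and stationary_integral_average:
      "(\<integral>x. (op_average m (\<lambda>j. kernel_op Q ^^ j) ^^ n) f x \<partial>\<mu>) = (\<integral>x. f x \<partial>\<mu>)"
proof -
  interpret P: markov_op S v "kernel_op Q" by fact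
  have \<mu>: "sets \<mu> = sets S" "space \<mu> = space S" "\<mu> \<bind> Q = \<mu>"
    using stat by (auto simp: stationary_distribution_def space_prob_algebra dest: sets_eq_imp_space_eq)
  note QS = prob_kernelD[OF Q]
  note int\<mu> = integrable_dominated[OF \<mu>(1) \<mu>v]
  note intQ = integrable_dominated[OF QS(1) Qv]
  show "integrable \<mu> f" by (rule int\<mu>[OF f])
  have nonneg: "(\<integral>x. kernel_op Q g x \<partial>\<mu>) = (\<integral>x. g x \<partial>\<mu>)"
    if g: "g \<in> dominated S v" and pos: "\<And>x. x \<in> space S \<Longrightarrow> 0 \<le> g x" for g
  proof -
    have "ennreal (\<integral>x. g x \<partial>\<mu>) = (\<integral>\<^sup>+x. ennreal (g x) \<partial>\<mu>)"
      by (intro nn_integral_eq_integral[symmetric] int\<mu>[OF g] AE_I2) (use pos \<mu> in auto)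
    also have "\<dots> = (\<integral>\<^sup>+x. ennreal (g x) \<partial>(\<mu> \<bind> Q))" using \<mu> by simp
    also have "\<dots> = (\<integral>\<^sup>+x. \<integral>\<^sup>+y. ennreal (g y) \<partial>Q x \<partial>\<mu>)"
      using dominated_measurable[OF g] measurable_prob_algebraD[OF Q] \<mu>
      by (intro nn_integral_bind[where B = S]) (auto cong: measurable_cong_sets)
    also have "\<dots> = (\<integral>\<^sup>+x. ennreal (kernel_op Q g x) \<partial>\<mu>)"
      unfolding kernel_op_def using \<mu> QS pos
      by (intro nn_integral_cong nn_integral_eq_integral intQ[OF _ _ g] AE_I2) auto
    also have "\<dots> = ennreal (\<integral>x. kernel_op Q g x \<partial>\<mu>)"
      by (intro nn_integral_eq_integral int\<mu> P.closed g AE_I2 P.nonneg) (use pos \<mu> in auto)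
    finally show ?thesis
      using pos \<mu> P.nonneg[OF g pos]
      by (subst (asm) ennreal_inj) (auto intro!: Bochner_Integration.integral_nonneg)
  qed
  have kernel_op: "(\<integral>x. kernel_op Q g x \<partial>\<mu>) = (\<integral>x. g x \<partial>\<mu>)" if g: "g \<in> dominated S v" for g
  proof -
    obtain c where c: "\<And>w. w \<in> space S \<Longrightarrow> \<bar>g w\<bar> \<le> c * v w" using g by (rule dominatedE) blast
    have cv: "(\<lambda>y. \<bar>c\<bar> * v y) \<in> dominated S v" by (intro dominated_scale P.V_dominated)
    have pos: "0 \<le> \<bar>c\<bar> * v x" "0 \<le> g x + \<bar>c\<bar> * v x" if "x \<in> space S" for x
    proof -
      have "c * v x \<le> \<bar>c\<bar> * v x" using P.V_ge_1[OF that] by (intro mult_right_mono) auto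
      with c[OF that] show "0 \<le> g x + \<bar>c\<bar> * v x" by linarith
      show "0 \<le> \<bar>c\<bar> * v x" using P.V_ge_1[OF that] by simp
    qed
    have "(\<integral>x. kernel_op Q (\<lambda>y. g y + \<bar>c\<bar> * v y) x \<partial>\<mu>) = (\<integral>x. g x \<partial>\<mu>) + (\<integral>x. \<bar>c\<bar> * v x \<partial>\<mu>)"
      using nonneg[OF dominated_add[OF g cv] pos(2)] int\<mu>[OF g] int\<mu>[OF cv] by simp
    moreover have "(\<integral>x. kernel_op Q (\<lambda>y. g y + \<bar>c\<bar> * v y) x \<partial>\<mu>)
        = (\<integral>x. kernel_op Q g x + kernel_op Q (\<lambda>y. \<bar>c\<bar> * v y) x \<partial>\<mu>)"
      by (rule Bochner_Integration.integral_cong) (use \<mu> P.add[OF g cv] in auto)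
    ultimately show ?thesis
      using nonneg[OF cv pos(1)] int\<mu>[OF P.closed[OF g]] int\<mu>[OF P.closed[OF cv]] by simp
  qed
  show "(\<integral>x. kernel_op Q f x \<partial>\<mu>) = (\<integral>x. f x \<partial>\<mu>)" by (rule kernel_op[OF f])
  let ?K = "op_average m (\<lambda>j. kernel_op Q ^^ j)"
  have pow_dom: "(kernel_op Q ^^ j) g \<in> dominated S v" if "g \<in> dominated S v" for g j
    by (rule markov_op.closed[OF markov_op_funpow[OF P] that])
  have pow: "(\<integral>x. (kernel_op Q ^^ j) g x \<partial>\<mu>) = (\<integral>x. g x \<partial>\<mu>)" if g: "g \<in> dominated S v" for g j
    by (induction j) (use g kernel_op[OF pow_dom[OF g]] in auto)
  have K: "(\<integral>x. ?K g x \<partial>\<mu>) = (\<integral>x. g x \<partial>\<mu>)" if g: "g \<in> dominated S v" for g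
    unfolding op_average_def using int\<mu>[OF pow_dom[OF g]] pow[OF g] by simp
  have "(?K ^^ n) f \<in> dominated S v" for n
    by (intro markov_op.closed[OF markov_op_funpow[OF markov_op_average[OF markov_op_funpow[OF P]]]] f)
  then show "(\<integral>x. (?K ^^ n) f x \<partial>\<mu>) = (\<integral>x. f x \<partial>\<mu>)"
    by (induction n) (simp_all add: K)
qed

text \<open>The average of the powers may contract where the kernel itself does not: it is the average that
  is minorized on a whole sublevel set of the weight.\<close>

locale ergodic_kernel =
  fixes S :: "'b measure" and Q :: "'b \<Rightarrow> 'b measure" and u :: "'b \<Rightarrow> real"
    and m :: nat and w\<^sub>0 :: 'b and q B :: real
  assumes Q: "Q \<in> S \<rightarrow>\<^sub>M prob_algebra S"
    and P: "markov_op S u (kernel_op Q)"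
    and Qu: "\<And>w. w \<in> space S \<Longrightarrow> integrable (Q w) u"
    and K: "contracting_op S u (op_average m (\<lambda>j. kernel_op Q ^^ j)) w\<^sub>0 q B"
begin

abbreviation average :: "('b \<Rightarrow> real) \<Rightarrow> 'b \<Rightarrow> real" where
  "average \<equiv> op_average m (\<lambda>j. kernel_op Q ^^ j)"

sublocale P: markov_op S u "kernel_op Q" by (rule P)
sublocale K: contracting_op S u average w\<^sub>0 q B by (rule K)

lemma dominated_osc:
  assumes "f \<in> dominated S u"
  obtains C where "osc_le S u C f"
  using assms by (meson dominatedE osc_le_of_abs_le)

lemma average_commute:
  assumes f: "f \<in> dominated S u" and w: "w \<in> space S"
  shows "(average ^^ n) (kernel_op Q f) w = kernel_op Q ((average ^^ n) f) w"
  using w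
proof (induction n arbitrary: w)
  case (Suc n)
  let ?g = "(average ^^ n) f"
  have g: "?g \<in> dominated S u" by (rule K.iter_dominated[OF f])
  have pow: "(kernel_op Q ^^ j) ?g \<in> dominated S u" for j
    by (rule markov_op.closed[OF markov_op_funpow[OF P] g])
  have "(average ^^ Suc n) (kernel_op Q f) w = average (kernel_op Q ?g) w"
    using K.cong[OF K.iter_dominated[OF P.closed[OF f]] P.closed[OF g] Suc.IH Suc.prems] by simp
  also have "\<dots> = (\<Sum>j\<le>m. kernel_op Q ((kernel_op Q ^^ j) ?g) w) / real (Suc m)"
    unfolding op_average_def by (simp add: funpow_swap1)
  also have "\<dots> = kernel_op Q (\<lambda>y. \<Sum>j\<le>m. (kernel_op Q ^^ j) ?g y) w / real (Suc m)"
    using Suc.prems by (simp add: P.sum pow)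
  also have "\<dots> = kernel_op Q (average ?g) w"
  proof -
    have sum_dom: "(\<lambda>y. \<Sum>j\<le>m. (kernel_op Q ^^ j) ?g y) \<in> dominated S u"
      by (intro P.dominated_sum pow) auto
    show ?thesis
      using P.scale[OF sum_dom Suc.prems, of "1 / real (Suc m)"] by (simp add: op_average_def[abs_def])
  qed
  finally show ?case by simp
qed simp

text \<open>The kernel commutes with its average, so it can be moved outside the iterates, which are already
  close to a constant.\<close>

lemma mean_kernel_op:
  assumes f: "f \<in> dominated S u"
  shows "K.mean (kernel_op Q f) = K.mean f"
proof -
  obtain C where osc: "osc_le S u C f" using dominated_osc f by metis
  obtain C' where osc': "osc_le S u C' (kernel_op Q f)" using dominated_osc P.closed[OF f] by metis
  let ?D = "C * (1 + B) / (1 - q)"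
  have "(\<lambda>n. (average ^^ n) (kernel_op Q f) w\<^sub>0 - K.mean f) \<longlonglongrightarrow> 0"
  proof (rule Lim_null_comparison)
    show "\<forall>\<^sub>F n in sequentially. norm ((average ^^ n) (kernel_op Q f) w\<^sub>0 - K.mean f) \<le> ?D * kernel_op Q u w\<^sub>0 * q ^ n"
    proof (rule always_eventually, rule allI)
      fix n
      have dom: "(\<lambda>y. (average ^^ n) f y - K.mean f) \<in> dominated S u"
        by (intro dominated_diff K.iter_dominated f P.const_dominated)
      have "(average ^^ n) (kernel_op Q f) w\<^sub>0 - K.mean f = kernel_op Q (\<lambda>y. (average ^^ n) f y - K.mean f) w\<^sub>0"
        by (simp add: average_commute f K.w\<^sub>0 P.diff K.iter_dominated P.const_dominated P.const)
      also have "\<bar>\<dots>\<bar> \<le> (?D * q ^ n) * kernel_op Q u w\<^sub>0"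
        by (rule P.abs_le_scale[OF dom P.V_dominated _ K.w\<^sub>0])
           (use K.mean_error[OF f osc] in \<open>simp add: ac_simps\<close>)
      finally show "norm ((average ^^ n) (kernel_op Q f) w\<^sub>0 - K.mean f) \<le> ?D * kernel_op Q u w\<^sub>0 * q ^ n"
        by (simp add: ac_simps)
    qed
    show "(\<lambda>n. ?D * kernel_op Q u w\<^sub>0 * q ^ n) \<longlonglongrightarrow> 0"
      using K.q by (intro tendsto_mult_right_zero LIMSEQ_realpow_zero) auto
  qed
  then have "(\<lambda>n. (average ^^ n) (kernel_op Q f) w\<^sub>0) \<longlonglongrightarrow> K.mean f" by (simp add: LIM_zero_iff)
  with K.mean_tendsto[OF P.closed[OF f] osc' K.w\<^sub>0] show ?thesis by (rule LIMSEQ_unique)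
qed

lemma mean_tendsto:
  assumes "f \<in> dominated S u"
  shows "(\<lambda>n. (average ^^ n) f w\<^sub>0) \<longlonglongrightarrow> K.mean f"
  using K.mean_tendsto[OF assms _ K.w\<^sub>0] dominated_osc assms by metis

text \<open>Bounded convergence is inherited from the iterates because they converge to the mean at a rate
  that is uniform over functions with a common bound.\<close>

lemma markov_op_mean: "markov_op S u (\<lambda>f _. K.mean f)"
proof unfold_locales
  interpret I: markov_op S u "average ^^ n" for n by (rule K.iter)
  show "u \<in> borel_measurable S" "\<And>w. w \<in> space S \<Longrightarrow> 1 \<le> u w" by (fact K.V_meas K.V_ge_1)+
  show "(\<lambda>_. K.mean f) \<in> dominated S u" for f by (rule K.const_dominated)
  show "K.mean (\<lambda>y. f y + g y) = K.mean f + K.mean g"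
    if "f \<in> dominated S u" "g \<in> dominated S u" for f g
    using mean_tendsto[OF dominated_add[OF that]] tendsto_add[OF mean_tendsto[OF that(1)] mean_tendsto[OF that(2)]]
    by (intro LIMSEQ_unique) (auto simp: I.add that K.w\<^sub>0)
  show "K.mean (\<lambda>y. c * f y) = c * K.mean f" if "f \<in> dominated S u" for f c
    using mean_tendsto[OF dominated_scale[OF that]] tendsto_mult_left[OF mean_tendsto[OF that], of c]
    by (intro LIMSEQ_unique) (auto simp: I.scale that K.w\<^sub>0)
  show "K.mean (\<lambda>_. 1) = 1"
    using mean_tendsto[OF K.const_dominated[of 1]] by (simp add: I.one K.w\<^sub>0 LIMSEQ_const_iff)
  show "0 \<le> K.mean f" if "f \<in> dominated S u" "\<And>y. y \<in> space S \<Longrightarrow> 0 \<le> f y" for f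
    using LIMSEQ_le_const[OF mean_tendsto[OF that(1)]] I.nonneg[OF that K.w\<^sub>0] by blast
  show "(\<lambda>i. K.mean (f i)) \<longlonglongrightarrow> K.mean g"
    if f: "\<And>i. f i \<in> borel_measurable S" and g: "g \<in> borel_measurable S"
      and b: "\<And>i y. y \<in> space S \<Longrightarrow> \<bar>f i y\<bar> \<le> b"
      and lim: "\<And>y. y \<in> space S \<Longrightarrow> (\<lambda>i. f i y) \<longlonglongrightarrow> g y"
    for f :: "nat \<Rightarrow> 'b \<Rightarrow> real" and g b
  proof (rule LIMSEQ_I)
    fix r :: real assume r: "0 < r"
    have b0: "0 \<le> b" using b[OF K.w\<^sub>0, of 0] by linarith
    have gb: "\<bar>g y\<bar> \<le> b" if "y \<in> space S" for y
      using LIMSEQ_le_const2[OF tendsto_rabs[OF lim[OF that]]] b[OF that] by blast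
    have bu: "osc_le S u b h" if "\<And>y. y \<in> space S \<Longrightarrow> \<bar>h y\<bar> \<le> b" for h
    proof (rule osc_le_of_abs_le)
      fix x assume "x \<in> space S"
      then show "\<bar>h x\<bar> \<le> b * u x"
        using that[of x] mult_left_mono[OF K.V_ge_1[of x] b0] by simp
    qed
    let ?D = "b * (1 + B) / (1 - q) * u w\<^sub>0"
    have "(\<lambda>n. ?D * q ^ n) \<longlonglongrightarrow> 0"
      using K.q by (intro tendsto_mult_right_zero LIMSEQ_realpow_zero) auto
    then have "\<exists>n. \<forall>k\<ge>n. norm (?D * q ^ k - 0) < r / 3" using r by (intro LIMSEQ_D) auto
    then obtain n where "norm (?D * q ^ n - 0) < r / 3" by blast
    then have n: "?D * q ^ n < r / 3" unfolding real_norm_def by linarith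
    from LIMSEQ_D[OF I.bounded_convergence[OF f g b lim K.w\<^sub>0, of n], of "r / 3"] r
    obtain N where N: "\<And>i. N \<le> i \<Longrightarrow> \<bar>(average ^^ n) (f i) w\<^sub>0 - (average ^^ n) g w\<^sub>0\<bar> < r / 3" by auto
    have err: "\<bar>(average ^^ n) h w\<^sub>0 - K.mean h\<bar> \<le> ?D * q ^ n"
      if "h \<in> borel_measurable S" "\<And>y. y \<in> space S \<Longrightarrow> \<bar>h y\<bar> \<le> b" for h
      by (rule K.mean_error[OF K.bounded_dominated[OF that] bu K.w\<^sub>0]) (use that in auto)
    have "\<bar>K.mean (f i) - K.mean g\<bar> < r" if "N \<le> i" for i
      using N[OF that] n err[OF f b, of i] err[OF g gb] by linarith
    then show "\<exists>no. \<forall>i\<ge>no. norm (K.mean (f i) - K.mean g) < r" by auto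
  qed
qed

sublocale mean: markov_op S u "\<lambda>f _. K.mean f" by (rule markov_op_mean)

text \<open>The set function is the limit, on sets, of the laws of the averaged chain started at \<open>w\<^sub>0\<close>.\<close>

definition limit_measure :: "'b measure" where
  "limit_measure = measure_of (space S) (sets S) (\<lambda>A. ennreal (K.mean (indicator A)))"

lemma indicator_dominated: "A \<in> sets S \<Longrightarrow> indicator A \<in> dominated S u"
  by (rule K.bounded_dominated[where B = 1]) (auto simp: indicator_def)

lemma sets_limit_measure: "sets limit_measure = sets S" "space limit_measure = space S"
  by (simp_all add: limit_measure_def)

text \<open>Countable additivity is bounded convergence of the mean along the partial unions.\<close>

lemma emeasure_limit_measure:
  assumes "A \<in> sets S"
  shows "emeasure limit_measure A = ennreal (K.mean (indicator A))"
  unfolding limit_measure_def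
proof (rule emeasure_measure_of_sigma)
  show "sigma_algebra (space S) (sets S)" by (rule sets.sigma_algebra_axioms)
  show "positive (sets S) (\<lambda>A. ennreal (K.mean (indicator A)))"
    using mean.const[OF K.w\<^sub>0, of 0] by (simp add: positive_def indicator_def[abs_def])
  show "countably_additive (sets S) (\<lambda>A. ennreal (K.mean (indicator A)))"
    unfolding countably_additive_def
  proof (intro allI impI)
    fix A :: "nat \<Rightarrow> 'b set"
    assume A: "range A \<subseteq> sets S" and disj: "disjoint_family A" and UA: "\<Union> (range A) \<in> sets S"
    have Ai: "A i \<in> sets S" for i using A by auto
    have "(\<Sum>i<n. K.mean (indicator (A i))) = K.mean (indicator (\<Union>i<n. A i))" for n
    proof -
      have "(\<Sum>i<n. K.mean (indicator (A i))) = K.mean (\<lambda>y. \<Sum>i<n. indicator (A i) y)"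
        by (rule mean.sum[symmetric, OF _ _ K.w\<^sub>0]) (auto intro: indicator_dominated Ai)
      also have "(\<lambda>y. \<Sum>i<n. indicator (A i) y) = (indicator (\<Union>i<n. A i) :: 'b \<Rightarrow> real)"
        by (rule ext, rule indicator_UN_disjoint[symmetric])
           (auto intro: disjoint_family_on_mono[OF _ disj])
      finally show ?thesis .
    qed
    moreover have "(\<lambda>n. K.mean (indicator (\<Union>i<n. A i))) \<longlonglongrightarrow> K.mean (indicator (\<Union> (range A)))"
    proof (rule mean.bounded_convergence[where B = 1, OF _ _ _ _ K.w\<^sub>0])
      show "(\<lambda>n. indicator (\<Union>i<n. A i) y) \<longlonglongrightarrow> (indicator (\<Union> (range A)) y :: real)" for y
        by (rule LIMSEQ_indicator_UN)
    qed (use Ai in \<open>auto simp: indicator_def\<close>)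
    ultimately have "(\<lambda>i. K.mean (indicator (A i))) sums K.mean (indicator (\<Union> (range A)))"
      by (simp add: sums_def)
    then show "(\<Sum>i. ennreal (K.mean (indicator (A i)))) = ennreal (K.mean (indicator (\<Union> (range A))))"
      by (intro suminf_ennreal_eq mean.nonneg[OF indicator_dominated[OF Ai] _ K.w\<^sub>0]) auto
  qed
qed (rule assms)

lemma prob_space_limit_measure: "prob_space limit_measure"
proof
  have "K.mean (indicator (space S)) = K.mean (\<lambda>_. 1)"
    by (rule mean.cong[OF _ _ _ K.w\<^sub>0]) (auto intro: indicator_dominated K.const_dominated)
  then show "emeasure limit_measure (space limit_measure) = 1"
    by (simp add: sets_limit_measure emeasure_limit_measure mean.one[OF K.w\<^sub>0])
qed

lemma integral_limit_measure:
  assumes "g \<in> borel_measurable S" "\<And>x. 0 \<le> g x" "\<And>x. x \<in> space S \<Longrightarrow> g x \<le> b"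
  shows "(\<integral>x. g x \<partial>limit_measure) = K.mean g"
proof -
  interpret prob_space limit_measure by (rule prob_space_limit_measure)
  have meas: "h \<in> borel_measurable limit_measure" if "h \<in> borel_measurable S" for h :: "'b \<Rightarrow> real"
    using that by (simp cong: measurable_cong_sets add: sets_limit_measure)
  have int: "integrable limit_measure h"
    if "h \<in> borel_measurable S" "\<And>x. 0 \<le> h x" "\<And>x. x \<in> space S \<Longrightarrow> h x \<le> b" for h and b :: real
    using that by (intro integrable_const_bound[where B = b] AE_I2 meas) (auto simp: sets_limit_measure)
  show ?thesis
    using assms
  proof (induction arbitrary: b rule: borel_measurable_induct_real)
    case (set A)
    then show ?case
      using emeasure_limit_measure[OF set(1)] mean.nonneg[OF indicator_dominated[OF set(1)] _ K.w\<^sub>0]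
      by (simp add: sets_limit_measure measure_def sets.Int_space_eq2)
  next
    case (mult f c)
    show ?case
    proof (cases "c = 0")
      case True
      then show ?thesis using mean.const[OF K.w\<^sub>0, of 0] by simp
    next
      case False
      with mult have c: "0 < c" by simp
      have f: "f x \<le> b / c" if "x \<in> space S" for x
        using mult.prems[OF that] c by (simp add: pos_le_divide_eq mult.commute)
      have "f \<in> dominated S u" by (rule K.bounded_dominated[where B = "b / c"]) (use mult f in auto)
      then show ?thesis using mult.IH[OF f] mean.scale[OF _ K.w\<^sub>0] by simp
    qed
  next
    case (add f g)
    have le: "f x \<le> b" "g x \<le> b" if "x \<in> space S" for x
      using add.prems[OF that] add.hyps(2)[of x] add.hyps(4)[of x] by linarith+
    have dom: "f \<in> dominated S u" "g \<in> dominated S u"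
      by (rule K.bounded_dominated[where B = b]; use add le in auto)+
    then show ?case
      using add.IH(1)[OF le(1)] add.IH(2)[OF le(2)] int[OF add.hyps(1,2) le(1)] int[OF add.hyps(3,4) le(2)]
        mean.add[OF dom(2,1) K.w\<^sub>0]
      by simp
  next
    case (seq F)
    have F_le: "F i x \<le> g x" if x: "x \<in> space S" for i x
      using incseq_le[OF _ seq.hyps(4)[OF x], of i] seq.hyps(3)
      by (force simp: incseq_def le_fun_def)
    have F_b: "F i x \<le> b" if x: "x \<in> space S" for i x
      using F_le[OF x, of i] seq.prems[OF x] by linarith
    have "(\<lambda>i. \<integral>x. F i x \<partial>limit_measure) \<longlonglongrightarrow> (\<integral>x. g x \<partial>limit_measure)"
      by (rule integral_dominated_convergence[where w = "\<lambda>_. b"])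
         (use seq.hyps F_b assms in \<open>auto intro!: AE_I2 meas simp: sets_limit_measure\<close>)
    moreover have "(\<lambda>i. K.mean (F i)) \<longlonglongrightarrow> K.mean g"
      by (rule mean.bounded_convergence[where B = b, OF _ _ _ _ K.w\<^sub>0])
         (use seq.hyps F_b assms in auto)
    moreover have "(\<integral>x. F i x \<partial>limit_measure) = K.mean (F i)" for i by (rule seq.IH[OF F_b])
    ultimately show ?case using LIMSEQ_unique by fastforce
  qed
qed

lemma limit_measure_stationary: "stationary_distribution S Q limit_measure"
  unfolding stationary_distribution_def
proof
  show "limit_measure \<in> space (prob_algebra S)"
    by (simp add: space_prob_algebra sets_limit_measure prob_space_limit_measure)
  have ne: "space limit_measure \<noteq> {}" using K.w\<^sub>0 by (auto simp: sets_limit_measure)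
  have Q': "Q \<in> limit_measure \<rightarrow>\<^sub>M subprob_algebra S"
    using measurable_prob_algebraD[OF Q] by (simp cong: measurable_cong_sets add: sets_limit_measure)
  show "limit_measure \<bind> Q = limit_measure"
  proof (rule measure_eqI)
    show sets: "sets (limit_measure \<bind> Q) = sets limit_measure"
      using sets_bind[OF sets_kernel[OF Q'] ne] by (simp add: sets_limit_measure)
    fix A assume "A \<in> sets (limit_measure \<bind> Q)"
    then have A: "A \<in> sets S" by (simp add: sets sets_limit_measure)
    let ?g = "kernel_op Q (indicator A)"
    have prob: "prob_space (Q x)" "sets (Q x) = sets S" "space (Q x) = space S" if "x \<in> space S" for x
      using measurable_space[OF Q that] by (auto simp: space_prob_algebra dest: sets_eq_imp_space_eq)
    have g: "?g \<in> borel_measurable S"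
      by (rule dominated_measurable[OF P.closed[OF indicator_dominated[OF A]]])
    have g_eq: "?g x = measure (Q x) A" if "x \<in> space S" for x
      using prob[OF that] A by (simp add: kernel_op_def sets.Int_space_eq2)
    have g0: "0 \<le> ?g x" for x by (simp add: kernel_op_def)
    have g1: "?g x \<le> 1" if "x \<in> space S" for x
      using g_eq[OF that] prob_space.prob_le_1[OF prob(1)[OF that]] by simp
    interpret prob_space limit_measure by (rule prob_space_limit_measure)
    have "emeasure (limit_measure \<bind> Q) A = (\<integral>\<^sup>+x. emeasure (Q x) A \<partial>limit_measure)"
      by (rule emeasure_bind[OF ne Q' A])
    also have "\<dots> = (\<integral>\<^sup>+x. ennreal (?g x) \<partial>limit_measure)"
      by (intro nn_integral_cong)
         (simp add: sets_limit_measure g_eq finite_measure.emeasure_eq_measure prob_space.finite_measure prob)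
    also have "\<dots> = ennreal (\<integral>x. ?g x \<partial>limit_measure)"
      by (intro nn_integral_eq_integral integrable_const_bound[where B = 1] AE_I2)
         (use g g0 g1 in \<open>auto simp: sets_limit_measure cong: measurable_cong_sets\<close>)
    also have "\<dots> = ennreal (K.mean (indicator A))"
      using integral_limit_measure[OF g g0 g1] mean_kernel_op[OF indicator_dominated[OF A]] by simp
    also have "\<dots> = emeasure limit_measure A" by (simp add: emeasure_limit_measure[OF A])
    finally show "emeasure (limit_measure \<bind> Q) A = emeasure limit_measure A" .
  qed
qed

text \<open>Integrating the iterates of an indicator against a stationary law leaves the integral unchanged,
  while dominated convergence sends it to the mean. The constant weight \<open>1\<close> is used here, since an
  arbitrary stationary law is not known to integrate the weight \<open>u\<close>.\<close>

lemma stationary_unique: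
  assumes stat: "stationary_distribution S Q \<mu>"
  shows "\<mu> = limit_measure"
proof (rule measure_eqI)
  have \<mu>: "sets \<mu> = sets S" "space \<mu> = space S" and "prob_space \<mu>"
    using stat by (auto simp: stationary_distribution_def space_prob_algebra dest: sets_eq_imp_space_eq)
  show "sets \<mu> = sets limit_measure" by (simp add: \<mu> sets_limit_measure)
  interpret prob_space \<mu> by fact
  have QS: "prob_space (Q w)" if "w \<in> space S" for w
    using measurable_space[OF Q that] by (auto simp: space_prob_algebra)
  have Q1: "integrable (Q w) (\<lambda>_. 1 :: real)" if "w \<in> space S" for w
    using prob_space.finite_measure[OF QS[OF that]] by (rule finite_measure.integrable_const)
  have P1: "markov_op S (\<lambda>_. 1) (kernel_op Q)"
    by (rule markov_op_kernel_op[OF Q, where B = 1]) (use Q1 QS in \<open>auto simp: prob_space.prob_space\<close>)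
  fix A assume "A \<in> sets \<mu>"
  then have A: "A \<in> sets S" by (simp add: \<mu>)
  let ?f = "indicator A :: 'b \<Rightarrow> real"
  have f1: "?f \<in> dominated S (\<lambda>_. 1)" using A by (intro dominatedI[where c = 1]) (auto simp: indicator_def)
  obtain C where osc: "osc_le S u C ?f" using dominated_osc indicator_dominated[OF A] by metis
  have iter1: "markov_op S (\<lambda>_. 1) (average ^^ n)" for n
    by (intro markov_op_funpow markov_op_average P1)
  have "(\<lambda>n. \<integral>x. (average ^^ n) ?f x \<partial>\<mu>) \<longlonglongrightarrow> (\<integral>x. K.mean ?f \<partial>\<mu>)"
  proof (rule integral_dominated_convergence[where w = "\<lambda>_. 1"])
    show "(average ^^ n) ?f \<in> borel_measurable \<mu>" for n
      using dominated_measurable[OF markov_op.closed[OF iter1 f1]] \<mu> by (simp cong: measurable_cong_sets)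
    show "AE x in \<mu>. (\<lambda>n. (average ^^ n) ?f x) \<longlonglongrightarrow> K.mean ?f"
      by (rule AE_I2) (use K.mean_tendsto[OF indicator_dominated[OF A] osc] \<mu> in auto)
    show "AE x in \<mu>. norm ((average ^^ n) ?f x) \<le> 1" for n
      by (rule AE_I2) (use markov_op.bounded[OF iter1, of ?f 1] A \<mu> in \<open>auto simp: indicator_def\<close>)
  qed auto
  moreover have "(\<integral>x. (average ^^ n) ?f x \<partial>\<mu>) = measure \<mu> A" for n
  proof -
    have "(\<integral>x. (average ^^ n) ?f x \<partial>\<mu>) = (\<integral>x. ?f x \<partial>\<mu>)"
      by (rule stationary_integral_average[OF Q P1 _ stat _ f1]) (use Q1 in auto)
    then show ?thesis using A \<mu> by (simp add: sets.Int_space_eq2)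
  qed
  ultimately have "measure \<mu> A = K.mean ?f"
    by (simp add: LIMSEQ_const_iff prob_space)
  then show "emeasure \<mu> A = emeasure limit_measure A"
    by (simp add: emeasure_eq_measure emeasure_limit_measure[OF A])
qed

lemma the_stationary_eq: "the_stationary S Q = limit_measure"
  unfolding the_stationary_def
  using limit_measure_stationary stationary_unique by (rule the_equality)

text \<open>The integrals of the truncated weight are bounded by the mean of the weight; Fatou's lemma removes
  the truncation.\<close>

lemma limit_measure_weight_integrable: "integrable limit_measure u"
proof (rule integrable_of_nn_integral_le)
  interpret prob_space limit_measure by (rule prob_space_limit_measure)
  let ?g = "\<lambda>n x. max 0 (min (u x) (real n))"
  have [measurable]: "u \<in> borel_measurable S" by (rule K.V_meas)
  have u: "u \<in> borel_measurable limit_measure"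
    using K.V_meas by (simp cong: measurable_cong_sets add: sets_limit_measure)
  show "u \<in> borel_measurable limit_measure" by (rule u)
  have le: "(\<integral>\<^sup>+x. ennreal (?g n x) \<partial>limit_measure) \<le> ennreal (K.mean u)" for n
  proof -
    have g: "?g n \<in> borel_measurable S" "\<And>x. 0 \<le> ?g n x" "\<And>x. x \<in> space S \<Longrightarrow> ?g n x \<le> real n"
      by auto
    have "(\<integral>\<^sup>+x. ennreal (?g n x) \<partial>limit_measure) = ennreal (\<integral>x. ?g n x \<partial>limit_measure)"
      by (intro nn_integral_eq_integral integrable_const_bound[where B = "real n"] AE_I2)
         (use u in auto)
    also have "\<dots> = ennreal (K.mean (?g n))" using integral_limit_measure[OF g] by simp
    also have "\<dots> \<le> ennreal (K.mean u)"
    proof (rule ennreal_leI, rule mean.mono[OF _ K.V_dominated _ K.w\<^sub>0])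
      show "?g n \<in> dominated S u" by (rule K.bounded_dominated[where B = "real n"]) auto
      show "?g n y \<le> u y" if "y \<in> space S" for y using K.V_ge_1[OF that] by auto
    qed
    finally show ?thesis .
  qed
  have "(\<integral>\<^sup>+x. ennreal \<bar>u x\<bar> \<partial>limit_measure) = (\<integral>\<^sup>+x. liminf (\<lambda>n. ennreal (?g n x)) \<partial>limit_measure)"
  proof (rule nn_integral_cong)
    fix x assume "x \<in> space limit_measure"
    then have x: "1 \<le> u x" using K.V_ge_1 by (simp add: sets_limit_measure)
    obtain N :: nat where N: "u x \<le> real N" using real_arch_simple by blast
    have "(\<lambda>n. ennreal (?g n x)) \<longlonglongrightarrow> ennreal \<bar>u x\<bar>"
    proof (rule tendsto_eventually, rule eventually_sequentiallyI[of N])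
      fix n assume "N \<le> n"
      then have "u x \<le> real n" using N by linarith
      then show "ennreal (?g n x) = ennreal \<bar>u x\<bar>" using x by (simp add: min_absorb1)
    qed
    then show "ennreal \<bar>u x\<bar> = liminf (\<lambda>n. ennreal (?g n x))"
      by (intro lim_imp_Liminf[symmetric]) auto
  qed
  also have "\<dots> \<le> liminf (\<lambda>n. \<integral>\<^sup>+x. ennreal (?g n x) \<partial>limit_measure)"
    by (rule nn_integral_liminf) (use u in measurable)
  also have "\<dots> \<le> liminf (\<lambda>n. ennreal (K.mean u))"
    by (rule Liminf_mono) (use le in auto)
  also have "\<dots> = ennreal (K.mean u)" by (rule Liminf_const) simp
  finally show "(\<integral>\<^sup>+x. ennreal \<bar>u x\<bar> \<partial>limit_measure) \<le> ennreal (K.mean u)" .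
qed

theorem integral_the_stationary:
  assumes f: "f \<in> dominated S u"
  shows "integrable (the_stationary S Q) f" "(\<integral>x. f x \<partial>the_stationary S Q) = K.mean f"
  unfolding the_stationary_eq
proof -
  interpret prob_space limit_measure by (rule prob_space_limit_measure)
  note stat = limit_measure_stationary limit_measure_weight_integrable
  have int: "integrable limit_measure g" if "g \<in> dominated S u" for g
    by (rule stationary_integrable[OF Q P _ stat that]) (rule Qu)
  have avg: "(\<integral>x. (average ^^ n) f x \<partial>limit_measure) = (\<integral>x. f x \<partial>limit_measure)" for n
    by (rule stationary_integral_average[OF Q P _ stat f]) (rule Qu)
  show "integrable limit_measure f" by (rule int[OF f])
  obtain C where osc: "osc_le S u C f" using dominated_osc f by metis
  let ?D = "C * (1 + B) / (1 - q)"
  have le: "\<bar>(\<integral>x. f x \<partial>limit_measure) - K.mean f\<bar> \<le> ?D * (\<integral>x. u x \<partial>limit_measure) * q ^ n" for n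
  proof -
    have dom: "(\<lambda>x. (average ^^ n) f x - K.mean f) \<in> dominated S u"
      by (intro dominated_diff K.iter_dominated f K.const_dominated)
    have "(\<integral>x. (average ^^ n) f x - K.mean f \<partial>limit_measure) = (\<integral>x. f x \<partial>limit_measure) - K.mean f"
      by (subst Bochner_Integration.integral_diff[OF int[OF K.iter_dominated[OF f]] int[OF K.const_dominated]])
        (simp only: avg lebesgue_integral_const prob_space real_scaleR_def mult_1)
    then have "\<bar>(\<integral>x. f x \<partial>limit_measure) - K.mean f\<bar> = \<bar>\<integral>x. (average ^^ n) f x - K.mean f \<partial>limit_measure\<bar>"
      by (simp only:)
    also have "\<dots> \<le> (\<integral>x. \<bar>(average ^^ n) f x - K.mean f\<bar> \<partial>limit_measure)" by (rule integral_abs_bound)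
    also have "\<dots> \<le> (\<integral>x. ?D * u x * q ^ n \<partial>limit_measure)"
    proof (rule integral_mono)
      show "integrable limit_measure (\<lambda>x. \<bar>(average ^^ n) f x - K.mean f\<bar>)"
        by (rule integrable_abs[OF int[OF dom]])
      show "integrable limit_measure (\<lambda>x. ?D * u x * q ^ n)"
        by (intro integrable_mult_left integrable_mult_right limit_measure_weight_integrable)
      show "\<bar>(average ^^ n) f x - K.mean f\<bar> \<le> ?D * u x * q ^ n" if "x \<in> space limit_measure" for x
        by (rule K.mean_error[OF f osc]) (use that in \<open>simp add: sets_limit_measure\<close>)
    qed
    also have "\<dots> = ?D * (\<integral>x. u x \<partial>limit_measure) * q ^ n"
      by (subst integral_mult_left_zero, subst integral_mult_right_zero) (rule refl)
    finally show ?thesis .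
  qed
  have lim: "(\<lambda>n. ?D * (\<integral>x. u x \<partial>limit_measure) * q ^ n) \<longlonglongrightarrow> 0"
    using K.q by (intro tendsto_mult_right_zero LIMSEQ_realpow_zero) auto
  have "\<bar>(\<integral>x. f x \<partial>limit_measure) - K.mean f\<bar> \<le> 0"
    by (rule LIMSEQ_le_const[OF lim]) (rule exI[of _ 0], intro allI impI le)
  then show "(\<integral>x. f x \<partial>limit_measure) = K.mean f" by simp
qed

end

section \<open>Contraction from drift and minorization\<close>

lemma dominated_harris_weight:
  assumes V: "\<And>w. w \<in> space S \<Longrightarrow> 1 \<le> V w" and \<beta>: "0 < \<beta>"
  shows "dominated S (harris_weight \<beta> V) = dominated S V"
proof -
  have le1: "harris_weight \<beta> V w \<le> (1 + \<beta>) * V w" if "w \<in> space S" for w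
    using V[OF that] by (simp add: harris_weight_def algebra_simps)
  have le2: "V w \<le> (1 / \<beta>) * harris_weight \<beta> V w" if "w \<in> space S" for w
    using \<beta> by (simp add: harris_weight_def field_simps)
  have bound: "\<exists>c'. \<forall>w\<in>space S. \<bar>f w\<bar> \<le> c' * v w"
    if "\<And>w. w \<in> space S \<Longrightarrow> u w \<le> k * v w" "\<And>w. w \<in> space S \<Longrightarrow> 0 \<le> u w"
      "\<forall>w\<in>space S. \<bar>f w\<bar> \<le> c * u w" for u v :: "'a \<Rightarrow> real" and f :: "'a \<Rightarrow> real" and k c
  proof (intro exI ballI)
    fix w assume w: "w \<in> space S"
    have "\<bar>f w\<bar> \<le> c * u w" using that(3) w by blast
    also have "\<dots> \<le> \<bar>c\<bar> * u w" by (rule mult_right_mono[OF _ that(2)[OF w]]) simp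
    also have "\<dots> \<le> \<bar>c\<bar> * (k * v w)" by (rule mult_left_mono[OF that(1)[OF w]]) simp
    finally show "\<bar>f w\<bar> \<le> \<bar>c\<bar> * k * v w" by (simp add: mult.assoc)
  qed
  have u0: "0 \<le> harris_weight \<beta> V w" "0 \<le> V w" if "w \<in> space S" for w
    using V[OF that] \<beta> by (auto simp: harris_weight_def)
  have "\<exists>c'. \<forall>w\<in>space S. \<bar>f w\<bar> \<le> c' * V w"
    if "\<forall>w\<in>space S. \<bar>f w\<bar> \<le> c * harris_weight \<beta> V w" for f c
    by (rule bound[where u = "harris_weight \<beta> V"]) (use le1 u0 that in auto)
  moreover have "\<exists>c'. \<forall>w\<in>space S. \<bar>f w\<bar> \<le> c' * harris_weight \<beta> V w"
    if "\<forall>w\<in>space S. \<bar>f w\<bar> \<le> c * V w" for f c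
    by (rule bound[where u = V and k = "1 / \<beta>"]) (use le2 u0 that in auto)
  ultimately show ?thesis unfolding dominated_def by blast
qed

lemma markov_op_harris_weight:
  assumes T: "markov_op S V T" and \<beta>: "0 < \<beta>"
  shows "markov_op S (harris_weight \<beta> V) T"
proof -
  interpret markov_op S V T by fact
  have dom: "dominated S (harris_weight \<beta> V) = dominated S V"
    by (rule dominated_harris_weight[OF _ \<beta>]) (rule V_ge_1)
  show ?thesis
  proof unfold_locales
    have [measurable]: "V \<in> borel_measurable S" by (rule V_meas)
    show "harris_weight \<beta> V \<in> borel_measurable S" unfolding harris_weight_def[abs_def] by measurable
    show "1 \<le> harris_weight \<beta> V w" if "w \<in> space S" for w
      using V_ge_1[OF that] \<beta> by (simp add: harris_weight_def)
  qed (use closed add scale one nonneg bounded_convergence in \<open>simp_all add: dom, blast\<close>)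
qed

context markov_op
begin

context
  fixes \<rho> b :: real and A :: "'b set"
  assumes \<rho>: "0 \<le> \<rho>" "\<rho> < 1" and b: "0 \<le> b" and A: "A \<in> sets S"
    and drift: "\<And>w. w \<in> space S \<Longrightarrow> T V w \<le> \<rho> * V w + b * indicator A w"
begin

lemma drift_indicator_dominated: "indicator A \<in> dominated S V"
  using A by (intro bounded_dominated[where B = 1]) (auto simp: indicator_def)

lemma drift_step:
  assumes w: "w \<in> space S"
  shows "(T ^^ Suc n) V w \<le> \<rho> * (T ^^ n) V w + b * (T ^^ n) (indicator A) w"
proof -
  interpret I: markov_op S V "T ^^ n" by (rule iter)
  note dom = V_dominated drift_indicator_dominated
  have "(T ^^ Suc n) V w = (T ^^ n) (T V) w" by (simp add: funpow_swap1)
  also have "\<dots> \<le> (T ^^ n) (\<lambda>y. \<rho> * V y + b * indicator A y) w"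
    by (rule I.mono) (use w drift in \<open>auto intro!: closed dominated_add dominated_scale dom\<close>)
  also have "\<dots> = \<rho> * (T ^^ n) V w + b * (T ^^ n) (indicator A) w"
    using w by (simp add: I.add I.scale dominated_scale dom)
  finally show ?thesis .
qed

lemma iter_indicator_bounds:
  assumes w: "w \<in> space S"
  shows "0 \<le> (T ^^ n) (indicator A) w" "(T ^^ n) (indicator A) w \<le> 1"
  using markov_op.nonneg[OF iter drift_indicator_dominated _ w] markov_op.bounded[OF iter, of "indicator A" 1 w n] A w
  by (auto simp: indicator_def abs_le_iff)

lemma drift_bound:
  assumes w: "w \<in> space S"
  shows "(T ^^ n) V w \<le> \<rho> ^ n * V w + b / (1 - \<rho>)"
proof (induction n)
  case 0
  then show ?case using \<rho> b by simp
next
  case (Suc n)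
  have "(T ^^ Suc n) V w \<le> \<rho> * (\<rho> ^ n * V w + b / (1 - \<rho>)) + b * 1"
    by (rule order_trans[OF drift_step[OF w]], intro add_mono mult_left_mono Suc iter_indicator_bounds w \<rho> b)
  also have "\<dots> = \<rho> ^ Suc n * V w + b / (1 - \<rho>)" using \<rho> by (simp add: field_simps)
  finally show ?case .
qed

text \<open>Iterating the drift lets the weight decay except for the contributions of the visits to \<open>A\<close>.
  As the weight never falls below \<open>1\<close>, there must be visits once \<open>\<rho> ^ n * V w\<close> is small.\<close>

lemma drift_visits:
  assumes w: "w \<in> space S"
  shows "1 \<le> \<rho> ^ n * V w + b * (\<Sum>j<n. (T ^^ j) (indicator A) w)"
proof -
  have "(T ^^ n) V w \<le> \<rho> ^ n * V w + b * (\<Sum>j<n. (T ^^ j) (indicator A) w)"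
  proof (induction n)
    case (Suc n)
    have "0 \<le> b * (\<Sum>j<n. (T ^^ j) (indicator A) w)"
      using b by (intro mult_nonneg_nonneg sum_nonneg iter_indicator_bounds w) auto
    then have "\<rho> * (b * (\<Sum>j<n. (T ^^ j) (indicator A) w)) \<le> b * (\<Sum>j<n. (T ^^ j) (indicator A) w)"
      using \<rho> by (simp add: mult_left_le_one_le)
    with drift_step[OF w, of n] mult_left_mono[OF Suc \<rho>(1)] show ?case
      by (simp add: algebra_simps)
  qed simp
  moreover have "(T ^^ n) (\<lambda>_. 1) w \<le> (T ^^ n) V w"
    by (rule markov_op.mono[OF iter const_dominated V_dominated V_ge_1 w])
  ultimately show ?thesis using markov_op.one[OF iter w, of n] by simp
qed

lemma average_drift:
  assumes w: "w \<in> space S" and m: "1 \<le> m"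
  shows "op_average m (\<lambda>j. T ^^ j) V w \<le> (1 + \<rho>) / 2 * V w + b / (1 - \<rho>)"
proof -
  have geo: "(\<Sum>j\<le>m. \<rho> ^ j) \<le> 1 + real m * \<rho>"
  proof -
    have "(\<Sum>j\<le>m. \<rho> ^ j) = 1 + (\<Sum>j<m. \<rho> ^ Suc j)"
      using sum.atMost_shift[of "\<lambda>j. \<rho> ^ j" m] by simp
    also have "(\<Sum>j<m. \<rho> ^ Suc j) \<le> (\<Sum>j<m. \<rho>)"
      using \<rho> by (intro sum_mono) (auto simp: mult_left_le power_le_one)
    finally show ?thesis by simp
  qed
  also have "\<dots> \<le> real (Suc m) * ((1 + \<rho>) / 2)"
  proof -
    have "0 \<le> (real m - 1) * (1 - \<rho>)" using m \<rho> by simp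
    then show ?thesis by (simp add: field_simps)
  qed
  finally have coef: "(\<Sum>j\<le>m. \<rho> ^ j) * V w \<le> real (Suc m) * ((1 + \<rho>) / 2) * V w"
    using V_ge_1[OF w] by (intro mult_right_mono) auto
  have "(\<Sum>j\<le>m. (T ^^ j) V w) \<le> (\<Sum>j\<le>m. \<rho> ^ j * V w + b / (1 - \<rho>))"
    by (intro sum_mono drift_bound w)
  also have "\<dots> = (\<Sum>j\<le>m. \<rho> ^ j) * V w + real (Suc m) * (b / (1 - \<rho>))"
    by (simp add: sum.distrib sum_distrib_right)
  also have "\<dots> \<le> real (Suc m) * ((1 + \<rho>) / 2 * V w + b / (1 - \<rho>))"
    using coef by (simp add: algebra_simps)
  finally show ?thesis by (simp add: op_average_def pos_divide_le_eq mult.commute)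
qed

text \<open>From any point of the sublevel set the expected number of visits to \<open>A\<close> before time \<open>n\<close> is at least
  \<open>1 / (2 * b)\<close>, and \<open>N\<close> steps after each visit the minorization applies.\<close>

lemma average_minorization:
  assumes w: "w \<in> space S" and R: "V w \<le> R" "\<rho> ^ n * R \<le> 1 / 2" and b0: "0 < b"
    and f: "f \<in> dominated S V" "\<And>y. y \<in> space S \<Longrightarrow> 0 \<le> f y"
    and e: "0 \<le> e" and minor: "\<And>y. y \<in> A \<Longrightarrow> e \<le> (T ^^ N) f y"
  shows "e / (2 * b * real (Suc (n + N))) \<le> op_average (n + N) (\<lambda>j. T ^^ j) f w"
proof -
  have fN: "(T ^^ N) f \<in> dominated S V" by (rule markov_op.closed[OF iter f(1)])
  have le: "e * indicator A y \<le> (T ^^ N) f y" if "y \<in> space S" for y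
    using minor[of y] markov_op.nonneg[OF iter f that] by (auto simp: indicator_def)
  have visit_le: "e * (T ^^ j) (indicator A) w \<le> (T ^^ (j + N)) f w" for j
  proof -
    have "e * (T ^^ j) (indicator A) w = (T ^^ j) (\<lambda>y. e * indicator A y) w"
      by (rule markov_op.scale[OF iter drift_indicator_dominated w, symmetric])
    also have "\<dots> \<le> (T ^^ j) ((T ^^ N) f) w"
      by (rule markov_op.mono[OF iter dominated_scale[OF drift_indicator_dominated] fN le w])
    finally show ?thesis by (simp add: funpow_add)
  qed
  have "\<rho> ^ n * V w \<le> 1 / 2"
    using mult_left_mono[OF R(1), of "\<rho> ^ n"] R(2) \<rho> by simp
  then have visits: "1 / (2 * b) \<le> (\<Sum>j<n. (T ^^ j) (indicator A) w)"
    using drift_visits[OF w, of n] b0 by (simp add: field_simps)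
  have "e / (2 * b) = e * (1 / (2 * b))" by simp
  also have "\<dots> \<le> e * (\<Sum>j<n. (T ^^ j) (indicator A) w)" by (rule mult_left_mono[OF visits e])
  also have "\<dots> \<le> (\<Sum>j<n. (T ^^ (j + N)) f w)"
    unfolding sum_distrib_left by (intro sum_mono visit_le)
  also have "\<dots> = (\<Sum>j\<in>(\<lambda>j. j + N) ` {..<n}. (T ^^ j) f w)"
    by (subst sum.reindex) (auto simp: inj_on_def)
  also have "\<dots> \<le> (\<Sum>j\<le>n + N. (T ^^ j) f w)"
    by (intro sum_mono2 markov_op.nonneg[OF iter f w]) auto
  finally have "e / (2 * b) / real (Suc (n + N)) \<le> (\<Sum>j\<le>n + N. (T ^^ j) f w) / real (Suc (n + N))"
    by (rule divide_right_mono) simp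
  then show ?thesis by (simp only: op_average_def divide_divide_eq_left)
qed

end

end

text \<open>All constants are built from those of the drift and of the minorization, which is what makes them
  independent of \<open>\<theta>\<close>.\<close>

lemma uniform_contraction:
  fixes T :: "'a \<Rightarrow> ('b \<Rightarrow> real) \<Rightarrow> 'b \<Rightarrow> real"
  assumes T: "\<And>\<theta>. \<theta> \<in> \<Theta> \<Longrightarrow> markov_op S V (T \<theta>)" and \<Phi>: "markov_op S V (\<lambda>f _. \<Phi> f)"
    and \<rho>: "0 \<le> \<rho>" "\<rho> < 1" and b: "0 < b" and \<epsilon>: "0 < \<epsilon>"
    and A: "A \<in> sets S" and w\<^sub>0: "w\<^sub>0 \<in> space S"
    and drift: "\<And>\<theta> w. \<theta> \<in> \<Theta> \<Longrightarrow> w \<in> space S \<Longrightarrow> T \<theta> V w \<le> \<rho> * V w + b * indicator A w"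
    and minor: "\<And>\<theta> f w. \<theta> \<in> \<Theta> \<Longrightarrow> f \<in> dominated S V \<Longrightarrow> (\<And>y. y \<in> space S \<Longrightarrow> 0 \<le> f y) \<Longrightarrow>
      w \<in> A \<Longrightarrow> \<epsilon> * \<Phi> f \<le> (T \<theta> ^^ N) f w"
  obtains \<beta> q B m where "0 < \<beta>"
    "\<And>\<theta>. \<theta> \<in> \<Theta> \<Longrightarrow> contracting_op S (harris_weight \<beta> V) (op_average m (\<lambda>j. T \<theta> ^^ j)) w\<^sub>0 q B"
proof -
  define c where "c = b / (1 - \<rho>)"
  \<comment> \<open>\<gamma> and c are the drift constants of the averaged kernel; R is the least radius that harris_contraction admits for them.\<close>
  define \<gamma> where "\<gamma> = (1 + \<rho>) / 2"
  define R where "R = 4 * c / (1 - \<gamma>)"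
  have c: "0 < c" using b \<rho> by (simp add: c_def)
  have \<gamma>: "0 \<le> \<gamma>" "\<gamma> < 1" using \<rho> by (auto simp: \<gamma>_def)
  have R: "0 < R" "4 * c \<le> (1 - \<gamma>) * R" using c \<gamma> by (auto simp: R_def)
  \<comment> \<open>After n steps the weight of a point of the sublevel set has decayed to at most one half.\<close>
  obtain n0 where n0: "\<rho> ^ n0 < 1 / (2 * R)"
    using real_arch_pow_inv[of "1 / (2 * R)" \<rho>] R \<rho> by auto
  define n where "n = Suc n0"
  have n: "\<rho> ^ n * R \<le> 1 / 2"
  proof -
    have "\<rho> ^ n \<le> \<rho> ^ n0" using \<rho> by (simp add: n_def mult_left_le_one_le)
    then have "\<rho> ^ n * R \<le> \<rho> ^ n0 * R" using R by (intro mult_right_mono) auto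
    moreover have "\<rho> ^ n0 * R \<le> 1 / 2" using n0 R by (simp add: field_simps)
    ultimately show ?thesis by linarith
  qed
  define m where "m = n + N"
  define a where "a = \<epsilon> / (2 * b * real (Suc m))"
  have a: "0 < a" using \<epsilon> b by (simp add: a_def)
  define \<beta> where "\<beta> = a / (2 * c)"
  have \<beta>: "0 < \<beta>" using a c by (simp add: \<beta>_def)
  show ?thesis
  proof (rule that[OF \<beta>])
    fix \<theta> assume \<theta>: "\<theta> \<in> \<Theta>"
    interpret T: markov_op S V "T \<theta>" by (rule T[OF \<theta>])
    let ?K = "op_average m (\<lambda>j. T \<theta> ^^ j)"
    have K: "markov_op S V ?K" by (intro markov_op_average T.iter)
    interpret K: markov_op S V ?K by (rule K)
    have dom: "dominated S (harris_weight \<beta> V) = dominated S V"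
      by (rule dominated_harris_weight[OF _ \<beta>]) (rule T.V_ge_1)
    have K_drift: "?K V w \<le> \<gamma> * V w + c" if "w \<in> space S" for w
      using T.average_drift[OF \<rho> _ A drift[OF \<theta>] that, of m] b
      by (simp add: \<gamma>_def c_def m_def n_def)
    have K_minor: "a * \<Phi> f \<le> ?K f w"
      if f: "f \<in> dominated S V" "\<And>y. y \<in> space S \<Longrightarrow> 0 \<le> f y" and w: "w \<in> space S" "V w \<le> R" for f w
    proof -
      have \<Phi>f: "0 \<le> \<epsilon> * \<Phi> f" using markov_op.nonneg[OF \<Phi> f w\<^sub>0] \<epsilon> by simp
      show ?thesis
        using T.average_minorization[OF \<rho> _ A drift[OF \<theta>] w n b f \<Phi>f minor[OF \<theta> f]] b
        by (simp add: a_def m_def)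
    qed
    show "contracting_op S (harris_weight \<beta> V) ?K w\<^sub>0 (harris_rate \<gamma> R a \<beta>) (1 + \<beta> * c)"
    proof (intro contracting_op.intro markov_op_harris_weight[OF K \<beta>] contracting_op_axioms.intro)
      show "w\<^sub>0 \<in> space S" by (rule w\<^sub>0)
      show "0 < harris_rate \<gamma> R a \<beta>" "harris_rate \<gamma> R a \<beta> < 1"
        using harris_rate_bounds[OF \<gamma> R(1) a \<beta>] by auto
      show "?K (harris_weight \<beta> V) w \<le> (1 + \<beta> * c) * harris_weight \<beta> V w" if w: "w \<in> space S" for w
      proof -
        have "?K (harris_weight \<beta> V) w = 1 + \<beta> * ?K V w"
          unfolding harris_weight_def[abs_def] using w
          by (simp add: K.add K.scale K.const K.const_dominated K.V_dominated dominated_scale)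
        also have "\<dots> \<le> 1 + \<beta> * (V w + c)"
        proof -
          have "\<gamma> * V w \<le> 1 * V w" using \<gamma> K.V_ge_1[OF w] by (intro mult_right_mono) auto
          then have "?K V w \<le> V w + c" using K_drift[OF w] by linarith
          then show ?thesis using \<beta> by simp
        qed
        also have "\<dots> \<le> (1 + \<beta> * c) * harris_weight \<beta> V w"
          using \<beta> c K.V_ge_1[OF w] by (simp add: harris_weight_def algebra_simps)
        finally show ?thesis .
      qed
      show "osc_le S (harris_weight \<beta> V) (harris_rate \<gamma> R a \<beta> * C) (?K f)"
        if "f \<in> dominated S (harris_weight \<beta> V)" "osc_le S (harris_weight \<beta> V) C f" for f C
        by (rule harris_contraction[OF K \<Phi> _ K_drift K_minor \<gamma> c a R(2) \<beta>_def _ that(2)])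
           (use that(1) dom in auto)
    qed
  qed
qed

section \<open>Powers of kernels and their dependence on the parameter\<close>

lemma kernel_power_measurable:
  assumes "Q \<in> S \<rightarrow>\<^sub>M prob_algebra S"
  shows "kernel_power S Q n \<in> S \<rightarrow>\<^sub>M subprob_algebra S"
proof (induction n)
  case (Suc n)
  then show ?case
    using measurable_bind2[OF measurable_prob_algebraD[OF assms] Suc] by simp
qed (simp add: return_measurable)

lemma nn_integral_kernel_power:
  assumes Q: "Q \<in> S \<rightarrow>\<^sub>M prob_algebra S" and P: "markov_op S V (kernel_op Q)"
    and QV: "\<And>w. w \<in> space S \<Longrightarrow> integrable (Q w) V"
    and f: "f \<in> dominated S V" "\<And>y. y \<in> space S \<Longrightarrow> 0 \<le> f y" and w: "w \<in> space S"
  shows "(\<integral>\<^sup>+y. ennreal (f y) \<partial>kernel_power S Q n w) = ennreal ((kernel_op Q ^^ n) f w)"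
  using w
proof (induction n arbitrary: w)
  case 0
  have [measurable]: "f \<in> borel_measurable S" by (rule dominated_measurable[OF f(1)])
  show ?case using 0 by (simp add: nn_integral_return)
next
  case (Suc n)
  interpret I: markov_op S V "kernel_op Q ^^ n" by (rule markov_op_funpow[OF P])
  have [measurable]: "f \<in> borel_measurable S" by (rule dominated_measurable[OF f(1)])
  note Qw = prob_kernelD[OF Q Suc.prems]
  have "(\<integral>\<^sup>+y. ennreal (f y) \<partial>kernel_power S Q (Suc n) w)
      = (\<integral>\<^sup>+x. \<integral>\<^sup>+y. ennreal (f y) \<partial>kernel_power S Q n x \<partial>Q w)"
    unfolding kernel_power.simps
    by (rule nn_integral_bind[where B = S])
       (use kernel_power_measurable[OF Q, of n] Qw in \<open>simp_all cong: measurable_cong_sets\<close>)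
  also have "\<dots> = (\<integral>\<^sup>+x. ennreal ((kernel_op Q ^^ n) f x) \<partial>Q w)"
    by (rule nn_integral_cong) (simp add: Qw Suc.IH)
  also have "\<dots> = ennreal (\<integral>x. (kernel_op Q ^^ n) f x \<partial>Q w)"
    by (intro nn_integral_eq_integral integrable_dominated[OF Qw(1) QV[OF Suc.prems]] I.closed f AE_I2 I.nonneg)
       (use Qw in auto)
  finally show ?case by (simp add: kernel_op_def[of Q "(kernel_op Q ^^ n) f"])
qed

lemma kernel_power_minorization:
  assumes Q: "Q \<in> S \<rightarrow>\<^sub>M prob_algebra S" and P: "markov_op S V (kernel_op Q)"
    and QV: "\<And>w. w \<in> space S \<Longrightarrow> integrable (Q w) V"
    and \<phi>: "\<phi> \<in> space (prob_algebra S)" and \<epsilon>: "0 < \<epsilon>" and w: "w \<in> space S"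
    and minor: "\<And>E. E \<in> sets S \<Longrightarrow> \<epsilon> * measure \<phi> E \<le> measure (kernel_power S Q N w) E"
    and f: "f \<in> dominated S V" "\<And>y. y \<in> space S \<Longrightarrow> 0 \<le> f y"
  shows "ennreal \<epsilon> * (\<integral>\<^sup>+y. ennreal (f y) \<partial>\<phi>) \<le> ennreal ((kernel_op Q ^^ N) f w)"
proof -
  let ?K = "kernel_power S Q N w"
  have K: "sets ?K = sets S" "subprob_space ?K"
    using measurable_space[OF kernel_power_measurable[OF Q] w] by (auto simp: space_subprob_algebra)
  interpret K: subprob_space ?K by (rule K)
  have \<phi>': "sets \<phi> = sets S" "prob_space \<phi>" using \<phi> by (auto simp: space_prob_algebra)
  interpret \<phi>: prob_space \<phi> by (rule \<phi>')
  have fm: "f \<in> borel_measurable S" by (rule dominated_measurable[OF f(1)])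
  have "scale_measure (ennreal \<epsilon>) \<phi> \<le> ?K"
  proof (subst le_measure)
    show "sets (scale_measure (ennreal \<epsilon>) \<phi>) = sets ?K" using K \<phi>' by simp
    have "emeasure (scale_measure (ennreal \<epsilon>) \<phi>) E \<le> emeasure ?K E" if "E \<in> sets S" for E
      using minor[OF that] \<epsilon>
      by (simp add: \<phi>.emeasure_eq_measure K.emeasure_eq_measure ennreal_mult[symmetric])
    then show "\<forall>E\<in>sets (scale_measure (ennreal \<epsilon>) \<phi>). emeasure (scale_measure (ennreal \<epsilon>) \<phi>) E \<le> emeasure ?K E"
      using \<phi>' by simp
  qed
  then have "(\<integral>\<^sup>+y. ennreal (f y) \<partial>scale_measure (ennreal \<epsilon>) \<phi>) \<le> (\<integral>\<^sup>+y. ennreal (f y) \<partial>?K)"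
    by (intro nn_integral_mono_measure) (use K \<phi>' in auto)
  moreover have "(\<integral>\<^sup>+y. ennreal (f y) \<partial>scale_measure (ennreal \<epsilon>) \<phi>) = ennreal \<epsilon> * (\<integral>\<^sup>+y. ennreal (f y) \<partial>\<phi>)"
    by (rule nn_integral_scale_measure) (use fm \<phi>' in \<open>simp cong: measurable_cong_sets\<close>)
  ultimately show ?thesis by (simp add: nn_integral_kernel_power[OF Q P QV f w])
qed

lemma funpow_abs_le:
  assumes T: "markov_op S u T" and growth: "\<And>w. w \<in> space S \<Longrightarrow> T u w \<le> B * u w" and B: "0 \<le> B"
    and f: "f \<in> dominated S u" "\<And>y. y \<in> space S \<Longrightarrow> \<bar>f y\<bar> \<le> c * u y" and c: "0 \<le> c"
    and w: "w \<in> space S"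
  shows "\<bar>(T ^^ n) f w\<bar> \<le> B ^ n * c * u w"
  using w
proof (induction n arbitrary: w)
  case (Suc n)
  interpret markov_op S u T by (rule T)
  have "\<bar>(T ^^ Suc n) f w\<bar> \<le> B ^ n * c * T u w"
    unfolding funpow.simps comp_apply
    by (rule abs_le_scale[OF markov_op.closed[OF iter f(1)] V_dominated Suc.IH Suc.prems])
  also have "\<dots> \<le> B ^ n * c * (B * u w)" using B c growth[OF Suc.prems] by (intro mult_left_mono) auto
  finally show ?case by (simp add: ac_simps)
qed (simp add: f)

text \<open>One step of either operator is exchanged at a time, as in a telescoping sum.\<close>

lemma funpow_lipschitz:
  assumes T1: "markov_op S u T1" and T2: "markov_op S u T2"
    and growth1: "\<And>w. w \<in> space S \<Longrightarrow> T1 u w \<le> B * u w"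
    and growth2: "\<And>w. w \<in> space S \<Longrightarrow> T2 u w \<le> B * u w" and B: "1 \<le> B"
    and close: "\<And>g c w. g \<in> dominated S u \<Longrightarrow> (\<And>y. y \<in> space S \<Longrightarrow> \<bar>g y\<bar> \<le> c * u y) \<Longrightarrow> w \<in> space S \<Longrightarrow>
      \<bar>T1 g w - T2 g w\<bar> \<le> \<eta> * c * u w"
    and \<eta>: "0 \<le> \<eta>" and f: "f \<in> dominated S u" "\<And>y. y \<in> space S \<Longrightarrow> \<bar>f y\<bar> \<le> c * u y" and c: "0 \<le> c"
    and w: "w \<in> space S"
  shows "\<bar>(T1 ^^ n) f w - (T2 ^^ n) f w\<bar> \<le> \<eta> * (real n * B ^ n) * c * u w"
  using w
proof (induction n arbitrary: w)
  case (Suc n)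
  interpret T1: markov_op S u T1 by (rule T1)
  interpret T2: markov_op S u T2 by (rule T2)
  have u: "0 \<le> u w" using T1.V_ge_1[OF Suc.prems] by simp
  have dom: "(T1 ^^ n) f \<in> dominated S u" "(T2 ^^ n) f \<in> dominated S u"
    by (rule markov_op.closed[OF T1.iter f(1)], rule markov_op.closed[OF T2.iter f(1)])
  have "\<bar>T1 (\<lambda>y. (T1 ^^ n) f y - (T2 ^^ n) f y) w\<bar> \<le> \<eta> * (real n * B ^ n) * c * T1 u w"
    by (rule T1.abs_le_scale[OF dominated_diff[OF dom] T1.V_dominated Suc.IH Suc.prems])
  also have "\<dots> \<le> \<eta> * (real n * B ^ n) * c * (B * u w)"
    using \<eta> B c growth1[OF Suc.prems] by (intro mult_left_mono) auto
  finally have "\<bar>T1 ((T1 ^^ n) f) w - T1 ((T2 ^^ n) f) w\<bar> \<le> \<eta> * (real n * B ^ n) * c * (B * u w)"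
    by (simp add: T1.diff[OF dom Suc.prems])
  moreover have "\<bar>T1 ((T2 ^^ n) f) w - T2 ((T2 ^^ n) f) w\<bar> \<le> \<eta> * (B ^ n * c) * u w"
    by (rule close[OF dom(2) funpow_abs_le[OF T2 growth2 _ f c] Suc.prems]) (use B in auto)
  moreover have "\<eta> * (B ^ n * c) * u w \<le> \<eta> * (B ^ Suc n * c) * u w"
    using \<eta> B c u by (intro mult_right_mono mult_left_mono power_increasing) auto
  ultimately have "\<bar>(T1 ^^ Suc n) f w - (T2 ^^ Suc n) f w\<bar>
      \<le> \<eta> * (real n * B ^ n) * c * (B * u w) + \<eta> * (B ^ Suc n * c) * u w"
    unfolding funpow.simps comp_apply by linarith
  also have "\<dots> = \<eta> * (real (Suc n) * B ^ Suc n) * c * u w" by (simp add: algebra_simps)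
  finally show ?case .
qed simp

text \<open>The polynomial \<open>A\<close> in \<open>T\<close> with \<open>A - T A = I - K\<close>, where \<open>K\<close> is the average of the powers of \<open>T\<close> up to
  \<open>m\<close>. Applied to a solution of the Poisson equation for \<open>K\<close> it gives one for \<open>T\<close>.\<close>

definition cesaro_resolvent :: "nat \<Rightarrow> (('b \<Rightarrow> real) \<Rightarrow> 'b \<Rightarrow> real) \<Rightarrow> ('b \<Rightarrow> real) \<Rightarrow> 'b \<Rightarrow> real" where
  "cesaro_resolvent m T f w = (\<Sum>j\<le>m. \<Sum>i<j. (T ^^ i) f w) / real (Suc m)"

lemma (in markov_op) cesaro_resolvent_equation:
  assumes f: "f \<in> dominated S V" and w: "w \<in> space S"
  shows "cesaro_resolvent m T f w - T (cesaro_resolvent m T f) w = f w - op_average m (\<lambda>j. T ^^ j) f w"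
proof -
  have dom: "(T ^^ i) f \<in> dominated S V" for i by (rule markov_op.closed[OF iter f])
  have sums: "(\<lambda>w. \<Sum>i<j. (T ^^ i) f w) \<in> dominated S V" for j
    by (intro dominated_sum dom) auto
  have "T (cesaro_resolvent m T f) w = 1 / real (Suc m) * T (\<lambda>w. \<Sum>j\<le>m. \<Sum>i<j. (T ^^ i) f w) w"
    using scale[OF dominated_sum[OF finite_atMost[of m] sums] w, of "1 / real (Suc m)"]
    by (simp add: cesaro_resolvent_def[abs_def])
  also have "\<dots> = (\<Sum>j\<le>m. \<Sum>i<j. (T ^^ Suc i) f w) / real (Suc m)"
    using w by (simp add: sum sums dom)
  finally have "cesaro_resolvent m T f w - T (cesaro_resolvent m T f) w
      = (\<Sum>j\<le>m. (\<Sum>i<j. (T ^^ i) f w) - (\<Sum>i<j. (T ^^ Suc i) f w)) / real (Suc m)"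
    by (simp add: cesaro_resolvent_def sum_subtractf diff_divide_distrib)
  also have "(\<Sum>i<j. (T ^^ i) f w) - (\<Sum>i<j. (T ^^ Suc i) f w) = f w - (T ^^ j) f w" for j
    by (induction j) auto
  then have "(\<Sum>j\<le>m. (\<Sum>i<j. (T ^^ i) f w) - (\<Sum>i<j. (T ^^ Suc i) f w))
      = real (Suc m) * f w - (\<Sum>j\<le>m. (T ^^ j) f w)"
    by (simp add: sum_subtractf)
  finally show ?thesis by (simp add: op_average_def diff_divide_distrib)
qed

lemma cesaro_sum_le:
  fixes a :: "nat \<Rightarrow> real"
  assumes a: "\<And>i. i \<le> m \<Longrightarrow> \<bar>a i\<bar> \<le> x" and x: "0 \<le> x"
  shows "\<bar>(\<Sum>j\<le>m. \<Sum>i<j. a i) / real (Suc m)\<bar> \<le> real m * x"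
proof -
  have "\<bar>\<Sum>j\<le>m. \<Sum>i<j. a i\<bar> \<le> (\<Sum>j\<le>m. \<bar>\<Sum>i<j. a i\<bar>)" by (rule sum_abs)
  also have "\<dots> \<le> (\<Sum>j\<le>m. real m * x)"
  proof (rule sum_mono)
    fix j assume "j \<in> {..m}"
    then have j: "j \<le> m" by simp
    have "\<bar>\<Sum>i<j. a i\<bar> \<le> (\<Sum>i<j. \<bar>a i\<bar>)" by (rule sum_abs)
    also have "\<dots> \<le> (\<Sum>i<j. x)" by (intro sum_mono a) (use j in auto)
    also have "\<dots> = real j * x" by simp
    also have "\<dots> \<le> real m * x" using j x by (intro mult_right_mono) auto
    finally show "\<bar>\<Sum>i<j. a i\<bar> \<le> real m * x" .
  qed
  also have "\<dots> = real (Suc m) * (real m * x)" by simp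
  finally have "\<bar>\<Sum>j\<le>m. \<Sum>i<j. a i\<bar> / real (Suc m) \<le> real m * x"
    by (simp add: pos_divide_le_eq mult.commute)
  then show ?thesis by (simp add: abs_divide)
qed

text \<open>The integrand depends on the parameter as well. It is integrated against the law of the pair
  \<open>(x, y)\<close>, which is again a kernel in \<open>x\<close>.\<close>

lemma kernel_op_measurable2:
  assumes Q[measurable]: "(\<lambda>(\<theta>, w). Q \<theta> w) \<in> T \<Otimes>\<^sub>M S \<rightarrow>\<^sub>M prob_algebra S"
    and g[measurable]: "(\<lambda>(\<theta>, w). g \<theta> w) \<in> borel_measurable (T \<Otimes>\<^sub>M S)"
  shows "(\<lambda>(\<theta>, w). kernel_op (Q \<theta>) (g \<theta>) w :: real) \<in> borel_measurable (T \<Otimes>\<^sub>M S)"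
proof -
  let ?X = "T \<Otimes>\<^sub>M S"
  have L: "(\<lambda>x. Q (fst x) (snd x)) \<in> ?X \<rightarrow>\<^sub>M subprob_algebra S"
    using measurable_prob_algebraD[OF Q] by (simp add: case_prod_beta')
  have f: "(\<lambda>(x, y). g (fst x) y) \<in> borel_measurable (?X \<Otimes>\<^sub>M S)"
    by measurable
  have eq: "kernel_op (Q (fst x)) (g (fst x)) (snd x)
      = (\<integral>z. (\<lambda>(x, y). g (fst x) y) z \<partial>distr (Q (fst x) (snd x)) (?X \<Otimes>\<^sub>M S) (\<lambda>y. (x, y)))"
    if "x \<in> space ?X" for x
  proof -
    have sets: "sets (Q (fst x) (snd x)) = sets S"
      using measurable_space[OF L that] by (simp add: space_subprob_algebra)
    show ?thesis
      unfolding kernel_op_def using that f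
      by (subst integral_distr) (auto simp: measurable_cong_sets[OF sets refl])
  qed
  have "(\<lambda>x. distr (Q (fst x) (snd x)) (?X \<Otimes>\<^sub>M S) (\<lambda>y. (x, y))) \<in> ?X \<rightarrow>\<^sub>M subprob_algebra (?X \<Otimes>\<^sub>M S)"
    by (rule measurable_distr2[OF _ L]) simp
  then have "(\<lambda>x. \<integral>z. (\<lambda>(x, y). g (fst x) y) z \<partial>distr (Q (fst x) (snd x)) (?X \<Otimes>\<^sub>M S) (\<lambda>y. (x, y)))
      \<in> borel_measurable ?X"
    by (rule measurable_compose[OF _ integral_measurable_subprob_algebra[OF f]])
  then have "(\<lambda>x. kernel_op (Q (fst x)) (g (fst x)) (snd x)) \<in> borel_measurable ?X"
    by (subst measurable_cong[OF eq])
  then show ?thesis by (simp add: case_prod_beta')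
qed

lemma funpow_kernel_op_measurable2:
  assumes Q: "(\<lambda>(\<theta>, w). Q \<theta> w) \<in> T \<Otimes>\<^sub>M S \<rightarrow>\<^sub>M prob_algebra S"
    and g: "(\<lambda>(\<theta>, w). g \<theta> w) \<in> borel_measurable (T \<Otimes>\<^sub>M S)"
  shows "(\<lambda>(\<theta>, w). (kernel_op (Q \<theta>) ^^ n) (g \<theta>) w :: real) \<in> borel_measurable (T \<Otimes>\<^sub>M S)"
  by (induction n) (use g kernel_op_measurable2[OF Q] in simp_all)

lemma average_kernel_op_measurable2:
  assumes Q: "(\<lambda>(\<theta>, w). Q \<theta> w) \<in> T \<Otimes>\<^sub>M S \<rightarrow>\<^sub>M prob_algebra S"
    and g: "(\<lambda>(\<theta>, w). g \<theta> w) \<in> borel_measurable (T \<Otimes>\<^sub>M S)"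
  shows "(\<lambda>(\<theta>, w). (op_average m (\<lambda>j. kernel_op (Q \<theta>) ^^ j) ^^ n) (g \<theta>) w :: real) \<in> borel_measurable (T \<Otimes>\<^sub>M S)"
proof (induction n)
  case (Suc n)
  define k where "k \<theta> = (op_average m (\<lambda>j. kernel_op (Q \<theta>) ^^ j) ^^ n) (g \<theta>)" for \<theta>
  have [measurable]: "(\<lambda>x. (kernel_op (Q (fst x)) ^^ j) (k (fst x)) (snd x)) \<in> borel_measurable (T \<Otimes>\<^sub>M S)" for j
    using funpow_kernel_op_measurable2[OF Q, of k j] Suc by (simp add: case_prod_beta' k_def)
  have "(\<lambda>x. op_average m (\<lambda>j. kernel_op (Q (fst x)) ^^ j) (k (fst x)) (snd x)) \<in> borel_measurable (T \<Otimes>\<^sub>M S)"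
    unfolding op_average_def by measurable
  then show ?case by (simp add: case_prod_beta' k_def)
qed (use g in simp)

section \<open>A Poisson solution that is Lipschitz in the parameter\<close>

lemma measurable_section:
  assumes "(\<lambda>(\<theta>, w). f \<theta> w) \<in> T \<Otimes>\<^sub>M S \<rightarrow>\<^sub>M N" "\<theta> \<in> space T"
  shows "f \<theta> \<in> S \<rightarrow>\<^sub>M N"
  using measurable_compose[OF measurable_Pair1'[OF assms(2)] assms(1)] by simp

text \<open>Solve the Poisson equation for the averaged kernel, where the contraction is available, and pass to
  the kernel itself by \<open>cesaro_resolvent\<close>. Each of the two passages preserves the linear growth in
  the weight and the Lipschitz dependence on \<open>\<theta>\<close>.\<close>

theorem uniform_poisson:
  fixes Q :: "'a::real_normed_vector \<Rightarrow> 'b \<Rightarrow> 'b measure" and T :: "'a measure" and S :: "'b measure"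
    and h :: "'a \<Rightarrow> 'b \<Rightarrow> real"
  assumes Q: "(\<lambda>(\<theta>, w). Q \<theta> w) \<in> T \<Otimes>\<^sub>M S \<rightarrow>\<^sub>M prob_algebra S" and T: "space T \<noteq> {}"
    and V: "V \<in> borel_measurable S" "\<And>w. w \<in> space S \<Longrightarrow> 1 \<le> V w"
    and int: "\<And>\<theta> w. \<theta> \<in> space T \<Longrightarrow> w \<in> space S \<Longrightarrow> integrable (Q \<theta> w) V"
    and drift: "\<And>\<theta> w. \<theta> \<in> space T \<Longrightarrow> w \<in> space S \<Longrightarrow>
      (\<integral>y. V y \<partial>Q \<theta> w) \<le> \<rho> * V w + b * indicator A w"
    and params: "0 \<le> \<rho>" "\<rho> < 1" "0 < b" "0 < \<epsilon>" "0 \<le> L" "0 \<le> H"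
    and A: "A \<in> sets S" "A \<noteq> {}" and \<phi>: "\<phi> \<in> space (prob_algebra S)"
    and minor: "\<And>\<theta> w E. \<theta> \<in> space T \<Longrightarrow> w \<in> A \<Longrightarrow> E \<in> sets S \<Longrightarrow>
      \<epsilon> * measure \<phi> E \<le> measure (kernel_power S (Q \<theta>) N w) E"
    and lip: "\<And>\<theta> \<theta>' f c w. \<theta> \<in> space T \<Longrightarrow> \<theta>' \<in> space T \<Longrightarrow> f \<in> dominated S V \<Longrightarrow>
      (\<And>y. y \<in> space S \<Longrightarrow> \<bar>f y\<bar> \<le> c * V y) \<Longrightarrow> w \<in> space S \<Longrightarrow>
      \<bar>kernel_op (Q \<theta>) f w - kernel_op (Q \<theta>') f w\<bar> \<le> L * c * V w * norm (\<theta> - \<theta>')"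
    and h: "(\<lambda>(\<theta>, w). h \<theta> w) \<in> borel_measurable (T \<Otimes>\<^sub>M S)"
    and h_le: "\<And>\<theta> w. \<theta> \<in> space T \<Longrightarrow> w \<in> space S \<Longrightarrow> \<bar>h \<theta> w\<bar> \<le> H * V w"
    and h_lip: "\<And>\<theta> \<theta>' w. \<theta> \<in> space T \<Longrightarrow> \<theta>' \<in> space T \<Longrightarrow> w \<in> space S \<Longrightarrow>
      \<bar>h \<theta> w - h \<theta>' w\<bar> \<le> H * V w * norm (\<theta> - \<theta>')"
  obtains G :: "'a \<Rightarrow> 'b \<Rightarrow> real" and C where "0 \<le> C"
    "(\<lambda>(\<theta>, w). G \<theta> w) \<in> borel_measurable (T \<Otimes>\<^sub>M S)"
    "\<And>\<theta> w. \<theta> \<in> space T \<Longrightarrow> w \<in> space S \<Longrightarrow> \<bar>G \<theta> w\<bar> \<le> C * V w"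
    "\<And>\<theta> \<theta>' w. \<theta> \<in> space T \<Longrightarrow> \<theta>' \<in> space T \<Longrightarrow> w \<in> space S \<Longrightarrow>
      \<bar>G \<theta> w - G \<theta>' w\<bar> \<le> C * V w * norm (\<theta> - \<theta>')"
    "\<And>\<theta> w. \<theta> \<in> space T \<Longrightarrow> w \<in> space S \<Longrightarrow>
      G \<theta> w - (\<integral>y. G \<theta> y \<partial>Q \<theta> w) = h \<theta> w - (\<integral>y. h \<theta> y \<partial>the_stationary S (Q \<theta>))"
    "\<And>\<theta>. \<theta> \<in> space T \<Longrightarrow> sets (the_stationary S (Q \<theta>)) = sets S"
    "\<And>\<theta>. \<theta> \<in> space T \<Longrightarrow> integrable (the_stationary S (Q \<theta>)) V"
proof -
  have Q\<theta>: "Q \<theta> \<in> S \<rightarrow>\<^sub>M prob_algebra S" if "\<theta> \<in> space T" for \<theta>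
    by (rule measurable_section[OF Q that])
  have indA: "indicator A w \<le> (1 :: real)" for w by (simp add: indicator_def)
  have V_growth: "(\<integral>y. V y \<partial>Q \<theta> w) \<le> (\<rho> + b) * V w" if "\<theta> \<in> space T" "w \<in> space S" for \<theta> w
  proof -
    have "b * indicator A w \<le> b * V w"
      using order_trans[OF indA V(2)[OF that(2)]] params by (intro mult_left_mono) auto
    then show ?thesis using drift[OF that] by (simp add: distrib_right)
  qed
  have P: "markov_op S V (kernel_op (Q \<theta>))" if "\<theta> \<in> space T" for \<theta>
    by (rule markov_op_kernel_op[OF Q\<theta>[OF that] V]) (use int V_growth that in auto)
  have A_sub: "w \<in> space S" if "w \<in> A" for w using A that sets.sets_into_space by blast
  obtain \<theta>\<^sub>0 where \<theta>\<^sub>0: "\<theta>\<^sub>0 \<in> space T" using T by blast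
  obtain w\<^sub>0 where w\<^sub>0: "w\<^sub>0 \<in> A" "w\<^sub>0 \<in> space S" using A A_sub by blast
  have \<phi>': "sets \<phi> = sets S" "prob_space \<phi>" using \<phi> by (auto simp: space_prob_algebra)
  interpret P0: markov_op S V "kernel_op (Q \<theta>\<^sub>0)" by (rule P[OF \<theta>\<^sub>0])
  interpret \<phi>: prob_space \<phi> by (rule \<phi>')
  have minor_nn: "ennreal \<epsilon> * (\<integral>\<^sup>+y. ennreal (f y) \<partial>\<phi>) \<le> ennreal ((kernel_op (Q \<theta>) ^^ N) f w)"
    if "\<theta> \<in> space T" "w \<in> A" "f \<in> dominated S V" "\<And>y. y \<in> space S \<Longrightarrow> 0 \<le> f y" for \<theta> w f
    by (rule kernel_power_minorization[OF Q\<theta>[OF that(1)] P[OF that(1)] int[OF that(1)] \<phi> params(4)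
          A_sub[OF that(2)] minor[OF that(1,2)] that(3,4)])
  have \<phi>V: "integrable \<phi> V"
  proof (rule integrableI_bounded)
    show "V \<in> borel_measurable \<phi>" using V \<phi>' by (simp cong: measurable_cong_sets)
    have "(\<integral>\<^sup>+y. ennreal (norm (V y)) \<partial>\<phi>) = (\<integral>\<^sup>+y. ennreal (V y) \<partial>\<phi>)"
      by (rule nn_integral_cong) (use V(2) \<phi>' in \<open>fastforce dest: sets_eq_imp_space_eq\<close>)
    moreover have "ennreal \<epsilon> * (\<integral>\<^sup>+y. ennreal (V y) \<partial>\<phi>) < \<infinity>"
      by (rule le_less_trans[OF minor_nn[OF \<theta>\<^sub>0 w\<^sub>0(1) P0.V_dominated]]) (use V(2) in force)+
    ultimately show "(\<integral>\<^sup>+y. ennreal (norm (V y)) \<partial>\<phi>) < \<infinity>"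
      using params by (auto simp: ennreal_mult_less_top ennreal_zero_less_one)
  qed
  have \<Phi>: "markov_op S V (\<lambda>f _. \<integral>y. f y \<partial>\<phi>)"
  proof -
    have "markov_op S V (kernel_op (\<lambda>_. \<phi>))"
    proof (rule markov_op_kernel_op[OF _ V \<phi>V, where B = "\<integral>y. V y \<partial>\<phi>"])
      show "(\<lambda>_. \<phi>) \<in> S \<rightarrow>\<^sub>M prob_algebra S" by (rule measurable_const[OF \<phi>])
      have "0 \<le> (\<integral>y. V y \<partial>\<phi>)"
        by (rule Bochner_Integration.integral_nonneg) (use V(2) \<phi>' in \<open>force dest: sets_eq_imp_space_eq\<close>)
      then show "(\<integral>y. V y \<partial>\<phi>) \<le> (\<integral>y. V y \<partial>\<phi>) * V w" if "w \<in> space S" for w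
        using V(2)[OF that] by (simp add: mult_le_cancel_left1)
    qed
    then show ?thesis by (simp add: kernel_op_def[abs_def])
  qed
  have minor': "\<epsilon> * (\<integral>y. f y \<partial>\<phi>) \<le> (kernel_op (Q \<theta>) ^^ N) f w"
    if "\<theta> \<in> space T" "f \<in> dominated S V" "\<And>y. y \<in> space S \<Longrightarrow> 0 \<le> f y" "w \<in> A" for \<theta> f w
  proof -
    have "ennreal \<epsilon> * (\<integral>\<^sup>+y. ennreal (f y) \<partial>\<phi>) = ennreal (\<epsilon> * (\<integral>y. f y \<partial>\<phi>))"
      using params that(3) \<phi>'
      by (subst nn_integral_eq_integral[OF integrable_dominated[OF \<phi>'(1) \<phi>V that(2)]])
         (auto intro!: AE_I2 simp: ennreal_mult' dest: sets_eq_imp_space_eq)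
    moreover have "0 \<le> (kernel_op (Q \<theta>) ^^ N) f w"
      by (rule markov_op.nonneg[OF markov_op_funpow[OF P[OF that(1)]] that(2,3) A_sub[OF that(4)]])
    ultimately show ?thesis using minor_nn[OF that(1,4,2,3)] by (simp add: ennreal_le_iff)
  qed
  obtain \<beta> q B m where \<beta>: "0 < \<beta>"
    and K: "\<And>\<theta>. \<theta> \<in> space T \<Longrightarrow>
      contracting_op S (harris_weight \<beta> V) (op_average m (\<lambda>j. kernel_op (Q \<theta>) ^^ j)) w\<^sub>0 q B"
    by (rule uniform_contraction[where T = "\<lambda>\<theta>. kernel_op (Q \<theta>)" and \<Theta> = "space T" and N = N,
          OF P \<Phi> params(1-4) A(1) w\<^sub>0(2) _ minor'])
       (use drift in \<open>auto simp: kernel_op_def\<close>)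
  define u where "u = harris_weight \<beta> V"
  have dom: "dominated S u = dominated S V"
    unfolding u_def by (rule dominated_harris_weight[OF _ \<beta>]) (rule V(2))
  have Pu: "markov_op S u (kernel_op (Q \<theta>))" if "\<theta> \<in> space T" for \<theta>
    unfolding u_def by (rule markov_op_harris_weight[OF P[OF that] \<beta>])
  note K = K[folded u_def]
  interpret C0: contracting_op S u "op_average m (\<lambda>j. kernel_op (Q \<theta>\<^sub>0) ^^ j)" w\<^sub>0 q B by (rule K[OF \<theta>\<^sub>0])
  have q: "0 < q" "q < 1" by (fact C0.q)+
  have u1: "1 \<le> u w" if "w \<in> space S" for w by (rule C0.V_ge_1[OF that])
  have u_le: "u w \<le> (1 + \<beta>) * V w" if "w \<in> space S" for w
    using V(2)[OF that] by (simp add: u_def harris_weight_def algebra_simps)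
  have V_le: "V w \<le> u w / \<beta>" for w using \<beta> by (simp add: u_def harris_weight_def field_simps)
  \<comment> \<open>A growth factor of one step of any kernel in the weight u, enlarged so that its powers increase.\<close>
  define B1 where "B1 = 1 + \<rho> + b"
  have B1: "1 \<le> B1" using params by (simp add: B1_def)
  have growth: "kernel_op (Q \<theta>) u w \<le> B1 * u w" if \<theta>: "\<theta> \<in> space T" and w: "w \<in> space S" for \<theta> w
  proof -
    interpret P: markov_op S V "kernel_op (Q \<theta>)" by (rule P[OF \<theta>])
    have "kernel_op (Q \<theta>) u w = 1 + \<beta> * kernel_op (Q \<theta>) V w"
      unfolding u_def harris_weight_def[abs_def] using w
      by (simp add: P.add P.scale P.const P.const_dominated P.V_dominated dominated_scale)
    also have "\<dots> \<le> 1 + \<beta> * ((\<rho> + b) * V w)"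
      using V_growth[OF \<theta> w] \<beta> by (simp add: kernel_op_def)
    also have "\<dots> \<le> B1 * u w"
    proof -
      have "0 \<le> \<rho> + b + \<beta> * V w" using params \<beta> V(2)[OF w] by (intro add_nonneg_nonneg) auto
      then show ?thesis by (simp add: B1_def u_def harris_weight_def algebra_simps)
    qed
    finally show ?thesis .
  qed
  define d where "d \<theta> \<theta>' = norm (\<theta> - \<theta>')" for \<theta> \<theta>' :: 'a
  \<comment> \<open>\<eta>1 and \<eta>K are Lipschitz constants of the kernel and of its average; cp and cl are the growth and Lipschitz constants of the solution p for the average.\<close>
  define \<eta>1 where "\<eta>1 = L * (1 + \<beta>) / \<beta>"
  have \<eta>1: "0 \<le> \<eta>1" using params \<beta> by (simp add: \<eta>1_def)
  have c_nonneg: "0 \<le> c" if "\<And>y. y \<in> space S \<Longrightarrow> \<bar>g y\<bar> \<le> c * u y" for g :: "'b \<Rightarrow> real" and c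
    using that[OF w\<^sub>0(2)] u1[OF w\<^sub>0(2)] abs_ge_zero[of "g w\<^sub>0"]
    by (smt (verit) mult_neg_pos)
  have lip_u: "\<bar>kernel_op (Q \<theta>) g w - kernel_op (Q \<theta>') g w\<bar> \<le> (\<eta>1 * d \<theta> \<theta>') * c * u w"
    if \<theta>: "\<theta> \<in> space T" "\<theta>' \<in> space T" and g: "g \<in> dominated S u"
      and le: "\<And>y. y \<in> space S \<Longrightarrow> \<bar>g y\<bar> \<le> c * u y" and w: "w \<in> space S" for \<theta> \<theta>' g c w
  proof -
    have c: "0 \<le> c" using le by (rule c_nonneg)
    have le': "\<bar>g y\<bar> \<le> (c * (1 + \<beta>)) * V y" if "y \<in> space S" for y
      using le[OF that] mult_left_mono[OF u_le[OF that] c] by (simp add: mult.assoc)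
    have "\<bar>kernel_op (Q \<theta>) g w - kernel_op (Q \<theta>') g w\<bar> \<le> L * (c * (1 + \<beta>)) * V w * norm (\<theta> - \<theta>')"
      by (rule lip[OF \<theta> _ le' w]) (use g dom in auto)
    also have "\<dots> \<le> L * (c * (1 + \<beta>)) * (u w / \<beta>) * norm (\<theta> - \<theta>')"
      using params c \<beta> V_le by (intro mult_right_mono mult_left_mono) auto
    also have "\<dots> = (\<eta>1 * d \<theta> \<theta>') * c * u w" by (simp add: \<eta>1_def d_def)
    finally show ?thesis .
  qed
  define M where "M = B1 ^ m"
  have M: "B1 ^ i \<le> M" if "i \<le> m" for i using B1 that by (simp add: M_def power_increasing)
  have M1: "1 \<le> M" using M[of 0] by simp
  have pow_lip: "\<bar>(kernel_op (Q \<theta>) ^^ i) g w - (kernel_op (Q \<theta>') ^^ i) g w\<bar> \<le> (\<eta>1 * d \<theta> \<theta>') * (real m * M) * c * u w"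
    if \<theta>: "\<theta> \<in> space T" "\<theta>' \<in> space T" and g: "g \<in> dominated S u"
      and le: "\<And>y. y \<in> space S \<Longrightarrow> \<bar>g y\<bar> \<le> c * u y" and w: "w \<in> space S" and i: "i \<le> m" for \<theta> \<theta>' g c w i
  proof -
    have c: "0 \<le> c" using le by (rule c_nonneg)
    have "\<bar>(kernel_op (Q \<theta>) ^^ i) g w - (kernel_op (Q \<theta>') ^^ i) g w\<bar> \<le> (\<eta>1 * d \<theta> \<theta>') * (real i * B1 ^ i) * c * u w"
      by (rule funpow_lipschitz[OF Pu[OF \<theta>(1)] Pu[OF \<theta>(2)] growth[OF \<theta>(1)] growth[OF \<theta>(2)] B1
            lip_u[OF \<theta>] _ g le c w]) (use \<eta>1 in \<open>auto simp: d_def\<close>)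
    also have "\<dots> \<le> (\<eta>1 * d \<theta> \<theta>') * (real m * M) * c * u w"
      using \<eta>1 c u1[OF w] i M[OF i] B1
      by (intro mult_right_mono mult_left_mono mult_mono) (auto simp: d_def)
    finally show ?thesis .
  qed
  define \<eta>K where "\<eta>K = \<eta>1 * (real m * M)"
  have \<eta>K: "0 \<le> \<eta>K" using \<eta>1 M1 by (simp add: \<eta>K_def)
  have K_lip: "\<bar>op_average m (\<lambda>j. kernel_op (Q \<theta>) ^^ j) g w - op_average m (\<lambda>j. kernel_op (Q \<theta>') ^^ j) g w\<bar>
      \<le> (\<eta>K * d \<theta> \<theta>') * c * u w"
    if \<theta>: "\<theta> \<in> space T" "\<theta>' \<in> space T" and g: "g \<in> dominated S u"
      and le: "\<And>y. y \<in> space S \<Longrightarrow> \<bar>g y\<bar> \<le> c * u y" and w: "w \<in> space S" for \<theta> \<theta>' g c w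
  proof -
    have "\<bar>\<Sum>j\<le>m. (kernel_op (Q \<theta>) ^^ j) g w - (kernel_op (Q \<theta>') ^^ j) g w\<bar>
        \<le> (\<Sum>j\<le>m. (\<eta>1 * d \<theta> \<theta>') * (real m * M) * c * u w)"
      by (rule order_trans[OF sum_abs sum_mono]) (use pow_lip[OF \<theta> g le w] in auto)
    also have "\<dots> = real (Suc m) * ((\<eta>K * d \<theta> \<theta>') * c * u w)" by (simp add: \<eta>K_def)
    finally have *: "\<bar>\<Sum>j\<le>m. (kernel_op (Q \<theta>) ^^ j) g w - (kernel_op (Q \<theta>') ^^ j) g w\<bar> / real (Suc m)
        \<le> (\<eta>K * d \<theta> \<theta>') * c * u w"
      by (simp add: pos_divide_le_eq mult.commute)
    have "op_average m (\<lambda>j. kernel_op (Q \<theta>) ^^ j) g w - op_average m (\<lambda>j. kernel_op (Q \<theta>') ^^ j) g w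
        = (\<Sum>j\<le>m. (kernel_op (Q \<theta>) ^^ j) g w - (kernel_op (Q \<theta>') ^^ j) g w) / real (Suc m)"
      by (simp add: op_average_def sum_subtractf diff_divide_distrib)
    then show ?thesis using * by (simp only: abs_divide abs_of_nat)
  qed
  define H' where "H' = H / \<beta>"
  have H': "0 \<le> H'" using params \<beta> by (simp add: H'_def)
  have hu_le: "\<bar>h \<theta> w\<bar> \<le> H' * u w" if "\<theta> \<in> space T" "w \<in> space S" for \<theta> w
    using h_le[OF that] mult_left_mono[OF V_le[of w] params(6)] by (simp add: H'_def)
  have hu_lip: "\<bar>h \<theta> w - h \<theta>' w\<bar> \<le> (H' * d \<theta> \<theta>') * u w"
    if "\<theta> \<in> space T" "\<theta>' \<in> space T" "w \<in> space S" for \<theta> \<theta>' w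
  proof -
    have "H * V w * norm (\<theta> - \<theta>') \<le> H * (u w / \<beta>) * norm (\<theta> - \<theta>')"
      using V_le[of w] params by (intro mult_right_mono mult_left_mono) auto
    then show ?thesis using h_lip[OF that] by (simp add: H'_def d_def mult_ac)
  qed
  have h_dom: "h \<theta> \<in> dominated S u" if "\<theta> \<in> space T" for \<theta>
    by (rule dominatedI[where c = H']) (use measurable_section[OF h that] hu_le[OF that] in auto)
  have h_osc: "osc_le S u H' (h \<theta>)" if "\<theta> \<in> space T" for \<theta>
    using hu_le[OF that] by (rule osc_le_of_abs_le)
  define p where "p \<theta> = contracting_op.poisson (op_average m (\<lambda>j. kernel_op (Q \<theta>) ^^ j)) w\<^sub>0 (h \<theta>)" for \<theta>
  have absorb: "x * (u w + u w\<^sub>0) \<le> x * (1 + u w\<^sub>0) * u w" if "0 \<le> x" "w \<in> space S" for x w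
  proof -
    have "u w\<^sub>0 * 1 \<le> u w\<^sub>0 * u w" using u1[OF that(2)] u1[OF w\<^sub>0(2)] by (intro mult_left_mono) auto
    then have "u w + u w\<^sub>0 \<le> (1 + u w\<^sub>0) * u w" by (simp add: algebra_simps)
    from mult_left_mono[OF this that(1)] show ?thesis by (simp add: mult.assoc)
  qed
  define cp where "cp = H' / (1 - q) * (1 + u w\<^sub>0)"
  have cp: "0 \<le> cp" using H' q u1[OF w\<^sub>0(2)] by (simp add: cp_def)
  have p_dom: "p \<theta> \<in> dominated S u" if "\<theta> \<in> space T" for \<theta>
    unfolding p_def by (rule contracting_op.poisson_dominated[OF K[OF that] h_dom[OF that] h_osc[OF that]])
  have p_le: "\<bar>p \<theta> w\<bar> \<le> cp * u w" if "\<theta> \<in> space T" "w \<in> space S" for \<theta> w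
    using contracting_op.poisson_le[OF K[OF that(1)] h_dom[OF that(1)] h_osc[OF that(1)] that(2)]
      absorb[of "H' / (1 - q)" w] H' q that(2)
    by (simp add: p_def cp_def)
  define cl where "cl = (H' / (1 - q) + \<eta>K * H' / (q * (1 - q)\<^sup>2)) * (1 + u w\<^sub>0)"
  have cl0: "0 \<le> H' / (1 - q) + \<eta>K * H' / (q * (1 - q)\<^sup>2)" using H' \<eta>K q by simp
  have cl: "0 \<le> cl" unfolding cl_def using cl0 u1[OF w\<^sub>0(2)] by (intro mult_nonneg_nonneg) auto
  have p_lip: "\<bar>p \<theta> w - p \<theta>' w\<bar> \<le> (cl * d \<theta> \<theta>') * u w"
    if \<theta>: "\<theta> \<in> space T" "\<theta>' \<in> space T" and w: "w \<in> space S" for \<theta> \<theta>' w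
  proof -
    have "\<bar>p \<theta> w - p \<theta>' w\<bar>
        \<le> ((H' * d \<theta> \<theta>') / (1 - q) + (\<eta>K * d \<theta> \<theta>') * H' / (q * (1 - q)\<^sup>2)) * (u w + u w\<^sub>0)"
      unfolding p_def
      by (rule poisson_lipschitz[OF K[OF \<theta>(1)] K[OF \<theta>(2)] K_lip[OF \<theta>] h_dom[OF \<theta>(1)] h_dom[OF \<theta>(2)]
            h_osc[OF \<theta>(2)] osc_le_of_abs_le[OF hu_lip[OF \<theta>]] w])
    also have "\<dots> = d \<theta> \<theta>' * (H' / (1 - q) + \<eta>K * H' / (q * (1 - q)\<^sup>2)) * (u w + u w\<^sub>0)"
      by (simp add: algebra_simps)
    also have "\<dots> \<le> d \<theta> \<theta>' * (H' / (1 - q) + \<eta>K * H' / (q * (1 - q)\<^sup>2)) * (1 + u w\<^sub>0) * u w"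
      using cl0 w by (intro absorb mult_nonneg_nonneg) (auto simp: d_def)
    also have "\<dots> = (cl * d \<theta> \<theta>') * u w" by (simp add: cl_def mult_ac)
    finally show ?thesis .
  qed
  define G where "G \<theta> = cesaro_resolvent m (kernel_op (Q \<theta>)) (p \<theta>)" for \<theta>
  have G_le: "\<bar>G \<theta> w\<bar> \<le> real m * (M * cp * u w)" if \<theta>: "\<theta> \<in> space T" and w: "w \<in> space S" for \<theta> w
    unfolding G_def cesaro_resolvent_def
  proof (rule cesaro_sum_le)
    fix i assume i: "i \<le> m"
    have "\<bar>(kernel_op (Q \<theta>) ^^ i) (p \<theta>) w\<bar> \<le> B1 ^ i * cp * u w"
      by (rule funpow_abs_le[OF Pu[OF \<theta>] growth[OF \<theta>] _ p_dom[OF \<theta>] p_le[OF \<theta>] cp w]) (use B1 in auto)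
    also have "\<dots> \<le> M * cp * u w" using M[OF i] cp u1[OF w] by (intro mult_right_mono) auto
    finally show "\<bar>(kernel_op (Q \<theta>) ^^ i) (p \<theta>) w\<bar> \<le> M * cp * u w" .
  qed (use M1 cp u1[OF w] in auto)
  have G_lip: "\<bar>G \<theta> w - G \<theta>' w\<bar> \<le> real m * ((M * cl + \<eta>K * cp) * d \<theta> \<theta>' * u w)"
    if \<theta>: "\<theta> \<in> space T" "\<theta>' \<in> space T" and w: "w \<in> space S" for \<theta> \<theta>' w
  proof -
    have d0: "0 \<le> d \<theta> \<theta>'" by (simp add: d_def)
    have eq: "G \<theta> w - G \<theta>' w
        = (\<Sum>j\<le>m. \<Sum>i<j. (kernel_op (Q \<theta>) ^^ i) (p \<theta>) w - (kernel_op (Q \<theta>') ^^ i) (p \<theta>') w) / real (Suc m)"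
      by (simp add: G_def cesaro_resolvent_def sum_subtractf diff_divide_distrib)
    show ?thesis unfolding eq
    proof (rule cesaro_sum_le)
      fix i assume i: "i \<le> m"
      interpret I: markov_op S u "kernel_op (Q \<theta>) ^^ i" by (rule markov_op_funpow[OF Pu[OF \<theta>(1)]])
      have "\<bar>(kernel_op (Q \<theta>) ^^ i) (\<lambda>y. p \<theta> y - p \<theta>' y) w\<bar> \<le> B1 ^ i * (cl * d \<theta> \<theta>') * u w"
        by (rule funpow_abs_le[OF Pu[OF \<theta>(1)] growth[OF \<theta>(1)] _ dominated_diff[OF p_dom[OF \<theta>(1)] p_dom[OF \<theta>(2)]]
              p_lip[OF \<theta>] _ w]) (use B1 cl d0 in auto)
      also have "\<dots> \<le> M * (cl * d \<theta> \<theta>') * u w"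
        using M[OF i] cl d0 u1[OF w] by (intro mult_right_mono) auto
      finally have "\<bar>(kernel_op (Q \<theta>) ^^ i) (p \<theta>) w - (kernel_op (Q \<theta>) ^^ i) (p \<theta>') w\<bar> \<le> M * (cl * d \<theta> \<theta>') * u w"
        using I.diff[OF p_dom[OF \<theta>(1)] p_dom[OF \<theta>(2)] w] by simp
      moreover have "\<bar>(kernel_op (Q \<theta>) ^^ i) (p \<theta>') w - (kernel_op (Q \<theta>') ^^ i) (p \<theta>') w\<bar>
          \<le> (\<eta>1 * d \<theta> \<theta>') * (real m * M) * cp * u w"
        by (rule pow_lip[OF \<theta> p_dom[OF \<theta>(2)] p_le[OF \<theta>(2)] w i])
      ultimately have "\<bar>(kernel_op (Q \<theta>) ^^ i) (p \<theta>) w - (kernel_op (Q \<theta>') ^^ i) (p \<theta>') w\<bar>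
          \<le> M * (cl * d \<theta> \<theta>') * u w + (\<eta>1 * d \<theta> \<theta>') * (real m * M) * cp * u w" by linarith
      then show "\<bar>(kernel_op (Q \<theta>) ^^ i) (p \<theta>) w - (kernel_op (Q \<theta>') ^^ i) (p \<theta>') w\<bar>
          \<le> (M * cl + \<eta>K * cp) * d \<theta> \<theta>' * u w"
        by (simp add: \<eta>K_def algebra_simps)
    qed (use M1 cl \<eta>K cp d0 u1[OF w] in auto)
  qed
  define C where "C = real m * (M * cp + M * cl + \<eta>K * cp) * (1 + \<beta>)"
  have C: "0 \<le> C" using M1 cp cl \<eta>K \<beta> by (simp add: C_def)
  show ?thesis
  proof (rule that[OF C])
    show "(\<lambda>(\<theta>, w). G \<theta> w) \<in> borel_measurable (T \<Otimes>\<^sub>M S)"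
    proof -
      let ?K = "\<lambda>\<theta> n. (op_average m (\<lambda>j. kernel_op (Q \<theta>) ^^ j) ^^ n) (h \<theta>)"
      have K2: "(\<lambda>x. ?K (fst x) n (snd x)) \<in> borel_measurable (T \<Otimes>\<^sub>M S)" for n
        using average_kernel_op_measurable2[OF Q h, where m = m and n = n] by (simp add: case_prod_beta')
      have K0: "(\<lambda>x. ?K (fst x) n w\<^sub>0) \<in> borel_measurable (T \<Otimes>\<^sub>M S)" for n
        using measurable_compose[OF _ K2, of "\<lambda>x. (fst x, w\<^sub>0)" "T \<Otimes>\<^sub>M S"] w\<^sub>0 by simp
      have "(\<lambda>x. \<Sum>n. ?K (fst x) n (snd x) - ?K (fst x) n w\<^sub>0) \<in> borel_measurable (T \<Otimes>\<^sub>M S)"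
        by (intro borel_measurable_suminf borel_measurable_diff K2 K0)
      also have "?this \<longleftrightarrow> (\<lambda>x. p (fst x) (snd x)) \<in> borel_measurable (T \<Otimes>\<^sub>M S)"
        by (rule measurable_cong)
           (auto simp: p_def contracting_op.poisson_def[OF K] space_pair_measure)
      finally have "(\<lambda>(\<theta>, w). p \<theta> w) \<in> borel_measurable (T \<Otimes>\<^sub>M S)" by (simp add: case_prod_beta')
      from funpow_kernel_op_measurable2[OF Q this]
      have "(\<lambda>x. (kernel_op (Q (fst x)) ^^ i) (p (fst x)) (snd x)) \<in> borel_measurable (T \<Otimes>\<^sub>M S)" for i
        by (simp add: case_prod_beta')
      then show ?thesis unfolding G_def cesaro_resolvent_def case_prod_beta' by measurable
    qed
    fix \<theta> assume \<theta>: "\<theta> \<in> space T"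
    interpret E: ergodic_kernel S "Q \<theta>" u m w\<^sub>0 q B
      by (rule ergodic_kernel.intro[OF Q\<theta>[OF \<theta>] Pu[OF \<theta>] _ K[OF \<theta>]])
         (use integrable_dominated[OF prob_kernelD(1)[OF Q\<theta>[OF \<theta>]] int[OF \<theta>]] C0.V_dominated dom in auto)
    show "sets (the_stationary S (Q \<theta>)) = sets S"
      by (simp add: E.the_stationary_eq E.sets_limit_measure)
    show "integrable (the_stationary S (Q \<theta>)) V"
      by (rule E.integral_the_stationary(1)) (simp add: dom P0.V_dominated)
    fix w assume w: "w \<in> space S"
    have "real m * (M * cp * u w) \<le> C * V w"
    proof -
      have "real m * (M * cp * u w) \<le> real m * (M * cp + M * cl + \<eta>K * cp) * u w"
        using M1 cp cl \<eta>K u1[OF w] by (simp add: algebra_simps mult_left_mono)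
      also have "\<dots> \<le> real m * (M * cp + M * cl + \<eta>K * cp) * ((1 + \<beta>) * V w)"
        using M1 cp cl \<eta>K by (intro mult_left_mono u_le[OF w]) auto
      finally show ?thesis by (simp add: C_def mult.assoc)
    qed
    then show "\<bar>G \<theta> w\<bar> \<le> C * V w" using G_le[OF \<theta> w] by simp
    show "\<bar>G \<theta> w - G \<theta>' w\<bar> \<le> C * V w * norm (\<theta> - \<theta>')" if \<theta>': "\<theta>' \<in> space T" for \<theta>'
    proof -
      have d0: "0 \<le> d \<theta> \<theta>'" by (simp add: d_def)
      have "real m * ((M * cl + \<eta>K * cp) * d \<theta> \<theta>' * u w)
          \<le> real m * ((M * cp + M * cl + \<eta>K * cp) * d \<theta> \<theta>' * ((1 + \<beta>) * V w))"
        using M1 cp cl \<eta>K u1[OF w] d0 by (intro mult_left_mono mult_mono u_le[OF w]) auto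
      also have "\<dots> = C * V w * norm (\<theta> - \<theta>')" by (simp add: C_def d_def mult_ac)
      finally show ?thesis using G_lip[OF \<theta> \<theta>' w] by simp
    qed
    have "G \<theta> w - kernel_op (Q \<theta>) (G \<theta>) w = p \<theta> w - op_average m (\<lambda>j. kernel_op (Q \<theta>) ^^ j) (p \<theta>) w"
      unfolding G_def by (rule markov_op.cesaro_resolvent_equation[OF Pu[OF \<theta>] p_dom[OF \<theta>] w])
    also have "\<dots> = h \<theta> w - E.K.mean (h \<theta>)"
      unfolding p_def by (rule E.K.poisson_equation[OF h_dom[OF \<theta>] h_osc[OF \<theta>] w])
    also have "E.K.mean (h \<theta>) = (\<integral>y. h \<theta> y \<partial>the_stationary S (Q \<theta>))"
      by (rule E.integral_the_stationary(2)[OF h_dom[OF \<theta>], symmetric])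
    finally show "G \<theta> w - (\<integral>y. G \<theta> y \<partial>Q \<theta> w) = h \<theta> w - (\<integral>y. h \<theta> y \<partial>the_stationary S (Q \<theta>))"
      by (simp add: kernel_op_def)
  qed
qed

section \<open>The deterministic recursion\<close>

lemma powr_neg_Suc_ge:
  assumes k: "1 \<le> k" and \<delta>: "0 \<le> \<delta>"
  shows "real k powr -\<delta> * (1 - \<delta> / real k) \<le> real (Suc k) powr -\<delta>"
proof -
  have kp: "0 < real k" using k by simp
  have pos: "0 < 1 + 1 / real k" using kp by (intro add_pos_pos) auto
  have "1 - \<delta> / real k \<le> 1 + -\<delta> * ln (1 + 1 / real k)"
    using mult_left_mono[OF ln_add_one_self_le_self[of "1 / real k"] \<delta>] by simp
  also have "\<dots> \<le> exp (-\<delta> * ln (1 + 1 / real k))" by (rule exp_ge_add_one_self)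
  also have "\<dots> = (1 + 1 / real k) powr -\<delta>" using pos by (simp add: powr_def)
  finally have "real k powr -\<delta> * (1 - \<delta> / real k) \<le> real k powr -\<delta> * (1 + 1 / real k) powr -\<delta>"
    by (intro mult_left_mono) auto
  also have "\<dots> = (real k * (1 + 1 / real k)) powr -\<delta>" by (simp add: powr_mult)
  also have "real k * (1 + 1 / real k) = real (Suc k)" using kp by (simp add: field_simps)
  finally show ?thesis .
qed

text \<open>The relative decrease of \<open>k powr -\<delta>\<close> from one index to the next is at most \<open>\<delta> / k\<close>. For \<open>\<delta> < 1\<close> this is
  negligible against the step size; for \<open>\<delta> = 1\<close> it is of the same order, and the margin is positive
  exactly when \<open>a > 1\<close>.\<close>

lemma step_margin:
  assumes \<delta>: "0 < \<delta>" "\<delta> \<le> 1" and a: "0 < a" and crit: "\<delta> = 1 \<Longrightarrow> 1 < a"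
  obtains \<mu> where "0 < \<mu>" "\<forall>\<^sub>F k in sequentially. \<delta> / real k \<le> (a - \<mu>) * real k powr -\<delta>"
proof (cases "\<delta> = 1")
  case True
  have "\<forall>\<^sub>F k in sequentially. \<delta> / real k \<le> (a - (a - 1)) * real k powr -\<delta>"
    using eventually_gt_at_top[of 0] by eventually_elim (simp add: True powr_minus_divide)
  moreover have "0 < a - 1" using crit[OF True] by simp
  ultimately show ?thesis using that by blast
next
  case False
  have "filterlim real at_top sequentially" by (rule filterlim_real_sequentially)
  then have "(\<lambda>k. real k powr (\<delta> - 1)) \<longlonglongrightarrow> 0"
    using tendsto_neg_powr[of "\<delta> - 1" real sequentially] False \<delta> by simp
  from order_tendstoD(2)[OF this, of "a / 2"]
  have ev: "\<forall>\<^sub>F k in sequentially. real k powr (\<delta> - 1) < a / 2" using a by simp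
  have "\<forall>\<^sub>F k in sequentially. \<delta> / real k \<le> (a - a / 2) * real k powr -\<delta>"
    using ev eventually_gt_at_top[of 0]
  proof eventually_elim
    case (elim k)
    have "\<delta> / real k \<le> 1 / real k" using \<delta> by (simp add: divide_right_mono)
    also have "\<dots> = real k powr (\<delta> - 1) * real k powr -\<delta>"
      using elim by (subst powr_add[symmetric]) (simp add: powr_minus_divide)
    also have "\<dots> \<le> a / 2 * real k powr -\<delta>" using elim by (intro mult_right_mono) auto
    finally show ?case by simp
  qed
  then show ?thesis using that[of "a / 2"] a by simp
qed

text \<open>The quantity \<open>S k = D k + 2 * \<alpha>\<^sub>k * g k\<close> absorbs the differences of \<open>g\<close>. What remains of them is of
  second order, since \<open>\<alpha>\<^sub>k - \<alpha>\<^sub>k\<^sub>+\<^sub>1\<close> is at most of the order of \<open>\<alpha>\<^sub>k\<^sup>2\<close> for \<open>\<delta> \<le> 1\<close>. A bound \<open>S k \<le> B * u * k powr -\<delta>\<close> then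
  propagates by induction as soon as \<open>B\<close> times the margin of \<open>step_margin\<close> is at least the coefficient
  of the second-order terms.\<close>

lemma chung_recursion:
  assumes steps: "0 < \<alpha>\<^sub>0" "0 < \<delta>" "\<delta> \<le> 1" and \<zeta>: "0 < \<zeta>" and crit: "\<delta> = 1 \<Longrightarrow> 1 < 2 * \<zeta> * \<alpha>\<^sub>0"
    and params: "0 \<le> \<Delta>" "0 \<le> \<kappa>" "0 \<le> \<Gamma>"
  obtains C K where "0 < C" "0 < K"
    "\<And>(D :: nat \<Rightarrow> real) g u k. 0 \<le> u \<Longrightarrow> (\<And>k. D k \<le> \<Delta> * u) \<Longrightarrow> (\<And>k. \<bar>g k\<bar> \<le> \<kappa> * u) \<Longrightarrow>
      (\<And>k. D (Suc k) \<le> (1 - 2 * \<zeta> * step_size \<alpha>\<^sub>0 \<delta> k) * D k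
         + 2 * step_size \<alpha>\<^sub>0 \<delta> k * (g k - g (Suc k)) + \<Gamma> * (step_size \<alpha>\<^sub>0 \<delta> k)\<^sup>2 * u) \<Longrightarrow>
      K \<le> k \<Longrightarrow> D k \<le> C * u * real k powr -\<delta>"
proof -
  define p where "p k = real k powr -\<delta>" for k
  have \<alpha>: "step_size \<alpha>\<^sub>0 \<delta> k = \<alpha>\<^sub>0 * p k" if "1 \<le> k" for k using that by (simp add: step_size_def p_def)
  have p: "0 < p k" "p k \<le> 1" "1 / real k \<le> p k" if "1 \<le> k" for k
  proof -
    show "0 < p k" using that by (simp add: p_def)
    have "real k powr -\<delta> \<le> real k powr 0" using that steps by (intro powr_mono) auto
    then show "p k \<le> 1" using that by (simp add: p_def)
    have "real k powr -1 \<le> real k powr -\<delta>" using that steps by (intro powr_mono) auto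
    then show "1 / real k \<le> p k" using that by (simp add: p_def powr_minus_divide)
  qed
  have p_Suc: "p k - p k * (\<delta> / real k) \<le> p (Suc k)" if "1 \<le> k" for k
    using powr_neg_Suc_ge[OF that, of \<delta>] steps by (simp add: p_def right_diff_distrib)
  have p_dec: "p (Suc k) \<le> p k" if "1 \<le> k" for k
    using that steps by (simp add: p_def powr_mono2')
  have p_diff: "p k - p (Suc k) \<le> (p k)\<^sup>2" if k: "1 \<le> k" for k
  proof -
    have "\<delta> / real k \<le> 1 / real k" using steps k by (simp add: divide_right_mono)
    then have "p k * (\<delta> / real k) \<le> p k * p k" using p[OF k] by (intro mult_left_mono) auto
    then show ?thesis using p_Suc[OF k] by (simp add: power2_eq_square)
  qed
  obtain \<mu> where \<mu>: "0 < \<mu>" and ev1: "\<forall>\<^sub>F k in sequentially. \<delta> / real k \<le> (2 * \<zeta> * \<alpha>\<^sub>0 - \<mu>) * p k"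
    using step_margin[OF steps(2,3) _ crit] \<zeta> steps unfolding p_def by (metis mult_pos_pos zero_less_numeral)
  have "p \<longlonglongrightarrow> 0"
    unfolding p_def using steps filterlim_real_sequentially by (intro tendsto_neg_powr) auto
  then have "(\<lambda>k. 2 * \<zeta> * \<alpha>\<^sub>0 * p k) \<longlonglongrightarrow> 0" by (rule tendsto_mult_right_zero)
  from order_tendstoD(2)[OF this, of 1]
  have ev2: "\<forall>\<^sub>F k in sequentially. 2 * \<zeta> * \<alpha>\<^sub>0 * p k < 1" by simp
  obtain K0 where K0: "\<And>k. K0 \<le> k \<Longrightarrow> \<delta> / real k \<le> (2 * \<zeta> * \<alpha>\<^sub>0 - \<mu>) * p k \<and> 2 * \<zeta> * \<alpha>\<^sub>0 * p k < 1"
    using eventually_conj[OF ev1 ev2] by (auto simp: eventually_sequentially)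
  \<comment> \<open>The step size at 0 does not follow the power law, so the induction starts at 1 or later.\<close>
  define K where "K = max 1 K0"
  have K: "1 \<le> k" "\<delta> / real k \<le> (2 * \<zeta> * \<alpha>\<^sub>0 - \<mu>) * p k" "2 * \<zeta> * \<alpha>\<^sub>0 * p k < 1" if "K \<le> k" for k
    using that K0[of k] by (auto simp: K_def)
  define \<Gamma>' where "\<Gamma>' = 4 * \<zeta> * \<kappa> * \<alpha>\<^sub>0\<^sup>2 + 2 * \<kappa> * \<alpha>\<^sub>0 + \<Gamma> * \<alpha>\<^sub>0\<^sup>2"
  \<comment> \<open>The first summand starts the induction at K, the second carries its step.\<close>
  define B where "B = (\<Delta> + 2 * \<alpha>\<^sub>0 * \<kappa>) / p K + \<Gamma>' / \<mu>"
  have \<Gamma>': "0 \<le> \<Gamma>'" using \<zeta> params steps by (simp add: \<Gamma>'_def)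
  have pK: "0 < p K" using p K by simp
  have B0: "0 \<le> B" using params steps pK \<Gamma>' \<mu> by (simp add: B_def)
  have BK: "\<Delta> + 2 * \<alpha>\<^sub>0 * \<kappa> \<le> B * p K"
  proof -
    have "(\<Delta> + 2 * \<alpha>\<^sub>0 * \<kappa>) / p K * p K \<le> B * p K"
      unfolding B_def using \<Gamma>' \<mu> pK by (intro mult_right_mono) auto
    then show ?thesis using pK by simp
  qed
  have B\<mu>: "\<Gamma>' \<le> B * \<mu>"
  proof -
    have "\<Gamma>' / \<mu> * \<mu> \<le> B * \<mu>"
      unfolding B_def using params steps pK \<mu> by (intro mult_right_mono) auto
    then show ?thesis using \<mu> by simp
  qed
  define C where "C = B + 2 * \<alpha>\<^sub>0 * \<kappa> + 1"
  show ?thesis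
  proof (rule that[of C K])
    show "0 < C" using B0 params steps by (simp add: C_def add_nonneg_pos)
    show "0 < K" by (simp add: K_def)
    fix D g :: "nat \<Rightarrow> real" and u k
    assume u: "0 \<le> u" and D: "\<And>k. D k \<le> \<Delta> * u" and g: "\<And>k. \<bar>g k\<bar> \<le> \<kappa> * u"
      and rec: "\<And>k. D (Suc k) \<le> (1 - 2 * \<zeta> * step_size \<alpha>\<^sub>0 \<delta> k) * D k
         + 2 * step_size \<alpha>\<^sub>0 \<delta> k * (g k - g (Suc k)) + \<Gamma> * (step_size \<alpha>\<^sub>0 \<delta> k)\<^sup>2 * u"
      and k: "K \<le> k"
    define S where "S k = D k + 2 * (\<alpha>\<^sub>0 * p k) * g k" for k
    have g_part: "x * g k \<le> x * (\<kappa> * u)" "- (x * g k) \<le> x * (\<kappa> * u)" if "0 \<le> x" for x k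
      using mult_left_mono[OF abs_le_D1[OF g] that, of k] mult_left_mono[OF abs_le_D2[OF g] that, of k] by auto
    have S_step: "S (Suc k) \<le> (1 - 2 * \<zeta> * \<alpha>\<^sub>0 * p k) * S k + \<Gamma>' * (p k)\<^sup>2 * u" if k: "1 \<le> k" for k
    proof -
      have "S (Suc k) \<le> (1 - 2 * \<zeta> * (\<alpha>\<^sub>0 * p k)) * D k + 2 * (\<alpha>\<^sub>0 * p k) * (g k - g (Suc k))
          + \<Gamma> * (\<alpha>\<^sub>0 * p k)\<^sup>2 * u + 2 * (\<alpha>\<^sub>0 * p (Suc k)) * g (Suc k)"
        using rec[of k] by (simp add: S_def \<alpha>[OF k])
      also have "\<dots> = (1 - 2 * \<zeta> * \<alpha>\<^sub>0 * p k) * S k + (4 * \<zeta> * \<alpha>\<^sub>0\<^sup>2 * (p k)\<^sup>2) * g k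
          + - ((2 * \<alpha>\<^sub>0 * (p k - p (Suc k))) * g (Suc k)) + \<Gamma> * \<alpha>\<^sub>0\<^sup>2 * (p k)\<^sup>2 * u"
        by (simp add: S_def algebra_simps power2_eq_square)
      also have "\<dots> \<le> (1 - 2 * \<zeta> * \<alpha>\<^sub>0 * p k) * S k + (4 * \<zeta> * \<alpha>\<^sub>0\<^sup>2 * (p k)\<^sup>2) * (\<kappa> * u)
          + (2 * \<alpha>\<^sub>0 * (p k - p (Suc k))) * (\<kappa> * u) + \<Gamma> * \<alpha>\<^sub>0\<^sup>2 * (p k)\<^sup>2 * u"
        using \<zeta> steps p_dec[OF k] by (intro add_mono g_part order_refl mult_nonneg_nonneg) auto
      also have "\<dots> \<le> (1 - 2 * \<zeta> * \<alpha>\<^sub>0 * p k) * S k + (4 * \<zeta> * \<alpha>\<^sub>0\<^sup>2 * (p k)\<^sup>2) * (\<kappa> * u)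
          + (2 * \<alpha>\<^sub>0 * (p k)\<^sup>2) * (\<kappa> * u) + \<Gamma> * \<alpha>\<^sub>0\<^sup>2 * (p k)\<^sup>2 * u"
        using p_diff[OF k] steps params u
        by (intro add_mono order_refl mult_right_mono mult_left_mono) auto
      also have "\<dots> = (1 - 2 * \<zeta> * \<alpha>\<^sub>0 * p k) * S k + \<Gamma>' * (p k)\<^sup>2 * u"
        by (simp add: \<Gamma>'_def algebra_simps)
      finally show ?thesis .
    qed
    have "S k \<le> B * u * p k"
      using k
    proof (induction k rule: nat_induct_at_least)
      case base
      have "2 * (\<alpha>\<^sub>0 * p K) * g K \<le> 2 * (\<alpha>\<^sub>0 * p K) * (\<kappa> * u)"
        using steps pK by (intro g_part) auto
      also have "\<dots> \<le> 2 * (\<alpha>\<^sub>0 * 1) * (\<kappa> * u)"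
        using steps params u p(2)[OF K(1)[OF order_refl]] by (intro mult_right_mono mult_left_mono) auto
      finally have "S K \<le> (\<Delta> + 2 * \<alpha>\<^sub>0 * \<kappa>) * u"
        using D[of K] by (simp add: S_def algebra_simps)
      also have "\<dots> \<le> B * p K * u" using BK u by (rule mult_right_mono)
      finally show ?case by (simp add: mult_ac)
    next
      case (Suc k)
      note k = K[OF Suc.hyps]
      have "S (Suc k) \<le> (1 - 2 * \<zeta> * \<alpha>\<^sub>0 * p k) * (B * u * p k) + \<Gamma>' * (p k)\<^sup>2 * u"
        using S_step[OF k(1)] mult_left_mono[OF Suc.IH, of "1 - 2 * \<zeta> * \<alpha>\<^sub>0 * p k"] k(3) by linarith
      also have "\<dots> \<le> (1 - 2 * \<zeta> * \<alpha>\<^sub>0 * p k) * (B * u * p k) + (B * \<mu>) * (p k)\<^sup>2 * u"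
        using B\<mu> u by (intro add_left_mono mult_right_mono) auto
      also have "\<dots> = B * u * (p k - p k * ((2 * \<zeta> * \<alpha>\<^sub>0 - \<mu>) * p k))"
        by (simp add: algebra_simps power2_eq_square)
      also have "\<dots> \<le> B * u * (p k - p k * (\<delta> / real k))"
        using B0 u k(2) p(1)[OF k(1)] by (intro mult_left_mono diff_left_mono) auto
      also have "\<dots> \<le> B * u * p (Suc k)" using B0 u by (intro mult_left_mono p_Suc k(1)) auto
      finally show ?case .
    qed
    moreover have "- (2 * (\<alpha>\<^sub>0 * p k) * g k) \<le> 2 * (\<alpha>\<^sub>0 * p k) * (\<kappa> * u)"
      using steps p(1)[OF K(1)[OF k]] by (intro g_part) auto
    ultimately have "D k \<le> B * u * p k + 2 * (\<alpha>\<^sub>0 * p k) * (\<kappa> * u)"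
      unfolding S_def by linarith
    also have "\<dots> \<le> C * u * p k"
      using u p(1)[OF K(1)[OF k]] by (simp add: C_def algebra_simps)
    finally show "D k \<le> C * u * real k powr -\<delta>" by (simp add: p_def)
  qed
qed

section \<open>The Markov property of the adaptive chain\<close>

locale adaptive_chain =
  fixes \<Theta> :: "'a::euclidean_space set" and \<W> :: "'b::euclidean_space set" and F :: "'a \<Rightarrow> 'b \<Rightarrow> 'a"
    and P :: "'a \<Rightarrow> 'b \<Rightarrow> 'b measure" and \<alpha> :: "nat \<Rightarrow> real" and M :: "'w measure"
    and \<theta> :: "nat \<Rightarrow> 'w \<Rightarrow> 'a" and W :: "nat \<Rightarrow> 'w \<Rightarrow> 'b"
  assumes model: "model \<Theta> \<W> F P" and SA: "adaptive_SA \<Theta> \<W> F P \<alpha> M \<theta> W"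
begin

sublocale prob_space M using SA by (simp add: adaptive_SA_def)

abbreviation T :: "'a measure" where "T \<equiv> restrict_space borel \<Theta>"
abbreviation S :: "'b measure" where "S \<equiv> restrict_space borel \<W>"

lemma spaces [simp]: "space T = \<Theta>" "space S = \<W>"
  by (simp_all add: space_restrict_space)

lemma kernel: "(\<lambda>(\<theta>, w). P \<theta> w) \<in> T \<Otimes>\<^sub>M S \<rightarrow>\<^sub>M prob_algebra S"
  using model by (simp add: model_def)

lemma process_measurable [measurable]: "\<theta> k \<in> M \<rightarrow>\<^sub>M T" "W k \<in> M \<rightarrow>\<^sub>M S"
  using SA by (auto simp: adaptive_SA_def)

lemma process_in: "\<omega> \<in> space M \<Longrightarrow> \<theta> k \<omega> \<in> \<Theta>" "\<omega> \<in> space M \<Longrightarrow> W k \<omega> \<in> \<W>"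
  using measurable_space[OF process_measurable(1)] measurable_space[OF process_measurable(2)] by auto

lemma process_borel: "\<theta> k \<in> borel_measurable M" "W k \<in> borel_measurable M"
  using process_measurable measurable_restrict_space2_iff by blast+

lemma history_generators: "(\<Union>j\<le>k. {\<theta> j -` A \<inter> space M |A. A \<in> sets borel} \<union>
    {W j -` B \<inter> space M |B. B \<in> sets borel}) \<subseteq> sets M"
  using measurable_sets[OF process_borel(1)] measurable_sets[OF process_borel(2)] by auto

lemma sets_history: "sets (history M \<theta> W k) = sigma_sets (space M)
    (\<Union>j\<le>k. {\<theta> j -` A \<inter> space M |A. A \<in> sets borel} \<union> {W j -` B \<inter> space M |B. B \<in> sets borel})"
  unfolding history_def by (rule sets_measure_of) auto

lemma space_history: "space (history M \<theta> W k) = space M"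
  unfolding history_def by (rule space_measure_of) auto

lemma history_subalgebra: "subalgebra M (history M \<theta> W k)"
  unfolding subalgebra_def
  using sets.sigma_sets_subset[OF history_generators, of k] by (simp add: space_history sets_history)

sublocale history: finite_measure_subalgebra M "history M \<theta> W k" for k
  by unfold_locales (rule history_subalgebra)

lemma history_0_subset: "sets (history M \<theta> W 0) \<subseteq> sets (history M \<theta> W k)"
  unfolding sets_history by (rule sigma_sets_mono') auto

lemma \<theta>_history:
  assumes "B \<in> sets T"
  shows "\<theta> k -` B \<inter> space M \<in> sets (history M \<theta> W k)"
proof -
  obtain B' where B': "B' \<in> sets borel" "B = \<Theta> \<inter> B'"
    using assms by (auto simp: sets_restrict_space)
  have "\<theta> k -` B \<inter> space M = \<theta> k -` B' \<inter> space M" using process_in(1) B' by auto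
  moreover have "\<theta> k -` B' \<inter> space M \<in> sets (history M \<theta> W k)"
    unfolding sets_history using B' by (intro sigma_sets.Basic) blast
  ultimately show ?thesis by simp
qed

lemma W0_history: "W 0 \<in> borel_measurable (history M \<theta> W 0)"
proof (rule measurableI)
  fix B :: "'b set" assume "B \<in> sets borel"
  then show "W 0 -` B \<inter> space (history M \<theta> W 0) \<in> sets (history M \<theta> W 0)"
    unfolding space_history sets_history by (intro sigma_sets.Basic) blast
qed simp

lemma process_kernel: "(\<lambda>\<omega>. P (\<theta> k \<omega>) (W k \<omega>)) \<in> M \<rightarrow>\<^sub>M prob_algebra S"
  using measurable_compose[OF measurable_Pair[OF process_measurable] kernel] by simp

lemma process_kernelD:
  assumes "\<omega> \<in> space M"
  shows "prob_space (P (\<theta> k \<omega>) (W k \<omega>))" "sets (P (\<theta> k \<omega>) (W k \<omega>)) = sets S"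
    "space (P (\<theta> k \<omega>) (W k \<omega>)) = \<W>"
  using measurable_space[OF process_kernel assms] sets_eq_imp_space_eq[of _ S]
  by (auto simp: space_prob_algebra)

text \<open>The event that \<open>\<theta> k\<close> lies in \<open>B\<close> belongs to the history, so the conditional law of the next state,
  given only for single sets, may be integrated over it.\<close>

lemma markov_rectangle:
  assumes A: "A \<in> sets (history M \<theta> W 0)" and B: "B \<in> sets T" and E: "E \<in> sets S"
  shows "(\<integral>\<^sup>+\<omega>. indicator A \<omega> * (indicator B (\<theta> k \<omega>) * indicator E (W (Suc k) \<omega>)) \<partial>M)
    = (\<integral>\<^sup>+\<omega>. indicator A \<omega> * (indicator B (\<theta> k \<omega>) * emeasure (P (\<theta> k \<omega>) (W k \<omega>)) E) \<partial>M)"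
proof -
  define A' where "A' = A \<inter> (\<theta> k -` B \<inter> space M)"
  have A': "A' \<in> sets (history M \<theta> W k)"
    unfolding A'_def using history_0_subset A \<theta>_history[OF B] by blast
  then have A'M: "A' \<in> sets M" using history_subalgebra[of k] by (auto simp: subalgebra_def)
  have A'_ind: "indicator A' \<omega> = indicator A \<omega> * (indicator B (\<theta> k \<omega>) :: 'x::semiring_1)" if "\<omega> \<in> space M" for \<omega>
    using that by (simp add: A'_def indicator_def)
  have [measurable]: "(\<lambda>\<omega>. indicat_real E (W (Suc k) \<omega>)) \<in> borel_measurable M"
    using E by measurable
  let ?m = "\<lambda>\<omega>. measure (P (\<theta> k \<omega>) (W k \<omega>)) E"
  have [measurable]: "?m \<in> borel_measurable M"
    by (rule measurable_compose[OF measurable_prob_algebraD[OF process_kernel] measurable_measure_subprob_algebra[OF E]])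
  have m1: "?m \<omega> \<le> 1" if "\<omega> \<in> space M" for \<omega>
    using prob_space.prob_le_1[OF process_kernelD(1)[OF that]] by simp
  have int1: "integrable M (\<lambda>\<omega>. indicat_real E (W (Suc k) \<omega>))"
  proof (rule integrable_const_bound[where B = 1])
    show "AE \<omega> in M. norm (indicat_real E (W (Suc k) \<omega>)) \<le> 1" by (simp add: indicator_def)
  qed measurable
  have int_m: "integrable M (\<lambda>\<omega>. indicator A' \<omega> * ?m \<omega>)"
    by (rule integrable_const_bound[where B = 1])
       (use m1 A'M in \<open>auto intro!: AE_I2 simp: indicator_def\<close>)
  have int_i: "integrable M (\<lambda>\<omega>. indicator A' \<omega> * indicat_real E (W (Suc k) \<omega>))"
  proof (rule integrable_const_bound[where B = 1])
    show "AE \<omega> in M. norm (indicator A' \<omega> * indicat_real E (W (Suc k) \<omega>)) \<le> 1" by (simp add: indicator_def)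
  qed (use A'M in measurable)
  have "(\<integral>\<omega>. indicator A' \<omega> * indicat_real E (W (Suc k) \<omega>) \<partial>M)
      = (\<integral>\<omega>. indicator A' \<omega> * real_cond_exp M (history M \<theta> W k) (\<lambda>\<omega>. indicat_real E (W (Suc k) \<omega>)) \<omega> \<partial>M)"
    using history.real_cond_exp_intA[OF int1 A'] by (simp add: set_lebesgue_integral_def)
  also have "\<dots> = (\<integral>\<omega>. indicator A' \<omega> * ?m \<omega> \<partial>M)"
  proof (rule integral_cong_AE)
    have "AE \<omega> in M. real_cond_exp M (history M \<theta> W k) (\<lambda>\<omega>. indicat_real E (W (Suc k) \<omega>)) \<omega> = ?m \<omega>"
      using SA E by (auto simp: adaptive_SA_def)
    then show "AE \<omega> in M. indicator A' \<omega> * real_cond_exp M (history M \<theta> W k) (\<lambda>\<omega>. indicat_real E (W (Suc k) \<omega>)) \<omega>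
        = indicator A' \<omega> * ?m \<omega>"
      by eventually_elim simp
  qed (use A'M in measurable)
  finally have eq: "(\<integral>\<omega>. indicator A' \<omega> * indicat_real E (W (Suc k) \<omega>) \<partial>M) = (\<integral>\<omega>. indicator A' \<omega> * ?m \<omega> \<partial>M)" .
  have "(\<integral>\<^sup>+\<omega>. indicator A \<omega> * (indicator B (\<theta> k \<omega>) * indicator E (W (Suc k) \<omega>)) \<partial>M)
      = (\<integral>\<^sup>+\<omega>. ennreal (indicator A' \<omega> * indicat_real E (W (Suc k) \<omega>)) \<partial>M)"
    by (rule nn_integral_cong) (auto simp: A'_def indicator_def)
  also have "\<dots> = ennreal (\<integral>\<omega>. indicator A' \<omega> * indicat_real E (W (Suc k) \<omega>) \<partial>M)"
    by (rule nn_integral_eq_integral[OF int_i]) simp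
  also have "\<dots> = ennreal (\<integral>\<omega>. indicator A' \<omega> * ?m \<omega> \<partial>M)" by (simp add: eq)
  also have "\<dots> = (\<integral>\<^sup>+\<omega>. ennreal (indicator A' \<omega> * ?m \<omega>) \<partial>M)"
    by (rule nn_integral_eq_integral[OF int_m, symmetric]) simp
  also have "\<dots> = (\<integral>\<^sup>+\<omega>. indicator A \<omega> * (indicator B (\<theta> k \<omega>) * emeasure (P (\<theta> k \<omega>) (W k \<omega>)) E) \<partial>M)"
  proof (rule nn_integral_cong)
    fix \<omega> assume \<omega>: "\<omega> \<in> space M"
    interpret Pw: prob_space "P (\<theta> k \<omega>) (W k \<omega>)" by (rule process_kernelD(1)[OF \<omega>])
    show "ennreal (indicator A' \<omega> * ?m \<omega>)
        = indicator A \<omega> * (indicator B (\<theta> k \<omega>) * emeasure (P (\<theta> k \<omega>) (W k \<omega>)) E)"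
      using \<omega> by (auto simp: A'_def indicator_def Pw.emeasure_eq_measure)
  qed
  finally show ?thesis .
qed

text \<open>Both sides are integrals of \<open>g\<close> against laws on pairs. These agree on rectangles, hence everywhere.\<close>

lemma markov_nn:
  assumes A: "A \<in> sets (history M \<theta> W 0)" and g: "g \<in> borel_measurable (T \<Otimes>\<^sub>M S)"
  shows "(\<integral>\<^sup>+\<omega>. indicator A \<omega> * g (\<theta> k \<omega>, W (Suc k) \<omega>) \<partial>M)
    = (\<integral>\<^sup>+\<omega>. indicator A \<omega> * (\<integral>\<^sup>+y. g (\<theta> k \<omega>, y) \<partial>P (\<theta> k \<omega>) (W k \<omega>)) \<partial>M)"
proof -
  have AM[measurable]: "A \<in> sets M" using A history_subalgebra[of 0] by (auto simp: subalgebra_def)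
  have iA[measurable]: "(indicator A :: 'w \<Rightarrow> ennreal) \<in> borel_measurable M" by measurable
  define D where "D = density M (indicator A)"
  have sets_D[measurable_cong]: "sets D = sets M" and space_D: "space D = space M" by (simp_all add: D_def)
  define N where "N = (\<lambda>\<omega>. distr (P (\<theta> k \<omega>) (W k \<omega>)) (T \<Otimes>\<^sub>M S) (\<lambda>y. (\<theta> k \<omega>, y)))"
  have f: "case_prod (\<lambda>\<omega> y. (\<theta> k \<omega>, y)) \<in> M \<Otimes>\<^sub>M S \<rightarrow>\<^sub>M T \<Otimes>\<^sub>M S" by measurable
  have N: "N \<in> M \<rightarrow>\<^sub>M subprob_algebra (T \<Otimes>\<^sub>M S)"
    unfolding N_def by (rule measurable_distr2[OF f measurable_prob_algebraD[OF process_kernel]])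
  then have ND: "N \<in> D \<rightarrow>\<^sub>M subprob_algebra (T \<Otimes>\<^sub>M S)" by (simp cong: measurable_cong_sets add: sets_D)
  have ne: "space D \<noteq> {}" using not_empty by (simp add: space_D)
  have pair_meas: "(\<lambda>y. (\<theta> k \<omega>, y)) \<in> P (\<theta> k \<omega>) (W k \<omega>) \<rightarrow>\<^sub>M T \<Otimes>\<^sub>M S" if "\<omega> \<in> space M" for \<omega>
    using process_in(1)[OF that, of k] by (simp add: measurable_cong_sets[OF process_kernelD(2)[OF that] refl])
  have next_meas[measurable]: "(\<lambda>\<omega>. (\<theta> k \<omega>, W (Suc k) \<omega>)) \<in> D \<rightarrow>\<^sub>M T \<Otimes>\<^sub>M S" by measurable
  have eq: "distr D (T \<Otimes>\<^sub>M S) (\<lambda>\<omega>. (\<theta> k \<omega>, W (Suc k) \<omega>)) = D \<bind> N" (is "?\<mu>1 = ?\<mu>2")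
  proof (rule measure_eqI_generator_eq[OF Int_stable_pair_measure_generator[of T S]])
    show "{a \<times> b |a b. a \<in> sets T \<and> b \<in> sets S} \<subseteq> Pow (space T \<times> space S)"
      using sets.sets_into_space[of _ T] sets.sets_into_space[of _ S] by blast
    show "sets ?\<mu>1 = sigma_sets (space T \<times> space S) {a \<times> b |a b. a \<in> sets T \<and> b \<in> sets S}"
      unfolding sets_distr by (rule sets_pair_measure)
    have "sets ?\<mu>2 = sets (T \<Otimes>\<^sub>M S)" by (rule sets_bind[OF _ ne]) (rule sets_kernel[OF ND])
    then show "sets ?\<mu>2 = sigma_sets (space T \<times> space S) {a \<times> b |a b. a \<in> sets T \<and> b \<in> sets S}"
      by (simp only: sets_pair_measure)
    show "range (\<lambda>_::nat. space T \<times> space S) \<subseteq> {a \<times> b |a b. a \<in> sets T \<and> b \<in> sets S}"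
      by blast
    have "emeasure ?\<mu>1 (space T \<times> space S) \<le> emeasure M (space M)"
    proof -
      have "emeasure ?\<mu>1 (space T \<times> space S) = emeasure D ((\<lambda>\<omega>. (\<theta> k \<omega>, W (Suc k) \<omega>)) -` (space T \<times> space S) \<inter> space D)"
        by (rule emeasure_distr[OF next_meas]) (intro pair_measureI sets.top)
      also have "\<dots> \<le> emeasure D (space D)" by (rule emeasure_space)
      also have "\<dots> = (\<integral>\<^sup>+\<omega>. indicator A \<omega> \<partial>M)"
        unfolding D_def by (simp add: emeasure_density)
      also have "\<dots> \<le> emeasure M (space M)" using emeasure_space[of M A] by simp
      finally show ?thesis .
    qed
    then show "emeasure ?\<mu>1 (space T \<times> space S) \<noteq> \<infinity>" for i :: nat
      by (metis emeasure_space_1 ennreal_one_less_top infinity_ennreal_def leD)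
    fix X assume "X \<in> {a \<times> b |a b. a \<in> sets T \<and> b \<in> sets S}"
    then obtain B E where X: "X = B \<times> E" and B[measurable]: "B \<in> sets T" and E[measurable]: "E \<in> sets S" by blast
    have XS: "X \<in> sets (T \<Otimes>\<^sub>M S)" using X B E by (simp add: pair_measureI)
    have "emeasure ?\<mu>1 X = (\<integral>\<^sup>+z. indicator X z \<partial>?\<mu>1)" using XS by simp
    also have "\<dots> = (\<integral>\<^sup>+\<omega>. indicator X (\<theta> k \<omega>, W (Suc k) \<omega>) \<partial>D)"
      by (rule nn_integral_distr[OF next_meas]) (use XS in simp)
    also have "\<dots> = (\<integral>\<^sup>+\<omega>. indicator A \<omega> * indicator X (\<theta> k \<omega>, W (Suc k) \<omega>) \<partial>M)"
      unfolding D_def by (rule nn_integral_density) (use XS in measurable)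
    also have "\<dots> = (\<integral>\<^sup>+\<omega>. indicator A \<omega> * (indicator B (\<theta> k \<omega>) * indicator E (W (Suc k) \<omega>)) \<partial>M)"
      by (simp add: X indicator_times)
    also have "\<dots> = (\<integral>\<^sup>+\<omega>. indicator A \<omega> * (indicator B (\<theta> k \<omega>) * emeasure (P (\<theta> k \<omega>) (W k \<omega>)) E) \<partial>M)"
      by (rule markov_rectangle[OF A B E])
    also have "\<dots> = (\<integral>\<^sup>+\<omega>. indicator A \<omega> * emeasure (N \<omega>) X \<partial>M)"
    proof (rule nn_integral_cong)
      fix \<omega> assume \<omega>: "\<omega> \<in> space M"
      have "emeasure (N \<omega>) X = emeasure (P (\<theta> k \<omega>) (W k \<omega>)) ((\<lambda>y. (\<theta> k \<omega>, y)) -` X \<inter> space (P (\<theta> k \<omega>) (W k \<omega>)))"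
        unfolding N_def by (rule emeasure_distr[OF pair_meas[OF \<omega>] XS])
      also have "(\<lambda>y. (\<theta> k \<omega>, y)) -` X \<inter> space (P (\<theta> k \<omega>) (W k \<omega>)) = (if \<theta> k \<omega> \<in> B then E else {})"
        using sets.sets_into_space[OF E] process_kernelD(3)[OF \<omega>] by (auto simp: X)
      finally show "indicator A \<omega> * (indicator B (\<theta> k \<omega>) * emeasure (P (\<theta> k \<omega>) (W k \<omega>)) E)
          = indicator A \<omega> * emeasure (N \<omega>) X" by simp
    qed
    also have "\<dots> = (\<integral>\<^sup>+\<omega>. emeasure (N \<omega>) X \<partial>D)"
      unfolding D_def
      by (rule nn_integral_density[symmetric])
         (use measurable_compose[OF N measurable_emeasure_subprob_algebra[OF XS]] in auto)
    also have "\<dots> = emeasure ?\<mu>2 X" by (rule emeasure_bind[OF ne ND XS, symmetric])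
    finally show "emeasure ?\<mu>1 X = emeasure ?\<mu>2 X" .
  qed auto
  have gm: "(\<lambda>\<omega>. \<integral>\<^sup>+z. g z \<partial>N \<omega>) \<in> borel_measurable M"
    by (rule measurable_compose[OF N nn_integral_measurable_subprob_algebra[OF g]])
  have "(\<integral>\<^sup>+\<omega>. indicator A \<omega> * g (\<theta> k \<omega>, W (Suc k) \<omega>) \<partial>M) = (\<integral>\<^sup>+\<omega>. g (\<theta> k \<omega>, W (Suc k) \<omega>) \<partial>D)"
    unfolding D_def by (rule nn_integral_density[symmetric]) (use g in measurable)
  also have "\<dots> = (\<integral>\<^sup>+z. g z \<partial>?\<mu>1)" by (rule nn_integral_distr[OF next_meas, symmetric]) (use g in simp)
  also have "\<dots> = (\<integral>\<^sup>+z. g z \<partial>?\<mu>2)" by (simp only: eq)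
  also have "\<dots> = (\<integral>\<^sup>+\<omega>. \<integral>\<^sup>+z. g z \<partial>N \<omega> \<partial>D)" by (rule nn_integral_bind[OF g ND])
  also have "\<dots> = (\<integral>\<^sup>+\<omega>. indicator A \<omega> * (\<integral>\<^sup>+z. g z \<partial>N \<omega>) \<partial>M)"
    unfolding D_def by (rule nn_integral_density) (use gm in auto)
  also have "\<dots> = (\<integral>\<^sup>+\<omega>. indicator A \<omega> * (\<integral>\<^sup>+y. g (\<theta> k \<omega>, y) \<partial>P (\<theta> k \<omega>) (W k \<omega>)) \<partial>M)"
    by (rule nn_integral_cong) (simp add: N_def nn_integral_distr[OF pair_meas] g)
  finally show ?thesis .
qed

end

section \<open>The Poisson solution of the model\<close>

lemma U_ge_1: "1 \<le> U 2 w"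
  by (simp add: U_def)

lemma U_measurable [measurable]: "U p \<in> borel_measurable borel"
  unfolding U_def[abs_def] by measurable

lemma sqrt_U_bounds: "1 \<le> sqrt (U 2 w)" "sqrt (U 2 w) \<le> U 2 w" "sqrt (U 2 w) \<le> U 1 w" "1 + norm w \<le> 2 * sqrt (U 2 w)"
proof -
  show "1 \<le> sqrt (U 2 w)" using U_ge_1 by simp
  have "U 2 w \<le> (U 2 w)\<^sup>2" using U_ge_1[of w] by (simp add: power2_eq_square mult_le_cancel_left1)
  then show "sqrt (U 2 w) \<le> U 2 w" using U_ge_1[of w] by (intro real_le_lsqrt) auto
  have "U 2 w \<le> (U 1 w)\<^sup>2" by (simp add: U_def power2_eq_square algebra_simps)
  then show "sqrt (U 2 w) \<le> U 1 w" by (intro real_le_lsqrt) (auto simp: U_def)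
  have "norm w \<le> sqrt (U 2 w)" by (intro real_le_rsqrt) (simp add: U_def)
  with \<open>1 \<le> sqrt (U 2 w)\<close> show "1 + norm w \<le> 2 * sqrt (U 2 w)" by linarith
qed

text \<open>Jensen's inequality for the square root, in the form that a variance is nonnegative.\<close>

lemma drift_sqrt:
  assumes N: "prob_space N" "sets N = sets (restrict_space borel \<W>)"
    and le: "(\<integral>\<^sup>+y. ennreal (U 2 y) \<partial>N) \<le> ennreal c" and c: "0 \<le> c"
  shows "integrable N (\<lambda>y. sqrt (U 2 y))" "(\<integral>y. sqrt (U 2 y) \<partial>N) \<le> sqrt c"
proof -
  interpret prob_space N by (rule N)
  have meas: "f \<in> borel_measurable N" if "f \<in> borel_measurable borel" for f :: "'a \<Rightarrow> real"
    using that N(2) by (simp cong: measurable_cong_sets add: measurable_restrict_space1)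
  have int2: "integrable N (U 2)"
    by (rule integrable_of_nn_integral_le[OF meas]) (use le U_ge_1 in \<open>simp_all add: U_def\<close>)
  show int1: "integrable N (\<lambda>y. sqrt (U 2 y))"
  proof (rule Bochner_Integration.integrable_bound[OF int2])
    show "(\<lambda>y. sqrt (U 2 y)) \<in> borel_measurable N" by (rule meas) measurable
    show "AE y in N. norm (sqrt (U 2 y)) \<le> norm (U 2 y)"
      using sqrt_U_bounds U_ge_1 by (auto simp: U_def)
  qed
  have sq: "(sqrt (U 2 y))\<^sup>2 = U 2 y" for y :: 'a using U_ge_1[of y] by simp
  have "(\<integral>y. U 2 y \<partial>N) \<le> c"
  proof -
    have "ennreal (\<integral>y. U 2 y \<partial>N) = (\<integral>\<^sup>+y. ennreal (U 2 y) \<partial>N)"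
      by (rule nn_integral_eq_integral[symmetric, OF int2]) (simp add: U_def)
    then show ?thesis using le c by (metis ennreal_le_iff)
  qed
  moreover have "0 \<le> variance (\<lambda>y. sqrt (U 2 y))" by (rule variance_positive)
  then have "(\<integral>y. sqrt (U 2 y) \<partial>N)\<^sup>2 \<le> (\<integral>y. U 2 y \<partial>N)"
    using variance_eq[OF int1] int2 by (simp only: sq)
  ultimately have "(\<integral>y. sqrt (U 2 y) \<partial>N)\<^sup>2 \<le> c" by simp
  then show "(\<integral>y. sqrt (U 2 y) \<partial>N) \<le> sqrt c" by (rule real_le_rsqrt)
qed

text \<open>Instantiates \<open>uniform_poisson\<close> at the weight \<open>sqrt (U 2 w)\<close>, which is comparable to \<open>U 1 w\<close>: the drift
  is assumed for \<open>U 2\<close>, but the continuity of the kernels only for functions bounded by \<open>U 1\<close>. The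
  scalar function \<open>\<langle>\<theta> - \<theta>star, F \<theta> w\<rangle>\<close> is used instead of the vector \<open>F \<theta> w\<close>; it is Lipschitz in \<open>\<theta>\<close>
  because \<open>\<Theta>\<close> is bounded.\<close>

lemma model_poisson:
  fixes \<Theta> :: "'a::euclidean_space set" and \<W> :: "'b::euclidean_space set"
  assumes model: "model \<Theta> \<W> F P" and \<Theta>: "\<Theta> \<noteq> {}" "bounded \<Theta>"
    and erg: "ergodicity \<Theta> \<W> P" and cont: "kernel_continuity \<Theta> \<W> P" and growth: "growth \<Theta> \<W> F"
  obtains G C \<rho> b where "0 \<le> C" "0 \<le> \<rho>" "\<rho> < 1" "0 \<le> b"
    "\<And>\<theta> w. \<theta> \<in> \<Theta> \<Longrightarrow> w \<in> \<W> \<Longrightarrow> (\<integral>\<^sup>+y. ennreal (U 2 y) \<partial>P \<theta> w) \<le> ennreal (\<rho> * U 2 w + b)"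
    "(\<lambda>(\<theta>, w). G \<theta> w) \<in> borel_measurable (restrict_space borel \<Theta> \<Otimes>\<^sub>M restrict_space borel \<W>)"
    "\<And>\<theta> w. \<theta> \<in> \<Theta> \<Longrightarrow> w \<in> \<W> \<Longrightarrow> \<bar>G \<theta> w\<bar> \<le> C * sqrt (U 2 w)"
    "\<And>\<theta> \<theta>' w. \<theta> \<in> \<Theta> \<Longrightarrow> \<theta>' \<in> \<Theta> \<Longrightarrow> w \<in> \<W> \<Longrightarrow>
      \<bar>G \<theta> w - G \<theta>' w\<bar> \<le> C * sqrt (U 2 w) * norm (\<theta> - \<theta>')"
    "\<And>\<theta> w. \<theta> \<in> \<Theta> \<Longrightarrow> w \<in> \<W> \<Longrightarrow> G \<theta> w - (\<integral>y. G \<theta> y \<partial>P \<theta> w)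
      = (\<theta> - \<theta>star) \<bullet> F \<theta> w - (\<theta> - \<theta>star) \<bullet> mean_field \<W> F P \<theta>"
proof -
  let ?T = "restrict_space borel \<Theta> :: 'a measure" and ?S = "restrict_space borel \<W> :: 'b measure"
  define V where "V = (\<lambda>w :: 'b. sqrt (U 2 w))"
  have sp: "space ?T = \<Theta>" "space ?S = \<W>" by (simp_all add: space_restrict_space)
  have V_meas: "V \<in> borel_measurable ?S"
    unfolding V_def by (rule measurable_restrict_space1) measurable
  have V1: "1 \<le> V w" for w unfolding V_def by (rule sqrt_U_bounds)
  have norm_V: "1 + norm w \<le> 2 * V w" for w unfolding V_def by (rule sqrt_U_bounds)
  from erg obtain N A \<epsilon> \<phi> \<rho> b where
    A: "A \<noteq> {}" "A \<subseteq> \<W>" "A \<in> sets borel" and \<epsilon>: "\<epsilon> > 0"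
    and \<phi>: "\<phi> \<in> space (prob_algebra ?S)"
    and minor: "\<forall>\<theta>\<in>\<Theta>. \<forall>w\<in>A. \<forall>E\<in>sets ?S. measure (kernel_power ?S (P \<theta>) N w) E \<ge> \<epsilon> * measure \<phi> E"
    and \<rho>: "0 \<le> \<rho>" "\<rho> < 1" and b: "0 \<le> b"
    and drift: "\<forall>\<theta>\<in>\<Theta>. \<forall>w\<in>\<W>. (\<integral>\<^sup>+y. ennreal (U 2 y) \<partial>P \<theta> w) \<le> ennreal (\<rho> * U 2 w + b * indicat_real A w)"
    unfolding ergodicity_def by (elim conjE exE) blast
  from cont obtain L where L: "L > 0"
    and lip: "\<And>\<theta> \<theta>' w f. \<theta> \<in> \<Theta> \<Longrightarrow> \<theta>' \<in> \<Theta> \<Longrightarrow> w \<in> \<W> \<Longrightarrow> f \<in> borel_measurable ?S \<Longrightarrow>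
        (\<forall>y\<in>\<W>. \<bar>f y\<bar> \<le> U 1 y) \<Longrightarrow>
        \<bar>(\<integral>y. f y \<partial>P \<theta> w) - (\<integral>y. f y \<partial>P \<theta>' w)\<bar> \<le> L * U 1 w * norm (\<theta> - \<theta>')"
    unfolding kernel_continuity_def by blast
  from growth obtain LF CF where LC: "LF > 0" "CF > 0"
    and F_lip: "\<And>\<theta> \<theta>' w. \<theta> \<in> \<Theta> \<Longrightarrow> \<theta>' \<in> \<Theta> \<Longrightarrow> w \<in> \<W> \<Longrightarrow>
      norm (F \<theta> w - F \<theta>' w) \<le> LF * (1 + norm w) * norm (\<theta> - \<theta>')"
    and F_le: "\<And>\<theta> w. \<theta> \<in> \<Theta> \<Longrightarrow> w \<in> \<W> \<Longrightarrow> norm (F \<theta> w) \<le> CF * (1 + norm w)"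
    unfolding growth_def by blast
  obtain R where R: "0 \<le> R" "\<And>\<theta>. \<theta> \<in> \<Theta> \<Longrightarrow> norm (\<theta> - \<theta>star) \<le> R"
  proof -
    obtain r where r: "\<And>\<theta>. \<theta> \<in> \<Theta> \<Longrightarrow> norm \<theta> \<le> r" using \<Theta>(2) unfolding bounded_iff by blast
    have "0 \<le> r" using r \<Theta>(1) norm_ge_zero order_trans by blast
    moreover have "norm (\<theta> - \<theta>star) \<le> r + norm \<theta>star" if "\<theta> \<in> \<Theta>" for \<theta>
      using r[OF that] norm_triangle_ineq4[of \<theta> \<theta>star] by linarith
    ultimately show ?thesis by (intro that[of "r + norm \<theta>star"]) auto
  qed
  have kernel: "(\<lambda>(\<theta>, w). P \<theta> w) \<in> ?T \<Otimes>\<^sub>M ?S \<rightarrow>\<^sub>M prob_algebra ?S"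
    using model by (simp add: model_def)
  have P\<theta>: "P \<theta> \<in> ?S \<rightarrow>\<^sub>M prob_algebra ?S" if "\<theta> \<in> \<Theta>" for \<theta>
    by (rule measurable_section[OF kernel]) (simp add: sp that)
  have PD: "prob_space (P \<theta> w)" "sets (P \<theta> w) = sets ?S" if "\<theta> \<in> \<Theta>" "w \<in> \<W>" for \<theta> w
    using prob_kernelD[OF P\<theta>[OF that(1)], of w] that sp by auto
  have F_meas: "(\<lambda>(\<theta>, w). F \<theta> w) \<in> borel_measurable (?T \<Otimes>\<^sub>M ?S)"
    using model by (simp add: model_def)
  have c0: "0 \<le> \<rho> * U 2 w + b * indicat_real A w" for w
    using \<rho> b U_ge_1[of w] by (intro add_nonneg_nonneg mult_nonneg_nonneg) auto
  have int: "integrable (P \<theta> w) V" if "\<theta> \<in> \<Theta>" "w \<in> \<W>" for \<theta> w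
    unfolding V_def by (rule drift_sqrt(1)[OF PD[OF that] _ c0]) (use drift that in auto)
  have drift_V: "(\<integral>y. V y \<partial>P \<theta> w) \<le> sqrt \<rho> * V w + (sqrt b + 1) * indicator A w"
    if "\<theta> \<in> \<Theta>" "w \<in> \<W>" for \<theta> w
  proof -
    have "(\<integral>y. V y \<partial>P \<theta> w) \<le> sqrt (\<rho> * U 2 w + b * indicat_real A w)"
      unfolding V_def by (rule drift_sqrt(2)[OF PD[OF that] _ c0]) (use drift that in auto)
    also have "\<dots> \<le> sqrt (\<rho> * U 2 w) + sqrt (b * indicat_real A w)"
      using \<rho> b U_ge_1[of w] by (intro sqrt_add_le_add_sqrt) auto
    also have "\<dots> \<le> sqrt \<rho> * V w + (sqrt b + 1) * indicator A w"
      by (auto simp: V_def real_sqrt_mult indicator_def)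
    finally show ?thesis .
  qed
  define h where "h \<theta> w = (\<theta> - \<theta>star) \<bullet> F \<theta> w" for \<theta> w
  define H where "H = 2 * (R * CF + CF + R * LF)"
  have H: "0 \<le> H" using R LC by (simp add: H_def)
  have F_V: "norm (F \<theta> w) \<le> 2 * CF * V w" if "\<theta> \<in> \<Theta>" "w \<in> \<W>" for \<theta> w
  proof -
    have "CF * (1 + norm w) \<le> CF * (2 * V w)" using norm_V[of w] LC by (intro mult_left_mono) auto
    then show ?thesis using F_le[OF that] by simp
  qed
  have h_le: "\<bar>h \<theta> w\<bar> \<le> H * V w" if "\<theta> \<in> \<Theta>" "w \<in> \<W>" for \<theta> w
  proof -
    have "\<bar>h \<theta> w\<bar> \<le> norm (\<theta> - \<theta>star) * norm (F \<theta> w)" unfolding h_def by (rule Cauchy_Schwarz_ineq2)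
    also have "\<dots> \<le> R * (2 * CF * V w)" using R F_V[OF that] that by (intro mult_mono) auto
    also have "\<dots> \<le> H * V w"
      using R LC V1[of w] by (simp add: H_def algebra_simps)
    finally show ?thesis .
  qed
  have h_lip: "\<bar>h \<theta> w - h \<theta>' w\<bar> \<le> H * V w * norm (\<theta> - \<theta>')"
    if "\<theta> \<in> \<Theta>" "\<theta>' \<in> \<Theta>" "w \<in> \<W>" for \<theta> \<theta>' w
  proof -
    have "h \<theta> w - h \<theta>' w = (\<theta> - \<theta>') \<bullet> F \<theta> w + (\<theta>' - \<theta>star) \<bullet> (F \<theta> w - F \<theta>' w)"
      by (simp add: h_def algebra_simps)
    also have "\<bar>\<dots>\<bar> \<le> norm (\<theta> - \<theta>') * norm (F \<theta> w) + norm (\<theta>' - \<theta>star) * norm (F \<theta> w - F \<theta>' w)"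
      by (intro order_trans[OF abs_triangle_ineq] add_mono Cauchy_Schwarz_ineq2)
    also have "\<dots> \<le> norm (\<theta> - \<theta>') * (2 * CF * V w) + R * (LF * (2 * V w) * norm (\<theta> - \<theta>'))"
    proof (intro add_mono mult_mono R F_V that)
      have "LF * (1 + norm w) * norm (\<theta> - \<theta>') \<le> LF * (2 * V w) * norm (\<theta> - \<theta>')"
        using LC norm_V[of w] by (intro mult_right_mono mult_left_mono) auto
      then show "norm (F \<theta> w - F \<theta>' w) \<le> LF * (2 * V w) * norm (\<theta> - \<theta>')"
        using F_lip[OF that] by simp
    qed (use R in auto)
    also have "\<dots> = (2 * CF + 2 * R * LF) * V w * norm (\<theta> - \<theta>')" by (simp add: algebra_simps)
    also have "\<dots> \<le> H * V w * norm (\<theta> - \<theta>')"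
      using R LC V1[of w] by (intro mult_right_mono) (auto simp: H_def)
    finally show ?thesis .
  qed
  have h_meas: "(\<lambda>(\<theta>, w). h \<theta> w) \<in> borel_measurable (?T \<Otimes>\<^sub>M ?S)"
  proof -
    have "fst \<in> borel_measurable (?T \<Otimes>\<^sub>M ?S)"
      by (rule measurable_compose[OF measurable_fst measurable_restrict_space1[OF measurable_ident_sets[OF refl]]])
    then show ?thesis using F_meas unfolding h_def case_prod_beta' by measurable
  qed
  have A_S: "A \<in> sets ?S" using A by (auto simp: sets_restrict_space)
  have lip_V: "\<bar>kernel_op (P \<theta>) f w - kernel_op (P \<theta>') f w\<bar> \<le> (2 * L) * c * V w * norm (\<theta> - \<theta>')"
    if \<theta>: "\<theta> \<in> \<Theta>" "\<theta>' \<in> \<Theta>" and f: "f \<in> dominated ?S V" and le: "\<And>y. y \<in> \<W> \<Longrightarrow> \<bar>f y\<bar> \<le> c * V y"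
      and w: "w \<in> \<W>" for \<theta> \<theta>' f c w
  proof (cases "c \<le> 0")
    case True
    have f0: "f y = 0" if "y \<in> \<W>" for y
      using le[OF that] True V1[of y] mult_nonpos_nonneg[of c "V y"] by simp
    have "kernel_op (P \<theta>) f w = 0" "kernel_op (P \<theta>') f w = 0"
      unfolding kernel_op_def using f0 sets_eq_imp_space_eq[OF PD(2)[OF \<theta>(1) w]] sets_eq_imp_space_eq[OF PD(2)[OF \<theta>(2) w]]
      by (auto intro!: integral_eq_zero_AE AE_I2 simp: sp)
    moreover have "0 \<le> c"
      using le[OF w] V1[of w] abs_ge_zero[of "f w"] mult_neg_pos[of c "V w"] by linarith
    ultimately show ?thesis using L V1[of w] by simp
  next
    case False
    then have c: "0 < c" by simp
    have "\<bar>(\<integral>y. f y / c \<partial>P \<theta> w) - (\<integral>y. f y / c \<partial>P \<theta>' w)\<bar> \<le> L * U 1 w * norm (\<theta> - \<theta>')"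
    proof (rule lip[OF \<theta> w])
      show "(\<lambda>y. f y / c) \<in> borel_measurable ?S" using dominated_measurable[OF f] by measurable
      show "\<forall>y\<in>\<W>. \<bar>f y / c\<bar> \<le> U 1 y"
      proof
        fix y assume y: "y \<in> \<W>"
        have "\<bar>f y\<bar> \<le> c * U 1 y"
          by (rule order_trans[OF le[OF y]], unfold V_def, rule mult_left_mono[OF sqrt_U_bounds(3)])
            (use c in simp)
        then show "\<bar>f y / c\<bar> \<le> U 1 y" using c by (simp add: pos_divide_le_eq mult.commute)
      qed
    qed
    then have "\<bar>kernel_op (P \<theta>) f w - kernel_op (P \<theta>') f w\<bar> / c \<le> L * U 1 w * norm (\<theta> - \<theta>')"
      using c by (simp add: kernel_op_def diff_divide_distrib[symmetric])
    then have "\<bar>kernel_op (P \<theta>) f w - kernel_op (P \<theta>') f w\<bar> \<le> L * c * norm (\<theta> - \<theta>') * U 1 w"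
      using c by (simp add: pos_divide_le_eq mult_ac)
    also have "\<dots> \<le> L * c * norm (\<theta> - \<theta>') * (2 * V w)"
      using L c norm_V[of w] by (intro mult_left_mono) (auto simp: U_def)
    finally show ?thesis by (simp add: mult_ac)
  qed
  obtain G C where G: "0 \<le> C"
    "(\<lambda>(\<theta>, w). G \<theta> w) \<in> borel_measurable (?T \<Otimes>\<^sub>M ?S)"
    "\<And>\<theta> w. \<theta> \<in> \<Theta> \<Longrightarrow> w \<in> \<W> \<Longrightarrow> \<bar>G \<theta> w\<bar> \<le> C * V w"
    "\<And>\<theta> \<theta>' w. \<theta> \<in> \<Theta> \<Longrightarrow> \<theta>' \<in> \<Theta> \<Longrightarrow> w \<in> \<W> \<Longrightarrow>
      \<bar>G \<theta> w - G \<theta>' w\<bar> \<le> C * V w * norm (\<theta> - \<theta>')"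
    "\<And>\<theta> w. \<theta> \<in> \<Theta> \<Longrightarrow> w \<in> \<W> \<Longrightarrow>
      G \<theta> w - (\<integral>y. G \<theta> y \<partial>P \<theta> w) = h \<theta> w - (\<integral>y. h \<theta> y \<partial>the_stationary ?S (P \<theta>))"
    and stat: "\<And>\<theta>. \<theta> \<in> \<Theta> \<Longrightarrow> sets (the_stationary ?S (P \<theta>)) = sets ?S"
      "\<And>\<theta>. \<theta> \<in> \<Theta> \<Longrightarrow> integrable (the_stationary ?S (P \<theta>)) V"
  proof (rule uniform_poisson[where Q = P and T = ?T and S = ?S and V = V and \<rho> = "sqrt \<rho>" and b = "sqrt b + 1"
        and \<epsilon> = \<epsilon> and L = "2 * L" and H = H and A = A and \<phi> = \<phi> and N = N and h = h, unfolded sp])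
    show "0 \<le> sqrt \<rho>" "sqrt \<rho> < 1" using \<rho> by auto
    show "0 < sqrt b + 1" using b by (simp add: add_nonneg_pos)
  qed (use kernel \<Theta> V_meas V1 int drift_V \<epsilon> L H A_S A(1) \<phi> minor lip_V h_meas h_le h_lip in auto)
  have mean: "(\<integral>y. h \<theta> y \<partial>the_stationary ?S (P \<theta>)) = (\<theta> - \<theta>star) \<bullet> mean_field \<W> F P \<theta>" if \<theta>: "\<theta> \<in> \<Theta>" for \<theta>
  proof -
    let ?\<nu> = "the_stationary ?S (P \<theta>)"
    have "integrable ?\<nu> (F \<theta>)"
    proof (rule Bochner_Integration.integrable_bound)
      show "integrable ?\<nu> (\<lambda>w. 2 * CF * V w)" using stat(2)[OF \<theta>] by simp
      have "F \<theta> \<in> borel_measurable ?S" by (rule measurable_section[OF F_meas]) (simp add: sp \<theta>)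
      then show "F \<theta> \<in> borel_measurable ?\<nu>" using stat(1)[OF \<theta>] by (simp cong: measurable_cong_sets)
      show "AE w in ?\<nu>. norm (F \<theta> w) \<le> norm (2 * CF * V w)"
        using F_V[OF \<theta>] sets_eq_imp_space_eq[OF stat(1)[OF \<theta>]] by (intro AE_I2) (force simp: sp)
    qed
    then show ?thesis unfolding h_def mean_field_def by (intro integral_inner_right)
  qed
  show ?thesis
  proof (rule that[of C \<rho> b G])
    show "(\<integral>\<^sup>+y. ennreal (U 2 y) \<partial>P \<theta> w) \<le> ennreal (\<rho> * U 2 w + b)" if "\<theta> \<in> \<Theta>" "w \<in> \<W>" for \<theta> w
    proof -
      have "\<rho> * U 2 w + b * indicat_real A w \<le> \<rho> * U 2 w + b" using b by (simp add: indicator_def)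
      then show ?thesis using drift that by (meson ennreal_leI order_trans)
    qed
    show "G \<theta> w - (\<integral>y. G \<theta> y \<partial>P \<theta> w) = (\<theta> - \<theta>star) \<bullet> F \<theta> w - (\<theta> - \<theta>star) \<bullet> mean_field \<W> F P \<theta>"
      if "\<theta> \<in> \<Theta>" "w \<in> \<W>" for \<theta> w
      using G(5)[OF that] mean[OF that(1)] by (simp add: h_def)
  qed (use G \<rho> b in \<open>auto simp: V_def\<close>)
qed

section \<open>The error recursion\<close>

text \<open>Test the hypothesis on the event where the inequality fails.\<close>

lemma (in sigma_finite_subalgebra) real_cond_exp_le_of_set_integrals:
  assumes X: "integrable M X" and Y: "integrable M Y" "Y \<in> borel_measurable F"
    and le: "\<And>A. A \<in> sets F \<Longrightarrow> (\<integral>x. indicator A x * X x \<partial>M) \<le> (\<integral>x. indicator A x * Y x \<partial>M)"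
  shows "AE x in M. real_cond_exp M F X x \<le> Y x"
proof -
  let ?Z = "real_cond_exp M F X"
  define A where "A = {x \<in> space M. Y x < ?Z x}"
  have spF: "space F = space M" using subalg by (simp add: subalgebra_def)
  have A: "A \<in> sets F"
  proof -
    have "{x \<in> space F. Y x < ?Z x} \<in> sets F"
      using Y(2) by measurable
    then show ?thesis by (simp add: A_def spF)
  qed
  have AM: "A \<in> sets M" using A subalg by (auto simp: subalgebra_def)
  have Z: "integrable M ?Z" by (rule real_cond_exp_int(1)[OF X])
  have intA: "integrable M (\<lambda>x. indicator A x * f x)" if "integrable M f" for f :: "'a \<Rightarrow> real"
    using integrable_mult_indicator[OF AM that] by simp
  have nn: "0 \<le> indicator A x * (?Z x - Y x)" for x by (simp add: A_def indicator_def)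
  have "(\<integral>x. indicator A x * ?Z x \<partial>M) = (\<integral>x. indicator A x * X x \<partial>M)"
    using real_cond_exp_intA[OF X A] by (simp add: set_lebesgue_integral_def)
  then have "(\<integral>x. indicator A x * (?Z x - Y x) \<partial>M) \<le> 0"
    using le[OF A] intA[OF Z] intA[OF Y(1)] by (simp add: right_diff_distrib)
  moreover have "0 \<le> (\<integral>x. indicator A x * (?Z x - Y x) \<partial>M)"
    by (rule Bochner_Integration.integral_nonneg) (rule nn)
  ultimately have "(\<integral>x. indicator A x * (?Z x - Y x) \<partial>M) = 0" by simp
  then have "AE x in M. indicator A x * (?Z x - Y x) = 0"
    using integral_nonneg_eq_0_iff_AE[OF intA[OF Bochner_Integration.integrable_diff[OF Z Y(1)]]] nn by simp
  then show ?thesis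
    using AE_space by eventually_elim (auto simp: A_def indicator_def split: if_splits)
qed

lemma project_step_le:
  fixes x v :: "'a::euclidean_space"
  assumes \<Theta>: "closed \<Theta>" "convex \<Theta>" "x \<in> \<Theta>" "z \<in> \<Theta>" and a: "0 \<le> a"
  shows "(norm (closest_point \<Theta> (x + a *\<^sub>R v) - z))\<^sup>2
      \<le> (norm (x - z))\<^sup>2 + 2 * a * ((x - z) \<bullet> v) + a\<^sup>2 * (norm v)\<^sup>2"
    and "norm (closest_point \<Theta> (x + a *\<^sub>R v) - x) \<le> a * norm v"
proof -
  have ne: "\<Theta> \<noteq> {}" using \<Theta> by auto
  have expand: "(norm (y + a *\<^sub>R v))\<^sup>2 = (norm y)\<^sup>2 + 2 * a * (y \<bullet> v) + a\<^sup>2 * (norm v)\<^sup>2" for y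
    unfolding power2_norm_eq_inner
    by (simp add: inner_add_left inner_add_right inner_commute[of v y] power2_eq_square distrib_left)
  have lip: "norm (closest_point \<Theta> y - w) \<le> norm (y - w)" if "w \<in> \<Theta>" for y w
    using closest_point_lipschitz[OF \<Theta>(2,1) ne, of y w] closest_point_self[OF that] by (simp add: dist_norm)
  have "(norm (closest_point \<Theta> (x + a *\<^sub>R v) - z))\<^sup>2 \<le> (norm ((x - z) + a *\<^sub>R v))\<^sup>2"
    using lip[OF \<Theta>(4), of "x + a *\<^sub>R v"] by (intro power_mono) (auto simp: algebra_simps)
  also have "\<dots> = (norm (x - z))\<^sup>2 + 2 * a * ((x - z) \<bullet> v) + a\<^sup>2 * (norm v)\<^sup>2"
    by (rule expand)
  finally show "(norm (closest_point \<Theta> (x + a *\<^sub>R v) - z))\<^sup>2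
      \<le> (norm (x - z))\<^sup>2 + 2 * a * ((x - z) \<bullet> v) + a\<^sup>2 * (norm v)\<^sup>2" .
  show "norm (closest_point \<Theta> (x + a *\<^sub>R v) - x) \<le> a * norm v"
    using lip[OF \<Theta>(3), of "x + a *\<^sub>R v"] a by simp
qed

context adaptive_chain
begin

lemma markov_real_nonneg:
  fixes g :: "'a \<times> 'b \<Rightarrow> real"
  assumes A: "A \<in> sets (history M \<theta> W 0)"
    and g: "g \<in> borel_measurable (T \<Otimes>\<^sub>M S)" "\<And>x w. x \<in> \<Theta> \<Longrightarrow> w \<in> \<W> \<Longrightarrow> 0 \<le> g (x, w)"
    and int: "integrable M (\<lambda>\<omega>. indicator A \<omega> * g (\<theta> k \<omega>, W (Suc k) \<omega>))"
    and kint: "\<And>\<omega>. \<omega> \<in> space M \<Longrightarrow> integrable (P (\<theta> k \<omega>) (W k \<omega>)) (\<lambda>y. g (\<theta> k \<omega>, y))"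
  shows "integrable M (\<lambda>\<omega>. indicator A \<omega> * (\<integral>y. g (\<theta> k \<omega>, y) \<partial>P (\<theta> k \<omega>) (W k \<omega>))) \<and>
    (\<integral>\<omega>. indicator A \<omega> * (\<integral>y. g (\<theta> k \<omega>, y) \<partial>P (\<theta> k \<omega>) (W k \<omega>)) \<partial>M)
      = (\<integral>\<omega>. indicator A \<omega> * g (\<theta> k \<omega>, W (Suc k) \<omega>) \<partial>M)" (is "integrable M ?R \<and> _ = integral\<^sup>L M ?L")
proof -
  have [measurable]: "A \<in> sets M" using A history_subalgebra[of 0] by (auto simp: subalgebra_def)
  have pos: "0 \<le> ?L \<omega>" "0 \<le> ?R \<omega>" if "\<omega> \<in> space M" for \<omega>
  proof -
    have ind: "0 \<le> indicat_real A \<omega>" by simp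
    have "0 \<le> g (\<theta> k \<omega>, W (Suc k) \<omega>)" by (rule g(2)) (rule process_in[OF that])+
    then show "0 \<le> ?L \<omega>" using ind by (rule mult_nonneg_nonneg[rotated])
    have "0 \<le> (\<integral>y. g (\<theta> k \<omega>, y) \<partial>P (\<theta> k \<omega>) (W k \<omega>))"
    proof (rule Bochner_Integration.integral_nonneg)
      fix y assume "y \<in> space (P (\<theta> k \<omega>) (W k \<omega>))"
      then show "0 \<le> g (\<theta> k \<omega>, y)"
        unfolding process_kernelD(3)[OF that] by (rule g(2)[OF process_in(1)[OF that]])
    qed
    then show "0 \<le> ?R \<omega>" using ind by (rule mult_nonneg_nonneg[rotated])
  qed
  have gm: "(\<lambda>(x, w). kernel_op (P x) (\<lambda>y. g (x, y)) w) \<in> borel_measurable (T \<Otimes>\<^sub>M S)"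
    by (rule kernel_op_measurable2[OF kernel]) (use g(1) in simp)
  have [measurable]: "(\<lambda>\<omega>. \<integral>y. g (\<theta> k \<omega>, y) \<partial>P (\<theta> k \<omega>) (W k \<omega>)) \<in> borel_measurable M"
    using measurable_compose[OF measurable_Pair[OF process_measurable] gm] by (simp add: kernel_op_def)
  have "(\<integral>\<^sup>+\<omega>. ennreal (?R \<omega>) \<partial>M)
      = (\<integral>\<^sup>+\<omega>. indicator A \<omega> * (\<integral>\<^sup>+y. ennreal (g (\<theta> k \<omega>, y)) \<partial>P (\<theta> k \<omega>) (W k \<omega>)) \<partial>M)"
  proof (rule nn_integral_cong)
    fix \<omega> assume \<omega>: "\<omega> \<in> space M"
    have "(\<integral>\<^sup>+y. ennreal (g (\<theta> k \<omega>, y)) \<partial>P (\<theta> k \<omega>) (W k \<omega>))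
        = ennreal (\<integral>y. g (\<theta> k \<omega>, y) \<partial>P (\<theta> k \<omega>) (W k \<omega>))"
      by (rule nn_integral_eq_integral[OF kint[OF \<omega>]])
         (use g(2) process_in[OF \<omega>] process_kernelD(3)[OF \<omega>] in auto)
    then show "ennreal (?R \<omega>) = indicator A \<omega> * (\<integral>\<^sup>+y. ennreal (g (\<theta> k \<omega>, y)) \<partial>P (\<theta> k \<omega>) (W k \<omega>))"
      by (simp add: indicator_def)
  qed
  also have "\<dots> = (\<integral>\<^sup>+\<omega>. indicator A \<omega> * ennreal (g (\<theta> k \<omega>, W (Suc k) \<omega>)) \<partial>M)"
    by (rule markov_nn[OF A, symmetric]) (use g(1) in simp)
  also have "\<dots> = (\<integral>\<^sup>+\<omega>. ennreal (?L \<omega>) \<partial>M)"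
    by (rule nn_integral_cong) (simp add: indicator_def)
  also have "\<dots> = ennreal (integral\<^sup>L M ?L)"
    by (rule nn_integral_eq_integral[OF int]) (use pos in auto)
  finally show ?thesis
    using pos by (subst (asm) nn_integral_eq_integrable) (auto intro!: Bochner_Integration.integral_nonneg)
qed

context
  fixes A and \<rho> b :: real
  assumes A: "A \<in> sets (history M \<theta> W 0)"
    and params: "0 \<le> \<rho>" "\<rho> < 1" "0 \<le> b"
    and drift: "\<And>x w. x \<in> \<Theta> \<Longrightarrow> w \<in> \<W> \<Longrightarrow> (\<integral>\<^sup>+y. ennreal (U 2 y) \<partial>P x w) \<le> ennreal (\<rho> * U 2 w + b)"
    and W0: "integrable M (\<lambda>\<omega>. U 2 (W 0 \<omega>))"
begin

text \<open>Conditional expectations given the initial state are tested on the events \<open>A\<close> of the initial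
  \<open>\<sigma>\<close>-algebra.\<close>

definition mean_on :: "('w \<Rightarrow> real) \<Rightarrow> real" where
  "mean_on X = (\<integral>\<omega>. indicator A \<omega> * X \<omega> \<partial>M)"

lemma A_sets [measurable]: "A \<in> sets M"
  using A history_subalgebra[of 0] by (auto simp: subalgebra_def)

lemma U_S [measurable]: "U p \<in> borel_measurable S"
  by (rule measurable_restrict_space1) measurable

lemma U_kernel_integrable:
  assumes "x \<in> \<Theta>" "w \<in> \<W>"
  shows "integrable (P x w) (U 2)"
proof (rule integrable_of_nn_integral_le)
  have "P x \<in> S \<rightarrow>\<^sub>M prob_algebra S" by (rule measurable_section[OF kernel]) (simp add: assms)
  from prob_kernelD(1)[OF this, of w] have "sets (P x w) = sets S" using assms by simp
  then show "U 2 \<in> borel_measurable (P x w)" using U_S by (simp cong: measurable_cong_sets)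
  show "(\<integral>\<^sup>+y. ennreal \<bar>U 2 y\<bar> \<partial>P x w) \<le> ennreal (\<rho> * U 2 w + b)"
    using drift[OF assms] by (simp add: U_def)
qed

text \<open>The factor is preserved by one step of the drift: the constant \<open>b\<close> is charged to the initial
  weight, which is at least \<open>1\<close>.\<close>

lemma second_moment:
  "integrable M (\<lambda>\<omega>. indicator A \<omega> * U 2 (W k \<omega>))"
  "mean_on (\<lambda>\<omega>. U 2 (W k \<omega>)) \<le> (1 + b / (1 - \<rho>)) * mean_on (\<lambda>\<omega>. U 2 (W 0 \<omega>))"
proof -
  let ?u = "mean_on (\<lambda>\<omega>. U 2 (W 0 \<omega>))" and ?\<kappa> = "1 + b / (1 - \<rho>)"
  have int0: "integrable M (\<lambda>\<omega>. indicator A \<omega> * U 2 (W 0 \<omega>))"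
    using integrable_mult_indicator[OF A_sets W0] by simp
  have U0: "0 \<le> U 2 w" for w :: 'b using U_ge_1[of w] by simp
  have u0: "0 \<le> ?u" unfolding mean_on_def by (rule Bochner_Integration.integral_nonneg) (simp add: U0)
  have \<kappa>: "0 \<le> ?\<kappa>" using params by simp
  have PA: "emeasure M A \<le> ennreal ?u"
  proof -
    have "measure M A = (\<integral>\<omega>. indicator A \<omega> \<partial>M)" by simp
    also have "\<dots> \<le> ?u"
      unfolding mean_on_def
    proof (rule integral_mono[OF _ int0])
      show "integrable M (indicat_real A)" by (simp add: emeasure_eq_measure)
      show "indicat_real A \<omega> \<le> indicator A \<omega> * U 2 (W 0 \<omega>)" for \<omega>
        using U_ge_1[of "W 0 \<omega>"] by (simp add: indicator_def)
    qed
    finally show ?thesis by (simp add: emeasure_eq_measure ennreal_leI)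
  qed
  have claim: "(\<integral>\<^sup>+\<omega>. indicator A \<omega> * ennreal (U 2 (W k \<omega>)) \<partial>M) \<le> ennreal (?\<kappa> * ?u)" for k
  proof (induction k)
    case 0
    have "(\<integral>\<^sup>+\<omega>. indicator A \<omega> * ennreal (U 2 (W 0 \<omega>)) \<partial>M)
        = (\<integral>\<^sup>+\<omega>. ennreal (indicator A \<omega> * U 2 (W 0 \<omega>)) \<partial>M)"
      by (rule nn_integral_cong) (simp add: indicator_def)
    also have "\<dots> = ennreal ?u"
      unfolding mean_on_def by (rule nn_integral_eq_integral[OF int0]) (simp add: U0)
    also have "\<dots> \<le> ennreal (?\<kappa> * ?u)"
      using params u0 mult_right_mono[of 1 ?\<kappa> ?u] by (intro ennreal_leI) auto
    finally show ?case .
  next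
    case (Suc k)
    have "(\<integral>\<^sup>+\<omega>. indicator A \<omega> * ennreal (U 2 (W (Suc k) \<omega>)) \<partial>M)
        = (\<integral>\<^sup>+\<omega>. indicator A \<omega> * (\<integral>\<^sup>+y. ennreal (U 2 y) \<partial>P (\<theta> k \<omega>) (W k \<omega>)) \<partial>M)"
      using markov_nn[OF A, of "\<lambda>z. ennreal (U 2 (snd z))" k] by simp
    also have "\<dots> \<le> (\<integral>\<^sup>+\<omega>. ennreal \<rho> * (indicator A \<omega> * ennreal (U 2 (W k \<omega>))) + ennreal b * indicator A \<omega> \<partial>M)"
    proof (rule nn_integral_mono)
      fix \<omega> assume \<omega>: "\<omega> \<in> space M"
      have "(\<integral>\<^sup>+y. ennreal (U 2 y) \<partial>P (\<theta> k \<omega>) (W k \<omega>)) \<le> ennreal \<rho> * ennreal (U 2 (W k \<omega>)) + ennreal b"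
        using drift[OF process_in[OF \<omega>]] params U0
        by (simp add: ennreal_mult'[symmetric] ennreal_plus[symmetric] del: ennreal_plus)
      then show "indicator A \<omega> * (\<integral>\<^sup>+y. ennreal (U 2 y) \<partial>P (\<theta> k \<omega>) (W k \<omega>))
          \<le> ennreal \<rho> * (indicator A \<omega> * ennreal (U 2 (W k \<omega>))) + ennreal b * indicator A \<omega>"
        by (simp add: indicator_def)
    qed
    also have "\<dots> = ennreal \<rho> * (\<integral>\<^sup>+\<omega>. indicator A \<omega> * ennreal (U 2 (W k \<omega>)) \<partial>M) + ennreal b * emeasure M A"
    proof -
      have [measurable]: "(\<lambda>\<omega>. U 2 (W k \<omega>)) \<in> borel_measurable M"
        by (rule measurable_compose[OF process_measurable(2) U_S])
      show ?thesis by (simp add: nn_integral_add nn_integral_cmult)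
    qed
    also have "\<dots> \<le> ennreal \<rho> * ennreal (?\<kappa> * ?u) + ennreal b * ennreal ?u"
      by (intro add_mono mult_left_mono Suc PA) auto
    also have "\<dots> = ennreal (\<rho> * (?\<kappa> * ?u) + b * ?u)"
      using params \<kappa> u0 by (simp add: ennreal_mult[symmetric] ennreal_plus[symmetric] del: ennreal_plus)
    also have "\<dots> \<le> ennreal (?\<kappa> * ?u)"
    proof (rule ennreal_leI)
      have "b / (1 - \<rho>) * (1 - \<rho>) = b" using params by simp
      moreover have "\<rho> * (1 + c) + c * (1 - \<rho>) = (1 + c) - (1 - \<rho>)" for c by (simp add: algebra_simps)
      ultimately have "\<rho> * ?\<kappa> + b = ?\<kappa> - (1 - \<rho>)" by metis
      then have "\<rho> * ?\<kappa> + b \<le> ?\<kappa>" using params by simp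
      from mult_right_mono[OF this u0] show "\<rho> * (?\<kappa> * ?u) + b * ?u \<le> ?\<kappa> * ?u" by (simp add: algebra_simps)
    qed
    finally show ?case .
  qed
  have nn: "(\<integral>\<^sup>+\<omega>. ennreal (indicator A \<omega> * U 2 (W k \<omega>)) \<partial>M) \<le> ennreal (?\<kappa> * ?u)"
  proof -
    have "(\<integral>\<^sup>+\<omega>. ennreal (indicator A \<omega> * U 2 (W k \<omega>)) \<partial>M) = (\<integral>\<^sup>+\<omega>. indicator A \<omega> * ennreal (U 2 (W k \<omega>)) \<partial>M)"
      by (rule nn_integral_cong) (simp add: indicator_def)
    then show ?thesis using claim[of k] by simp
  qed
  have [measurable]: "(\<lambda>\<omega>. U 2 (W k \<omega>)) \<in> borel_measurable M"
    by (rule measurable_compose[OF process_measurable(2) U_S])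
  show int: "integrable M (\<lambda>\<omega>. indicator A \<omega> * U 2 (W k \<omega>))"
    by (rule integrable_of_nn_integral_le[where c = "?\<kappa> * ?u"]) (use nn U0 in \<open>simp_all add: abs_mult\<close>)
  have "ennreal (mean_on (\<lambda>\<omega>. U 2 (W k \<omega>))) = (\<integral>\<^sup>+\<omega>. ennreal (indicator A \<omega> * U 2 (W k \<omega>)) \<partial>M)"
    unfolding mean_on_def by (rule nn_integral_eq_integral[symmetric, OF int]) (simp add: U0)
  also note nn
  finally show "mean_on (\<lambda>\<omega>. U 2 (W k \<omega>)) \<le> ?\<kappa> * ?u"
    using \<kappa> u0 by (metis ennreal_le_iff mult_nonneg_nonneg)
qed

lemma mean_on_dominated:
  assumes X: "X \<in> borel_measurable M" and le: "\<And>\<omega>. \<omega> \<in> space M \<Longrightarrow> \<bar>X \<omega>\<bar> \<le> Y \<omega>"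
    and Y: "integrable M (\<lambda>\<omega>. indicator A \<omega> * Y \<omega>)"
  shows "integrable M (\<lambda>\<omega>. indicator A \<omega> * X \<omega>)" "\<bar>mean_on X\<bar> \<le> mean_on Y"
proof -
  show int: "integrable M (\<lambda>\<omega>. indicator A \<omega> * X \<omega>)"
  proof (rule Bochner_Integration.integrable_bound[OF Y])
    show "AE \<omega> in M. norm (indicator A \<omega> * X \<omega>) \<le> norm (indicator A \<omega> * Y \<omega>)"
      by (rule AE_I2) (use order_trans[OF le abs_ge_self] in \<open>simp add: indicator_def\<close>)
  qed (use X in measurable)
  have "\<bar>mean_on X\<bar> \<le> (\<integral>\<omega>. \<bar>indicator A \<omega> * X \<omega>\<bar> \<partial>M)" unfolding mean_on_def by (rule integral_abs_bound)
  also have "\<dots> \<le> mean_on Y"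
    unfolding mean_on_def by (rule integral_mono[OF integrable_abs[OF int] Y]) (use le in \<open>simp add: indicator_def\<close>)
  finally show "\<bar>mean_on X\<bar> \<le> mean_on Y" .
qed

text \<open>Adding a multiple of \<open>U 2\<close> reduces the claim to nonnegative functions.\<close>

lemma markov_real:
  fixes g :: "'a \<Rightarrow> 'b \<Rightarrow> real"
  assumes g: "(\<lambda>(x, w). g x w) \<in> borel_measurable (T \<Otimes>\<^sub>M S)"
    and le: "\<And>x w. x \<in> \<Theta> \<Longrightarrow> w \<in> \<W> \<Longrightarrow> \<bar>g x w\<bar> \<le> c * U 2 w"
  shows "integrable M (\<lambda>\<omega>. indicator A \<omega> * (\<integral>y. g (\<theta> k \<omega>) y \<partial>P (\<theta> k \<omega>) (W k \<omega>)))"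
    "mean_on (\<lambda>\<omega>. \<integral>y. g (\<theta> k \<omega>) y \<partial>P (\<theta> k \<omega>) (W k \<omega>)) = mean_on (\<lambda>\<omega>. g (\<theta> k \<omega>) (W (Suc k) \<omega>))"
proof -
  \<comment> \<open>g is the difference of two nonnegative functions, g1 and g2.\<close>
  define g1 where "g1 = (\<lambda>(x, w). g x w + c * U 2 w)"
  define g2 where "g2 = (\<lambda>(x :: 'a, w :: 'b). c * U 2 w :: real)"
  have meas2: "g2 \<in> borel_measurable (T \<Otimes>\<^sub>M S)" unfolding g2_def by measurable
  have meas1: "g1 \<in> borel_measurable (T \<Otimes>\<^sub>M S)"
    using borel_measurable_add[OF g meas2] by (simp add: g1_def g2_def case_prod_beta')
  have gk: "(\<lambda>\<omega>. g (\<theta> k \<omega>) (W (Suc k) \<omega>)) \<in> borel_measurable M"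
    using measurable_compose[OF measurable_Pair[OF process_measurable(1)[of k] process_measurable(2)[of "Suc k"]] g] by simp
  have int2: "integrable M (\<lambda>\<omega>. indicator A \<omega> * (c * U 2 (W (Suc k) \<omega>)))"
    using integrable_mult_right[OF second_moment(1), of c "Suc k"] by (simp add: mult_ac)
  have intg: "integrable M (\<lambda>\<omega>. indicator A \<omega> * g (\<theta> k \<omega>) (W (Suc k) \<omega>))"
    by (rule mean_on_dominated(1)[OF gk _ int2]) (use le process_in in auto)
  have k2: "integrable (P (\<theta> k \<omega>) (W k \<omega>)) (\<lambda>y. c * U 2 y)" if "\<omega> \<in> space M" for \<omega>
    using U_kernel_integrable[OF process_in[OF that]] by simp
  have kg: "integrable (P (\<theta> k \<omega>) (W k \<omega>)) (\<lambda>y. g (\<theta> k \<omega>) y)" if \<omega>: "\<omega> \<in> space M" for \<omega>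
  proof (rule Bochner_Integration.integrable_bound[OF k2[OF \<omega>]])
    have "g (\<theta> k \<omega>) \<in> borel_measurable S" by (rule measurable_section[OF g]) (use process_in(1)[OF \<omega>] in simp)
    then show "g (\<theta> k \<omega>) \<in> borel_measurable (P (\<theta> k \<omega>) (W k \<omega>))"
      using process_kernelD(2)[OF \<omega>] by (simp cong: measurable_cong_sets)
    show "AE y in P (\<theta> k \<omega>) (W k \<omega>). norm (g (\<theta> k \<omega>) y) \<le> norm (c * U 2 y)"
    proof (rule AE_I2)
      fix y assume "y \<in> space (P (\<theta> k \<omega>) (W k \<omega>))"
      then have "y \<in> \<W>" unfolding process_kernelD(3)[OF \<omega>] .
      from le[OF process_in(1)[OF \<omega>] this, of k] show "norm (g (\<theta> k \<omega>) y) \<le> norm (c * U 2 y)"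
        unfolding real_norm_def by linarith
    qed
  qed
  have r1: "integrable M (\<lambda>\<omega>. indicator A \<omega> * (\<integral>y. g1 (\<theta> k \<omega>, y) \<partial>P (\<theta> k \<omega>) (W k \<omega>))) \<and>
    mean_on (\<lambda>\<omega>. \<integral>y. g1 (\<theta> k \<omega>, y) \<partial>P (\<theta> k \<omega>) (W k \<omega>)) = mean_on (\<lambda>\<omega>. g1 (\<theta> k \<omega>, W (Suc k) \<omega>))"
    unfolding mean_on_def
  proof (rule markov_real_nonneg[OF A meas1])
    show "0 \<le> g1 (x, w)" if "x \<in> \<Theta>" "w \<in> \<W>" for x w
      using le[OF that] by (simp add: g1_def abs_le_iff)
    show "integrable M (\<lambda>\<omega>. indicator A \<omega> * g1 (\<theta> k \<omega>, W (Suc k) \<omega>))"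
      using Bochner_Integration.integrable_add[OF intg int2] by (simp add: g1_def distrib_left)
    show "integrable (P (\<theta> k \<omega>) (W k \<omega>)) (\<lambda>y. g1 (\<theta> k \<omega>, y))" if "\<omega> \<in> space M" for \<omega>
      using Bochner_Integration.integrable_add[OF kg[OF that] k2[OF that]] by (simp add: g1_def)
  qed
  have r2: "integrable M (\<lambda>\<omega>. indicator A \<omega> * (\<integral>y. g2 (\<theta> k \<omega>, y) \<partial>P (\<theta> k \<omega>) (W k \<omega>))) \<and>
    mean_on (\<lambda>\<omega>. \<integral>y. g2 (\<theta> k \<omega>, y) \<partial>P (\<theta> k \<omega>) (W k \<omega>)) = mean_on (\<lambda>\<omega>. g2 (\<theta> k \<omega>, W (Suc k) \<omega>))"
    unfolding mean_on_def
  proof (rule markov_real_nonneg[OF A meas2])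
    show "0 \<le> g2 (x, w)" if "x \<in> \<Theta>" "w \<in> \<W>" for x w
      using order_trans[OF abs_ge_zero le[OF that]] by (simp add: g2_def)
    show "integrable M (\<lambda>\<omega>. indicator A \<omega> * g2 (\<theta> k \<omega>, W (Suc k) \<omega>))"
      using int2 by (simp add: g2_def)
    show "integrable (P (\<theta> k \<omega>) (W k \<omega>)) (\<lambda>y. g2 (\<theta> k \<omega>, y))" if "\<omega> \<in> space M" for \<omega>
      using k2[OF that] by (simp add: g2_def)
  qed
  have dec: "indicator A \<omega> * (\<integral>y. g (\<theta> k \<omega>) y \<partial>P (\<theta> k \<omega>) (W k \<omega>))
      = indicator A \<omega> * (\<integral>y. g1 (\<theta> k \<omega>, y) \<partial>P (\<theta> k \<omega>) (W k \<omega>))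
        - indicator A \<omega> * (\<integral>y. g2 (\<theta> k \<omega>, y) \<partial>P (\<theta> k \<omega>) (W k \<omega>))" if "\<omega> \<in> space M" for \<omega>
    using Bochner_Integration.integral_add[OF kg[OF that] k2[OF that]]
    by (simp add: g1_def g2_def right_diff_distrib[symmetric])
  have "integrable M (\<lambda>\<omega>. indicator A \<omega> * (\<integral>y. g1 (\<theta> k \<omega>, y) \<partial>P (\<theta> k \<omega>) (W k \<omega>))
        - indicator A \<omega> * (\<integral>y. g2 (\<theta> k \<omega>, y) \<partial>P (\<theta> k \<omega>) (W k \<omega>)))"
    using r1 r2 by (intro Bochner_Integration.integrable_diff) auto
  then show "integrable M (\<lambda>\<omega>. indicator A \<omega> * (\<integral>y. g (\<theta> k \<omega>) y \<partial>P (\<theta> k \<omega>) (W k \<omega>)))"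
    by (subst Bochner_Integration.integrable_cong[OF refl dec])
  have "mean_on (\<lambda>\<omega>. \<integral>y. g (\<theta> k \<omega>) y \<partial>P (\<theta> k \<omega>) (W k \<omega>))
      = (\<integral>\<omega>. indicator A \<omega> * (\<integral>y. g1 (\<theta> k \<omega>, y) \<partial>P (\<theta> k \<omega>) (W k \<omega>))
        - indicator A \<omega> * (\<integral>y. g2 (\<theta> k \<omega>, y) \<partial>P (\<theta> k \<omega>) (W k \<omega>)) \<partial>M)"
    unfolding mean_on_def by (rule Bochner_Integration.integral_cong[OF refl dec])
  also have "\<dots> = mean_on (\<lambda>\<omega>. g1 (\<theta> k \<omega>, W (Suc k) \<omega>)) - mean_on (\<lambda>\<omega>. g2 (\<theta> k \<omega>, W (Suc k) \<omega>))"
    using r1 r2 by (simp add: mean_on_def)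
  also have "\<dots> = mean_on (\<lambda>\<omega>. g (\<theta> k \<omega>) (W (Suc k) \<omega>))"
    using Bochner_Integration.integral_add[OF intg int2] by (simp add: mean_on_def g1_def g2_def distrib_left)
  finally show "mean_on (\<lambda>\<omega>. \<integral>y. g (\<theta> k \<omega>) y \<partial>P (\<theta> k \<omega>) (W k \<omega>)) = mean_on (\<lambda>\<omega>. g (\<theta> k \<omega>) (W (Suc k) \<omega>))" .
qed


text \<open>By the Poisson equation the noise in one step is \<open>G \<theta>\<^sub>k W\<^sub>k\<close> minus the kernel applied to \<open>G \<theta>\<^sub>k\<close>, and
  the Markov property turns the latter into \<open>G \<theta>\<^sub>k W\<^sub>k\<^sub>+\<^sub>1\<close> in mean. Moving the parameter to \<open>\<theta>\<^sub>k\<^sub>+\<^sub>1\<close> costs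
  \<open>\<alpha>\<^sub>k\<close> times a product of two weights, at consecutive times, which is bounded by second moments.\<close>

lemma error_recursion:
  fixes G :: "'a \<Rightarrow> 'b \<Rightarrow> real"
  assumes \<Theta>: "compact \<Theta>" "convex \<Theta>" "z \<in> \<Theta>" and \<alpha>: "0 \<le> \<alpha> k" and C: "0 \<le> C" "0 \<le> CF"
    and F_le: "\<And>x w. x \<in> \<Theta> \<Longrightarrow> w \<in> \<W> \<Longrightarrow> norm (F x w) \<le> CF * (1 + norm w)"
    and G: "(\<lambda>(x, w). G x w) \<in> borel_measurable (T \<Otimes>\<^sub>M S)"
    and G_le: "\<And>x w. x \<in> \<Theta> \<Longrightarrow> w \<in> \<W> \<Longrightarrow> \<bar>G x w\<bar> \<le> C * sqrt (U 2 w)"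
    and G_lip: "\<And>x x' w. x \<in> \<Theta> \<Longrightarrow> x' \<in> \<Theta> \<Longrightarrow> w \<in> \<W> \<Longrightarrow> \<bar>G x w - G x' w\<bar> \<le> C * sqrt (U 2 w) * norm (x - x')"
    and poisson: "\<And>x w. x \<in> \<Theta> \<Longrightarrow> w \<in> \<W> \<Longrightarrow>
      G x w - (\<integral>y. G x y \<partial>P x w) = (x - z) \<bullet> F x w - (x - z) \<bullet> m x"
    and mono: "\<And>x. x \<in> \<Theta> \<Longrightarrow> (x - z) \<bullet> m x \<le> - \<zeta> * (norm (x - z))\<^sup>2"
  shows "mean_on (\<lambda>\<omega>. (norm (\<theta> (Suc k) \<omega> - z))\<^sup>2) \<le> (1 - 2 * \<zeta> * \<alpha> k) * mean_on (\<lambda>\<omega>. (norm (\<theta> k \<omega> - z))\<^sup>2)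
    + 2 * \<alpha> k * (mean_on (\<lambda>\<omega>. G (\<theta> k \<omega>) (W k \<omega>)) - mean_on (\<lambda>\<omega>. G (\<theta> (Suc k) \<omega>) (W (Suc k) \<omega>)))
    + (2 * CF\<^sup>2 + 4 * C * CF) * (1 + b / (1 - \<rho>)) * (\<alpha> k)\<^sup>2 * mean_on (\<lambda>\<omega>. U 2 (W 0 \<omega>))"
    and "\<bar>mean_on (\<lambda>\<omega>. G (\<theta> k \<omega>) (W k \<omega>))\<bar> \<le> C * (1 + b / (1 - \<rho>)) * mean_on (\<lambda>\<omega>. U 2 (W 0 \<omega>))"
proof -
  let ?\<kappa>u = "(1 + b / (1 - \<rho>)) * mean_on (\<lambda>\<omega>. U 2 (W 0 \<omega>))"
  define X where "X k \<omega> = (norm (\<theta> k \<omega> - z))\<^sup>2" for k \<omega>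
  define Z where "Z k \<omega> = U 2 (W k \<omega>)" for k \<omega>
  define g where "g i j \<omega> = G (\<theta> i \<omega>) (W j \<omega>)" for i j \<omega>
  define p where "p \<omega> = (\<integral>y. G (\<theta> k \<omega>) y \<partial>P (\<theta> k \<omega>) (W k \<omega>))" for \<omega>
  have closed: "closed \<Theta>" using \<Theta> by (simp add: compact_imp_closed)
  have Z_int: "integrable M (\<lambda>\<omega>. indicator A \<omega> * Z j \<omega>)" for j
    unfolding Z_def by (rule second_moment(1))
  have Z_le: "mean_on (Z j) \<le> ?\<kappa>u" for j unfolding Z_def by (rule second_moment(2))
  have X_meas [measurable]: "X j \<in> borel_measurable M" for j
    unfolding X_def using process_borel(1) by measurable
  have g_meas [measurable]: "g i j \<in> borel_measurable M" for i j
    using measurable_compose[OF measurable_Pair[OF process_measurable(1)[of i] process_measurable(2)[of j]] G]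
    by (simp add: g_def[abs_def])
  have cZ_int: "integrable M (\<lambda>\<omega>. indicator A \<omega> * (c * Z j \<omega>))" for c j
    using integrable_mult_right[OF Z_int[of j], of c] by (simp add: mult_ac)
  have mean_on_cZ: "mean_on (\<lambda>\<omega>. c * Z j \<omega>) = c * mean_on (Z j)" for c j
    unfolding mean_on_def by (subst Bochner_Integration.integral_mult_right_zero[symmetric]) (simp add: mult_ac)
  have G_U: "\<bar>G x w\<bar> \<le> C * U 2 w" if "x \<in> \<Theta>" "w \<in> \<W>" for x w
    by (rule order_trans[OF G_le[OF that] mult_left_mono[OF sqrt_U_bounds(2) C(1)]])
  have g_Z: "\<bar>g i j \<omega>\<bar> \<le> C * Z j \<omega>" if "\<omega> \<in> space M" for i j \<omega>
    unfolding g_def Z_def by (rule G_U) (rule process_in[OF that])+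
  have g_int: "integrable M (\<lambda>\<omega>. indicator A \<omega> * g i j \<omega>)" and g_EA: "\<bar>mean_on (g i j)\<bar> \<le> C * mean_on (Z j)" for i j
    using mean_on_dominated[OF g_meas g_Z cZ_int] mean_on_cZ by auto
  have "\<bar>mean_on (g k k)\<bar> \<le> C * ?\<kappa>u"
    by (rule order_trans[OF g_EA mult_left_mono[OF Z_le C(1)]])
  then show "\<bar>mean_on (\<lambda>\<omega>. G (\<theta> k \<omega>) (W k \<omega>))\<bar> \<le> C * (1 + b / (1 - \<rho>)) * mean_on (\<lambda>\<omega>. U 2 (W 0 \<omega>))"
    by (simp add: g_def[abs_def] mult.assoc)
  have p_int: "integrable M (\<lambda>\<omega>. indicator A \<omega> * p \<omega>)" and p_EA: "mean_on p = mean_on (g k (Suc k))"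
    using markov_real[OF G G_U, of k] by (simp_all add: p_def[abs_def] g_def[abs_def])
  obtain R where R: "\<And>x. x \<in> \<Theta> \<Longrightarrow> (norm (x - z))\<^sup>2 \<le> R"
  proof -
    obtain r where r: "\<And>x. x \<in> \<Theta> \<Longrightarrow> norm x \<le> r"
      using compact_imp_bounded[OF \<Theta>(1)] unfolding bounded_iff by blast
    have "(norm (x - z))\<^sup>2 \<le> (r + r)\<^sup>2" if "x \<in> \<Theta>" for x
      using r[OF that] r[OF \<Theta>(3)] norm_triangle_ineq4[of x z] by (intro power_mono) auto
    then show ?thesis by (rule that)
  qed
  have X_int: "integrable M (\<lambda>\<omega>. indicator A \<omega> * X j \<omega>)" for j
  proof (rule mean_on_dominated(1)[OF X_meas])
    show "\<bar>X j \<omega>\<bar> \<le> R" if "\<omega> \<in> space M" for \<omega>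
      using R[OF process_in(1)[OF that]] by (simp add: X_def)
    show "integrable M (\<lambda>\<omega>. indicator A \<omega> * R)"
      using integrable_mult_indicator[OF A_sets integrable_const[of R]] by simp
  qed
  have step: "AE \<omega> in M. \<theta> (Suc k) \<omega> = closest_point \<Theta> (\<theta> k \<omega> + \<alpha> k *\<^sub>R F (\<theta> k \<omega>) (W k \<omega>))"
    using SA by (simp add: adaptive_SA_def)
  have F_sq: "(norm (F x w))\<^sup>2 \<le> 2 * CF\<^sup>2 * U 2 w" if "x \<in> \<Theta>" "w \<in> \<W>" for x w
  proof -
    have "(norm (F x w))\<^sup>2 \<le> (CF * (1 + norm w))\<^sup>2" by (rule power_mono[OF F_le[OF that]]) simp
    also have "\<dots> = CF\<^sup>2 * (1 + norm w)\<^sup>2" by (rule power_mult_distrib)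
    also have "\<dots> \<le> CF\<^sup>2 * (2 * U 2 w)"
    proof (rule mult_left_mono)
      have "0 \<le> (1 - norm w)\<^sup>2" by simp
      then show "(1 + norm w)\<^sup>2 \<le> 2 * U 2 w" by (simp add: U_def power2_eq_square algebra_simps)
    qed simp
    finally show ?thesis by (simp add: mult_ac)
  qed
  have X_step: "AE \<omega> in M. indicator A \<omega> * X (Suc k) \<omega> \<le> (1 - 2 * \<zeta> * \<alpha> k) * (indicator A \<omega> * X k \<omega>)
      + 2 * \<alpha> k * (indicator A \<omega> * g k k \<omega> - indicator A \<omega> * p \<omega>)
      + 2 * CF\<^sup>2 * (\<alpha> k)\<^sup>2 * (indicator A \<omega> * Z k \<omega>)"
    using step AE_space
  proof eventually_elim
    case (elim \<omega>)
    note x = process_in[OF elim(2), of k]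
    have "X (Suc k) \<omega> \<le> X k \<omega> + 2 * \<alpha> k * ((\<theta> k \<omega> - z) \<bullet> F (\<theta> k \<omega>) (W k \<omega>))
        + (\<alpha> k)\<^sup>2 * (norm (F (\<theta> k \<omega>) (W k \<omega>)))\<^sup>2"
      unfolding X_def elim(1) by (rule project_step_le(1)[OF closed \<Theta>(2) x(1) \<Theta>(3) \<alpha>])
    moreover have "(\<theta> k \<omega> - z) \<bullet> F (\<theta> k \<omega>) (W k \<omega>) \<le> - \<zeta> * X k \<omega> + (g k k \<omega> - p \<omega>)"
      using poisson[OF x] mono[OF x(1)] by (simp add: g_def p_def X_def)
    then have "2 * \<alpha> k * ((\<theta> k \<omega> - z) \<bullet> F (\<theta> k \<omega>) (W k \<omega>)) \<le> 2 * \<alpha> k * (- \<zeta> * X k \<omega> + (g k k \<omega> - p \<omega>))"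
      using \<alpha> by (intro mult_left_mono) auto
    moreover have "(\<alpha> k)\<^sup>2 * (norm (F (\<theta> k \<omega>) (W k \<omega>)))\<^sup>2 \<le> (\<alpha> k)\<^sup>2 * (2 * CF\<^sup>2 * Z k \<omega>)"
      unfolding Z_def by (intro mult_left_mono F_sq x) simp
    ultimately have "X (Suc k) \<omega> \<le> (1 - 2 * \<zeta> * \<alpha> k) * X k \<omega> + 2 * \<alpha> k * (g k k \<omega> - p \<omega>)
        + 2 * CF\<^sup>2 * (\<alpha> k)\<^sup>2 * Z k \<omega>"
      by (simp add: algebra_simps)
    then show ?case by (simp add: indicator_def)
  qed
  have "mean_on (X (Suc k)) \<le> (\<integral>\<omega>. (1 - 2 * \<zeta> * \<alpha> k) * (indicator A \<omega> * X k \<omega>)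
      + 2 * \<alpha> k * (indicator A \<omega> * g k k \<omega> - indicator A \<omega> * p \<omega>)
      + 2 * CF\<^sup>2 * (\<alpha> k)\<^sup>2 * (indicator A \<omega> * Z k \<omega>) \<partial>M)"
    unfolding mean_on_def
    by (rule integral_mono_AE[OF X_int _ X_step])
       (intro Bochner_Integration.integrable_add Bochner_Integration.integrable_diff integrable_mult_right
          X_int g_int p_int Z_int)
  also have "\<dots> = (1 - 2 * \<zeta> * \<alpha> k) * mean_on (X k) + 2 * \<alpha> k * (mean_on (g k k) - mean_on p) + 2 * CF\<^sup>2 * (\<alpha> k)\<^sup>2 * mean_on (Z k)"
    using X_int[of k] g_int[of k k] p_int Z_int[of k] by (simp add: mean_on_def)
  finally have main: "mean_on (X (Suc k)) \<le> (1 - 2 * \<zeta> * \<alpha> k) * mean_on (X k)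
      + 2 * \<alpha> k * (mean_on (g k k) - mean_on (g k (Suc k))) + 2 * CF\<^sup>2 * (\<alpha> k)\<^sup>2 * mean_on (Z k)" by (simp only: p_EA)
  have g_step: "AE \<omega> in M. indicator A \<omega> * g (Suc k) (Suc k) \<omega> - indicator A \<omega> * g k (Suc k) \<omega>
      \<le> C * CF * \<alpha> k * (indicator A \<omega> * Z (Suc k) \<omega> + indicator A \<omega> * Z k \<omega>)"
    using step AE_space
  proof eventually_elim
    case (elim \<omega>)
    note x = process_in[OF elim(2), of k] and x' = process_in[OF elim(2), of "Suc k"]
    let ?V = "\<lambda>j. sqrt (Z j \<omega>)"
    have V0: "0 \<le> ?V j" for j unfolding Z_def using sqrt_U_bounds(1)[of "W j \<omega>"] by linarith
    have Z0: "0 \<le> Z j \<omega>" for j unfolding Z_def using U_ge_1[of "W j \<omega>"] by linarith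
    have "norm (\<theta> (Suc k) \<omega> - \<theta> k \<omega>) \<le> \<alpha> k * norm (F (\<theta> k \<omega>) (W k \<omega>))"
      unfolding elim(1) by (rule project_step_le(2)[OF closed \<Theta>(2) x(1) \<Theta>(3) \<alpha>])
    also have "\<dots> \<le> \<alpha> k * (CF * (2 * ?V k))"
    proof (rule mult_left_mono[OF _ \<alpha>])
      have "CF * (1 + norm (W k \<omega>)) \<le> CF * (2 * ?V k)"
        unfolding Z_def by (rule mult_left_mono[OF sqrt_U_bounds(4) C(2)])
      then show "norm (F (\<theta> k \<omega>) (W k \<omega>)) \<le> CF * (2 * ?V k)" using F_le[OF x] by linarith
    qed
    finally have d: "norm (\<theta> (Suc k) \<omega> - \<theta> k \<omega>) \<le> \<alpha> k * (CF * (2 * ?V k))" .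
    have "g (Suc k) (Suc k) \<omega> - g k (Suc k) \<omega> \<le> C * ?V (Suc k) * norm (\<theta> (Suc k) \<omega> - \<theta> k \<omega>)"
      using G_lip[OF x'(1) x(1) x'(2)] by (simp add: g_def Z_def)
    also have "\<dots> \<le> C * ?V (Suc k) * (\<alpha> k * (CF * (2 * ?V k)))"
      using C V0 by (intro mult_left_mono d) auto
    also have "\<dots> = C * CF * \<alpha> k * (2 * ?V (Suc k) * ?V k)" by (simp add: mult_ac)
    also have "\<dots> \<le> C * CF * \<alpha> k * (Z (Suc k) \<omega> + Z k \<omega>)"
    proof (rule mult_left_mono)
      \<comment> \<open>This turns the product of the weights at consecutive times into second moments.\<close>
      have "0 \<le> (?V (Suc k) - ?V k)\<^sup>2" by simp
      then show "2 * ?V (Suc k) * ?V k \<le> Z (Suc k) \<omega> + Z k \<omega>"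
        using Z0 by (simp add: power2_diff)
      show "0 \<le> C * CF * \<alpha> k" using C \<alpha> by simp
    qed
    finally show ?case by (simp add: indicator_def)
  qed
  have "mean_on (g (Suc k) (Suc k)) - mean_on (g k (Suc k))
      = (\<integral>\<omega>. indicator A \<omega> * g (Suc k) (Suc k) \<omega> - indicator A \<omega> * g k (Suc k) \<omega> \<partial>M)"
    unfolding mean_on_def by (rule Bochner_Integration.integral_diff[symmetric, OF g_int g_int])
  also have "\<dots> \<le> (\<integral>\<omega>. C * CF * \<alpha> k * (indicator A \<omega> * Z (Suc k) \<omega> + indicator A \<omega> * Z k \<omega>) \<partial>M)"
    by (rule integral_mono_AE[OF _ _ g_step])
       (intro Bochner_Integration.integrable_add Bochner_Integration.integrable_diff integrable_mult_right g_int Z_int)+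
  also have "\<dots> = C * CF * \<alpha> k * (mean_on (Z (Suc k)) + mean_on (Z k))"
    using Z_int[of k] Z_int[of "Suc k"] by (simp add: mean_on_def)
  also have "\<dots> \<le> C * CF * \<alpha> k * (?\<kappa>u + ?\<kappa>u)"
    using C \<alpha> by (intro mult_left_mono add_mono Z_le) auto
  finally have "mean_on (g (Suc k) (Suc k)) - mean_on (g k (Suc k)) \<le> 2 * C * CF * \<alpha> k * ?\<kappa>u"
    by (simp only: mult_2[symmetric] mult_ac)
  then have "2 * \<alpha> k * (mean_on (g (Suc k) (Suc k)) - mean_on (g k (Suc k))) \<le> 2 * \<alpha> k * (2 * C * CF * \<alpha> k * ?\<kappa>u)"
    using \<alpha> by (intro mult_left_mono) auto
  moreover have "2 * CF\<^sup>2 * (\<alpha> k)\<^sup>2 * mean_on (Z k) \<le> 2 * CF\<^sup>2 * (\<alpha> k)\<^sup>2 * ?\<kappa>u"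
    by (intro mult_left_mono Z_le) auto
  ultimately have bound: "mean_on (X (Suc k)) \<le> (1 - 2 * \<zeta> * \<alpha> k) * mean_on (X k)
      + 2 * \<alpha> k * (mean_on (g k k) - mean_on (g (Suc k) (Suc k)))
      + 2 * \<alpha> k * (2 * C * CF * \<alpha> k * ?\<kappa>u) + 2 * CF\<^sup>2 * (\<alpha> k)\<^sup>2 * ?\<kappa>u"
    using main unfolding right_diff_distrib by linarith
  have collect: "2 * a * (2 * C * CF * a * (\<kappa> * u)) + 2 * CF\<^sup>2 * a\<^sup>2 * (\<kappa> * u)
      = (2 * CF\<^sup>2 + 4 * C * CF) * \<kappa> * a\<^sup>2 * u" for a \<kappa> u :: real
    by (simp add: power2_eq_square algebra_simps)
  have "(1 - 2 * \<zeta> * \<alpha> k) * mean_on (X k)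
      + 2 * \<alpha> k * (mean_on (g k k) - mean_on (g (Suc k) (Suc k)))
      + 2 * \<alpha> k * (2 * C * CF * \<alpha> k * ?\<kappa>u) + 2 * CF\<^sup>2 * (\<alpha> k)\<^sup>2 * ?\<kappa>u
    = (1 - 2 * \<zeta> * \<alpha> k) * mean_on (X k)
      + 2 * \<alpha> k * (mean_on (g k k) - mean_on (g (Suc k) (Suc k)))
      + (2 * CF\<^sup>2 + 4 * C * CF) * (1 + b / (1 - \<rho>)) * (\<alpha> k)\<^sup>2 * mean_on (\<lambda>\<omega>. U 2 (W 0 \<omega>))"
    by (simp only: collect add.assoc)
  with bound show "mean_on (\<lambda>\<omega>. (norm (\<theta> (Suc k) \<omega> - z))\<^sup>2) \<le> (1 - 2 * \<zeta> * \<alpha> k) * mean_on (\<lambda>\<omega>. (norm (\<theta> k \<omega> - z))\<^sup>2)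
    + 2 * \<alpha> k * (mean_on (\<lambda>\<omega>. G (\<theta> k \<omega>) (W k \<omega>)) - mean_on (\<lambda>\<omega>. G (\<theta> (Suc k) \<omega>) (W (Suc k) \<omega>)))
    + (2 * CF\<^sup>2 + 4 * C * CF) * (1 + b / (1 - \<rho>)) * (\<alpha> k)\<^sup>2 * mean_on (\<lambda>\<omega>. U 2 (W 0 \<omega>))"
    by (simp only: X_def[abs_def] g_def[abs_def])
qed

end

end

section \<open>The convergence rate\<close>

theorem proposition1:
  fixes \<Theta> :: "'a::euclidean_space set"
    and \<W> :: "'b::euclidean_space set"
    and F :: "'a \<Rightarrow> 'b \<Rightarrow> 'a"
    and P :: "'a \<Rightarrow> 'b \<Rightarrow> 'b measure"
    and \<alpha>\<^sub>0 \<delta> \<zeta> :: real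
    and \<theta>star :: 'a
  assumes model: "model \<Theta> \<W> F P"
    and step_sizes: "\<alpha>\<^sub>0 > 0" "0 < \<delta>" "\<delta> \<le> 1"
    and compactness: "\<Theta> \<noteq> {}" "compact \<Theta>" "convex \<Theta>"
    and ergodicity: "ergodicity \<Theta> \<W> P"
    and kernel_continuity: "kernel_continuity \<Theta> \<W> P"
    and growth: "growth \<Theta> \<W> F"
    and interior_target: "\<theta>star \<in> interior \<Theta>" "mean_field \<W> F P \<theta>star = 0"
    and quasi_strong_monotonicity: "\<zeta> > 0"
      "\<forall>\<theta>\<in>\<Theta>. (\<theta> - \<theta>star) \<bullet> mean_field \<W> F P \<theta> \<le> - \<zeta> * (norm (\<theta> - \<theta>star))\<^sup>2"
    and critical_step: "\<delta> = 1 \<Longrightarrow> 2 * \<zeta> * \<alpha>\<^sub>0 > 1"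
  shows "\<exists>C>0. \<exists>K>0. \<forall>(M :: 'w measure) \<theta> W.
    adaptive_SA \<Theta> \<W> F P (step_size \<alpha>\<^sub>0 \<delta>) M \<theta> W \<and> integrable M (\<lambda>\<omega>. U 2 (W 0 \<omega>)) \<longrightarrow>
    (\<forall>k\<ge>K. AE \<omega> in M.
       real_cond_exp M (history M \<theta> W 0) (\<lambda>\<omega>'. (norm (\<theta> k \<omega>' - \<theta>star))\<^sup>2) \<omega>
         \<le> C * U 2 (W 0 \<omega>) * (1 + ln (real k)) * real k powr (-\<delta>))"
proof -
  have closed: "closed \<Theta>" and bounded: "bounded \<Theta>"
    using compactness by (auto simp: compact_imp_closed compact_imp_bounded)
  have z: "\<theta>star \<in> \<Theta>" using interior_target interior_subset by blast
  obtain G C\<^sub>G \<rho> b where C\<^sub>G: "0 \<le> C\<^sub>G" and \<rho>: "0 \<le> \<rho>" "\<rho> < 1" and b: "0 \<le> b"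
    and drift: "\<And>\<theta> w. \<theta> \<in> \<Theta> \<Longrightarrow> w \<in> \<W> \<Longrightarrow> (\<integral>\<^sup>+y. ennreal (U 2 y) \<partial>P \<theta> w) \<le> ennreal (\<rho> * U 2 w + b)"
    and G: "(\<lambda>(\<theta>, w). G \<theta> w) \<in> borel_measurable (restrict_space borel \<Theta> \<Otimes>\<^sub>M restrict_space borel \<W>)"
    and G_le: "\<And>\<theta> w. \<theta> \<in> \<Theta> \<Longrightarrow> w \<in> \<W> \<Longrightarrow> \<bar>G \<theta> w\<bar> \<le> C\<^sub>G * sqrt (U 2 w)"
    and G_lip: "\<And>\<theta> \<theta>' w. \<theta> \<in> \<Theta> \<Longrightarrow> \<theta>' \<in> \<Theta> \<Longrightarrow> w \<in> \<W> \<Longrightarrow>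
      \<bar>G \<theta> w - G \<theta>' w\<bar> \<le> C\<^sub>G * sqrt (U 2 w) * norm (\<theta> - \<theta>')"
    and poisson: "\<And>\<theta> w. \<theta> \<in> \<Theta> \<Longrightarrow> w \<in> \<W> \<Longrightarrow> G \<theta> w - (\<integral>y. G \<theta> y \<partial>P \<theta> w)
      = (\<theta> - \<theta>star) \<bullet> F \<theta> w - (\<theta> - \<theta>star) \<bullet> mean_field \<W> F P \<theta>"
    by (rule model_poisson[OF model compactness(1) bounded ergodicity kernel_continuity growth, of \<theta>star]) blast
  obtain C\<^sub>F where C\<^sub>F: "0 \<le> C\<^sub>F"
    and F_le: "\<And>\<theta> w. \<theta> \<in> \<Theta> \<Longrightarrow> w \<in> \<W> \<Longrightarrow> norm (F \<theta> w) \<le> C\<^sub>F * (1 + norm w)"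
    using growth unfolding growth_def by (metis less_imp_le)
  obtain \<Delta> where \<Delta>: "\<And>\<theta>. \<theta> \<in> \<Theta> \<Longrightarrow> (norm (\<theta> - \<theta>star))\<^sup>2 \<le> \<Delta>"
  proof -
    obtain r where r: "\<And>\<theta>. \<theta> \<in> \<Theta> \<Longrightarrow> norm \<theta> \<le> r" using bounded unfolding bounded_iff by blast
    have "(norm (\<theta> - \<theta>star))\<^sup>2 \<le> (r + r)\<^sup>2" if "\<theta> \<in> \<Theta>" for \<theta>
      using r[OF that] r[OF z] norm_triangle_ineq4[of \<theta> \<theta>star] by (intro power_mono) auto
    then show ?thesis by (rule that)
  qed
  have \<Delta>0: "0 \<le> \<Delta>" using \<Delta>[OF z] by simp
  define \<kappa> where "\<kappa> = 1 + b / (1 - \<rho>)"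
  have \<kappa>: "0 \<le> \<kappa>" using \<rho> b by (simp add: \<kappa>_def)
  define \<Gamma> where "\<Gamma> = (2 * C\<^sub>F\<^sup>2 + 4 * C\<^sub>G * C\<^sub>F) * \<kappa>"
  have \<Gamma>: "0 \<le> \<Gamma>" using C\<^sub>F C\<^sub>G \<kappa> by (simp add: \<Gamma>_def)
  have C\<^sub>G\<kappa>: "0 \<le> C\<^sub>G * \<kappa>" using C\<^sub>G \<kappa> by simp
  let ?\<alpha> = "step_size \<alpha>\<^sub>0 \<delta>"
  have \<alpha>: "0 \<le> ?\<alpha> k" for k using step_sizes by (simp add: step_size_def)
  obtain C K where C: "0 < C" and K: "0 < K"
    and chung: "\<And>(D :: nat \<Rightarrow> real) g u k. 0 \<le> u \<Longrightarrow> (\<And>k. D k \<le> \<Delta> * u) \<Longrightarrow> (\<And>k. \<bar>g k\<bar> \<le> C\<^sub>G * \<kappa> * u) \<Longrightarrow>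
      (\<And>k. D (Suc k) \<le> (1 - 2 * \<zeta> * ?\<alpha> k) * D k
         + 2 * ?\<alpha> k * (g k - g (Suc k)) + \<Gamma> * (?\<alpha> k)\<^sup>2 * u) \<Longrightarrow>
      K \<le> k \<Longrightarrow> D k \<le> C * u * real k powr -\<delta>"
    by (rule chung_recursion[OF step_sizes quasi_strong_monotonicity(1) critical_step \<Delta>0 C\<^sub>G\<kappa> \<Gamma>]) blast+
  show ?thesis
  proof (intro exI conjI allI impI)
    show "0 < C" "0 < K" by (fact C K)+
    fix M :: "'w measure" and \<theta> W k
    assume "adaptive_SA \<Theta> \<W> F P ?\<alpha> M \<theta> W \<and> integrable M (\<lambda>\<omega>. U 2 (W 0 \<omega>))"
    then have SA: "adaptive_SA \<Theta> \<W> F P ?\<alpha> M \<theta> W" and W0: "integrable M (\<lambda>\<omega>. U 2 (W 0 \<omega>))" by auto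
    assume k: "K \<le> k"
    interpret adaptive_chain \<Theta> \<W> F P ?\<alpha> M \<theta> W by unfold_locales (fact model, fact SA)
    define X where "X k \<omega> = (norm (\<theta> k \<omega> - \<theta>star))\<^sup>2" for k \<omega>
    define Y where "Y \<omega> = C * U 2 (W 0 \<omega>) * (1 + ln (real k)) * real k powr -\<delta>" for \<omega>
    have X_meas: "X k \<in> borel_measurable M" for k
      unfolding X_def using process_borel(1) by measurable
    have X_le: "\<bar>X k \<omega>\<bar> \<le> \<Delta>" if "\<omega> \<in> space M" for k \<omega>
      using \<Delta>[OF process_in(1)[OF that]] by (simp add: X_def)
    have X_int: "integrable M (X k)" for k
      by (rule integrable_const_bound[where B = \<Delta>]) (use X_meas X_le in auto)
    have Y_int: "integrable M Y" unfolding Y_def using W0 by simp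
    have Y_meas: "Y \<in> borel_measurable (history M \<theta> W 0)"
      unfolding Y_def using measurable_compose[OF W0_history U_measurable] by measurable
    have "(\<integral>\<omega>. indicator A \<omega> * X k \<omega> \<partial>M) \<le> (\<integral>\<omega>. indicator A \<omega> * Y \<omega> \<partial>M)"
      if A: "A \<in> sets (history M \<theta> W 0)" for A
    proof -
      let ?E = "mean_on A"
      let ?u = "?E (\<lambda>\<omega>. U 2 (W 0 \<omega>))"
      note chain = A \<rho> b drift W0
      have E_def: "?E f = (\<integral>\<omega>. indicator A \<omega> * f \<omega> \<partial>M)" for f by (rule mean_on_def[OF chain])
      have AM: "A \<in> sets M" by (rule A_sets[OF chain])
      have u_int: "integrable M (\<lambda>\<omega>. indicator A \<omega> * (\<Delta> * U 2 (W 0 \<omega>)))"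
        using integrable_mult_indicator[OF AM integrable_mult_right[OF W0, of \<Delta>]] by simp
      have Eu: "?E (\<lambda>\<omega>. c * U 2 (W 0 \<omega>)) = c * ?u" for c
        unfolding E_def by (subst Bochner_Integration.integral_mult_right_zero[symmetric]) (simp add: mult_ac)
      have u: "0 \<le> ?u"
        unfolding E_def by (rule Bochner_Integration.integral_nonneg) (simp add: U_def)
      have D_le: "?E (X k) \<le> \<Delta> * ?u" for k
      proof -
        have "\<bar>?E (X k)\<bar> \<le> ?E (\<lambda>\<omega>. \<Delta> * U 2 (W 0 \<omega>))"
        proof (rule mean_on_dominated(2)[OF chain X_meas _ u_int])
          fix \<omega> assume \<omega>: "\<omega> \<in> space M"
          have "\<Delta> * 1 \<le> \<Delta> * U 2 (W 0 \<omega>)" by (intro mult_left_mono U_ge_1 \<Delta>0)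
          then show "\<bar>X k \<omega>\<bar> \<le> \<Delta> * U 2 (W 0 \<omega>)" using X_le[OF \<omega>, of k] by simp
        qed
        then show ?thesis by (simp add: Eu)
      qed
      note rec = error_recursion[OF chain compactness(2,3) z \<alpha> C\<^sub>G C\<^sub>F F_le G G_le G_lip poisson
          quasi_strong_monotonicity(2)[rule_format]]
      have "?E (X k) \<le> C * ?u * real k powr -\<delta>"
      proof (rule chung[OF u D_le _ _ k])
        show "\<bar>?E (\<lambda>\<omega>. G (\<theta> k \<omega>) (W k \<omega>))\<bar> \<le> C\<^sub>G * \<kappa> * ?u" for k
          unfolding \<kappa>_def by (rule rec(2))
        show "?E (X (Suc k)) \<le> (1 - 2 * \<zeta> * ?\<alpha> k) * ?E (X k)
            + 2 * ?\<alpha> k * (?E (\<lambda>\<omega>. G (\<theta> k \<omega>) (W k \<omega>)) - ?E (\<lambda>\<omega>. G (\<theta> (Suc k) \<omega>) (W (Suc k) \<omega>)))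
            + \<Gamma> * (?\<alpha> k)\<^sup>2 * ?u" for k
          unfolding X_def[abs_def] \<Gamma>_def \<kappa>_def by (rule rec(1))
      qed
      also have "\<dots> \<le> C * ?u * (1 + ln (real k)) * real k powr -\<delta>"
      proof (rule mult_right_mono)
        have "0 \<le> ln (real k)" using k K by simp
        then have "C * ?u * 1 \<le> C * ?u * (1 + ln (real k))" using C u by (intro mult_left_mono) auto
        then show "C * ?u \<le> C * ?u * (1 + ln (real k))" by simp
      qed simp
      also have "\<dots> = (C * (1 + ln (real k)) * real k powr -\<delta>) * ?u" by (simp only: mult_ac)
      also have "\<dots> = ?E (\<lambda>\<omega>. (C * (1 + ln (real k)) * real k powr -\<delta>) * U 2 (W 0 \<omega>))"
        by (rule Eu[symmetric])
      also have "\<dots> = (\<integral>\<omega>. indicator A \<omega> * Y \<omega> \<partial>M)"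
        unfolding E_def Y_def by (simp only: mult_ac)
      finally show ?thesis unfolding E_def .
    qed
    then have "AE \<omega> in M. real_cond_exp M (history M \<theta> W 0) (X k) \<omega> \<le> Y \<omega>"
      by (rule history.real_cond_exp_le_of_set_integrals[OF X_int Y_int Y_meas])
    then show "AE \<omega> in M. real_cond_exp M (history M \<theta> W 0) (\<lambda>\<omega>'. (norm (\<theta> k \<omega>' - \<theta>star))\<^sup>2) \<omega>
        \<le> C * U 2 (W 0 \<omega>) * (1 + ln (real k)) * real k powr -\<delta>"
      by (simp only: X_def[abs_def] Y_def)
  qed
qed

end
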